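(* Let $D$ be a shifted skew diagram, $X,Y$ finite sets of positive integers, and let $G=G^{\mathrm{bip}}_{X,Y}(D)$. Let $R_G$ (resp. $H_G$) be the unique (up to isomorphism) row-nested (resp. horizontal) bipartite graph with the same row sizes as $G$, i.e. with $\deg(x)=\deg_G(x)$ for all $x\in X$. Then for all $i$ and all $X'\subseteq X$, $$\beta_{i,X',\bullet}(I(R_G))\le\beta_{i,X',\bullet}(I(G))\le\beta_{i,X',\bullet}(I(H_G)),$$ where $$\beta_{i,X',\bullet}(I(R_G))=\begin{cases}\binom{\mathrm{mindeg}(X')}{i-|X'|+2}&\text{if }|X'|<i+2,\\0&\text{otherwise,}\end{cases}\qquad \beta_{i,X',\bullet}(I(H_G))=\binom{|\deg(X')|}{i+1},$$ with $\mathrm{mindeg}(X'):=\min\{\deg_G(x):x\in X'\}$ and $|\deg(X')|:=\sum_{x\in X'}\deg_G(x)$. Furthermore, equality occurs for all $i$ and all $X'$ in the first (resp. second) inequality if and only if $G$ is nearly-row-nested (resp. horizontal-vertical).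
   Context: Given integers $\lambda_1>\dots>\lambda_\ell>0$ and $\mu_1>\dots>\mu_r>0$ with $0\le r\le \ell$ and $\mu_i<\lambda_i$ for $1\le i\le \ell$ (where $\mu_i:=0$ for $i>r$), the associated shifted skew diagram is $D=\{(i,j)\in\mathbb Z^2: 1\le i\le \ell,\ i+\mu_i+1\le j\le i+\lambda_i\}$. For finite sets of positive integers $X,Y$, $G^{\mathrm{bip}}_{X,Y}(D)$ is the bipartite graph on the disjoint union $X\sqcup Y$ (even if $X,Y$ share integers) with an edge joining $x\in X$ to $y\in Y$ iff $(x,y)\in D$. For a bipartite graph $G$ on $X\sqcup Y$, its diagram is $\{(x,y):\{x,y\}\in E(G)\}\subseteq X\times Y$ (elements: cells), the row of $x\in X$ is $R_x=\{y\in Y:\{x,y\}\in E(G)\}$, the column of $y\in Y$ is $\{x\in X:\{x,y\}\in E(G)\}$. $G$ is: row-nested if $\{R_x\}_{x\in X}$ is totally ordered by inclusion; nearly-row-nested if $|R_x|<|R_{x'}|$ implies $R_x\subset R_{x'}$ and for each cardinality $c\ge0$ one has $|\bigcap_{x:|R_x|=c}R_x|\in\{c-1,c\}$ (in other words, rows of different cardinalities are nested, while all the rows of a given cardinality $c$ are either all the same or have a common intersection of cocardinality $1$); horizontal if every cell is alone within its column; horizontal-vertical if every cell is alone within its column or alone within its row (or both). $R_G$ and $H_G$ have vertex sets $X\sqcup Y''$ for suitable finite sets $Y''$. Let $k$ be a field. $I(G)\subset k[X\sqcup Y]$ is the edge ideal, generated by the monomials $xy$ for edges $\{x,y\}$ of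 $G$. For $X'\subseteq X$, $Y'\subseteq Y$, $\beta_{i,X'\sqcup Y'}(I(G))=\dim_k\mathrm{Tor}_i^{k[X\sqcup Y]}(I(G),k)_{X'\sqcup Y'}$ in the multidegree given by the indicator vector of $X'\sqcup Y'$, and $\beta_{i,X',\bullet}(I(G))=\sum_{Y'\subseteq Y}\beta_{i,X'\sqcup Y'}(I(G))$; likewise for $R_G$ and $H_G$.
   Formalization: The formula for H_G is false as written (two rows of size 1, i=0, X'={x1,x2}: 0, not 2); the formal version states that the sum over all X''⊆X' of β_{i,X'',•}(I(H_G)) equals binom(|deg(X')|, i+1). *)

theory Defs
  imports Complex_Main "HOL-Library.Poly_Mapping"
begin

section \<open>Disjoint unions as ordered sets\<close>

text \<open>The order fixes the signs in the Koszul complex of a polynomial ring with variables \<open>X <+> Y\<close>.\<close>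

instantiation sum :: (linorder, linorder) linorder
begin

fun less_eq_sum :: "'a + 'b \<Rightarrow> 'a + 'b \<Rightarrow> bool" where
  "less_eq_sum (Inl a) (Inl b) \<longleftrightarrow> a \<le> b"
| "less_eq_sum (Inl a) (Inr b) \<longleftrightarrow> True"
| "less_eq_sum (Inr a) (Inl b) \<longleftrightarrow> False"
| "less_eq_sum (Inr a) (Inr b) \<longleftrightarrow> a \<le> b"

definition less_sum :: "'a + 'b \<Rightarrow> 'a + 'b \<Rightarrow> bool" where
  "less_sum x y \<longleftrightarrow> x \<le> y \<and> \<not> y \<le> (x :: 'a + 'b)"

instance
proof
  fix x y z :: "'a + 'b"
  show "x < y \<longleftrightarrow> x \<le> y \<and> \<not> y \<le> x" by (rule less_sum_def)
  show "x \<le> x" by (cases x) auto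
  show "x \<le> y \<Longrightarrow> y \<le> z \<Longrightarrow> x \<le> z" by (cases x; cases y; cases z) auto
  show "x \<le> y \<Longrightarrow> y \<le> x \<Longrightarrow> x = y" by (cases x; cases y) auto
  show "x \<le> y \<or> y \<le> x" by (cases x; cases y) auto
qed

end

section \<open>Polynomial rings and edge ideals\<close>

type_synonym ('v, 'k) mpoly = "('v \<Rightarrow>\<^sub>0 nat) \<Rightarrow>\<^sub>0 'k"

definition poly_ring :: "'v set \<Rightarrow> ('v, 'k::field) mpoly set" where
  "poly_ring V = {p. \<forall>m \<in> Poly_Mapping.keys p. Poly_Mapping.keys m \<subseteq> V}"

definition mvar :: "'v \<Rightarrow> ('v, 'k::field) mpoly" where
  "mvar v = Poly_Mapping.single (Poly_Mapping.single v 1) 1"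

text \<open>The ideal of \<open>k[V]\<close> generated by a finite set \<open>B\<close>.\<close>

definition ideal_gen :: "'v set \<Rightarrow> ('v, 'k::field) mpoly set \<Rightarrow> ('v, 'k) mpoly set" where
  "ideal_gen V B = {\<Sum>b\<in>B. c b * b | c. \<forall>b\<in>B. c b \<in> poly_ring V}"

text \<open>
  A bipartite graph on the disjoint union \<open>X <+> Y\<close> is given by its diagram \<open>E \<subseteq> X \<times> Y\<close>:
  the pair \<open>(x, y) \<in> E\<close> stands for the edge joining \<open>Inl x\<close> and \<open>Inr y\<close>.
\<close>

definition bipartite_graph :: "'a set \<Rightarrow> 'b set \<Rightarrow> ('a \<times> 'b) set \<Rightarrow> bool" where
  "bipartite_graph X Y E \<longleftrightarrow> finite X \<and> finite Y \<and> E \<subseteq> X \<times> Y"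

definition edge_ideal :: "'a set \<Rightarrow> 'b set \<Rightarrow> ('a \<times> 'b) set \<Rightarrow> ('a + 'b, 'k::field) mpoly set" where
  "edge_ideal X Y E = ideal_gen (X <+> Y) {mvar (Inl x) * mvar (Inr y) | x y. (x, y) \<in> E}"

section \<open>Multigraded Betti numbers\<close>

text \<open>
  \<open>Tor\<^sub>i(I, k)\<close> over \<open>S = k[V]\<close> is the homology of \<open>I \<otimes>\<^sub>S K\<close>, where \<open>K\<close> is the Koszul complex of the
  variables, a free resolution of \<open>k\<close>: \<open>K\<^sub>i\<close> is free over \<open>S\<close> on the symbols \<open>e\<^sub>F\<close> with
  \<open>F \<subseteq> V\<close>, \<open>card F = i\<close>, the symbol \<open>e\<^sub>F\<close> having multidegree the indicator of \<open>F\<close>, and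
  the differential sends \<open>e\<^sub>F\<close> to the alternating sum of the \<open>x\<^sub>v e\<^bsub>F - {v}\<^esub>\<close>.
  An element of \<open>I \<otimes>\<^sub>S K\<^sub>i\<close> is a finitely supported map \<open>F \<mapsto> (coefficient of e\<^sub>F) \<in> I\<close>.
  The lemmas \<open>koszul_diff_diff\<close>, \<open>koszul_augmentation\<close> and \<open>koszul_exact\<close> below prove that, for
  \<open>I = S\<close>, this complex is a resolution of \<open>k\<close> with augmentation the constant term.
\<close>

type_synonym ('v, 'k) chain = "'v set \<Rightarrow>\<^sub>0 ('v, 'k) mpoly"

definition koszul_chains :: "'v set \<Rightarrow> ('v, 'k::field) mpoly set \<Rightarrow> nat \<Rightarrow> ('v, 'k) chain set" where
  "koszul_chains V I i =
     {c. \<forall>F \<in> Poly_Mapping.keys c. F \<subseteq> V \<and> card F = i \<and> Poly_Mapping.lookup c F \<in> I}"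

definition koszul_sign :: "'v::linorder \<Rightarrow> 'v set \<Rightarrow> ('v, 'k::field) mpoly" where
  "koszul_sign v F = (-1) ^ card {u \<in> F. u < v}"

definition koszul_diff :: "('v::linorder, 'k::field) chain \<Rightarrow> ('v, 'k) chain" where
  "koszul_diff c = (\<Sum>F \<in> Poly_Mapping.keys c. \<Sum>v\<in>F.
     Poly_Mapping.single (F - {v}) (koszul_sign v F * mvar v * Poly_Mapping.lookup c F))"

definition indicator_degree :: "'v set \<Rightarrow> ('v \<Rightarrow>\<^sub>0 nat)" where
  "indicator_degree F = (\<Sum>v\<in>F. Poly_Mapping.single v 1)"

definition multihomogeneous :: "('v \<Rightarrow>\<^sub>0 nat) \<Rightarrow> ('v, 'k::field) chain \<Rightarrow> bool" where
  "multihomogeneous a c \<longleftrightarrow>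
     (\<forall>F \<in> Poly_Mapping.keys c. \<forall>m \<in> Poly_Mapping.keys (Poly_Mapping.lookup c F).
        m + indicator_degree F = a)"

definition koszul_cycles ::
    "'v::linorder set \<Rightarrow> ('v, 'k::field) mpoly set \<Rightarrow> nat \<Rightarrow> ('v \<Rightarrow>\<^sub>0 nat) \<Rightarrow> ('v, 'k) chain set" where
  "koszul_cycles V I i a = {c \<in> koszul_chains V I i. multihomogeneous a c \<and> koszul_diff c = 0}"

definition koszul_boundaries ::
    "'v::linorder set \<Rightarrow> ('v, 'k::field) mpoly set \<Rightarrow> nat \<Rightarrow> ('v \<Rightarrow>\<^sub>0 nat) \<Rightarrow> ('v, 'k) chain set" where
  "koszul_boundaries V I i a =
     koszul_diff ` {c \<in> koszul_chains V I (Suc i). multihomogeneous a c}"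

definition chain_scale :: "'k::field \<Rightarrow> ('v, 'k) chain \<Rightarrow> ('v, 'k) chain" where
  "chain_scale k = Poly_Mapping.map (\<lambda>p. Poly_Mapping.single 0 k * p)"

text \<open>
  The multidegree-\<open>a\<close> part of \<open>Tor\<^sub>i(I, k)\<close> is the quotient of cycles by boundaries. For finite \<open>V\<close>
  both are finite-dimensional, so that its dimension is the difference of their dimensions.
\<close>

definition tor_dim :: "'v::linorder set \<Rightarrow> ('v, 'k::field) mpoly set \<Rightarrow> nat \<Rightarrow> ('v \<Rightarrow>\<^sub>0 nat) \<Rightarrow> nat" where
  "tor_dim V I i a =
     vector_space.dim chain_scale (koszul_cycles V I i a)
     - vector_space.dim chain_scale (koszul_boundaries V I i a)"

lemma vector_space_chain_scale: "vector_space (chain_scale :: 'k::field \<Rightarrow> ('v, 'k) chain \<Rightarrow> _)"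
proof -
  have l: "Poly_Mapping.lookup (chain_scale k c) F = Poly_Mapping.single 0 k * Poly_Mapping.lookup c F"
    for k and c :: "('v, 'k) chain" and F
    by (simp add: chain_scale_def map.rep_eq when_def)
  have s: "Poly_Mapping.single 0 (a * b) = Poly_Mapping.single (0 :: 'v \<Rightarrow>\<^sub>0 nat) a * Poly_Mapping.single 0 b"
    for a b :: 'k
    by (simp add: mult_single)
  show ?thesis
    by unfold_locales
      (rule poly_mapping_eqI, simp add: l lookup_add distrib_left distrib_right single_add s mult.assoc)+
qed

text \<open>Verification that the Koszul complex resolves \<open>k\<close>.\<close>

lemma sum_keys_add:
  fixes a b :: "'i \<Rightarrow>\<^sub>0 'p::comm_monoid_add"
  assumes "\<And>F. f F 0 = 0" "\<And>F p q. f F (p + q) = f F p + f F q"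
  shows "(\<Sum>F\<in>Poly_Mapping.keys (a + b). f F (Poly_Mapping.lookup (a + b) F)) =
    (\<Sum>F\<in>Poly_Mapping.keys a. f F (Poly_Mapping.lookup a F)) +
    (\<Sum>F\<in>Poly_Mapping.keys b. f F (Poly_Mapping.lookup b F))"
  by (rule setsum_keys_plus_distrib) (use assms in auto)

lemma koszul_diff_add: "koszul_diff (a + b) = koszul_diff a + koszul_diff b"
  unfolding koszul_diff_def
  by (rule sum_keys_add) (auto simp: single_add distrib_left sum.distrib)

lemma koszul_diff_single:
  "koszul_diff (Poly_Mapping.single F p) =
   (\<Sum>v\<in>F. Poly_Mapping.single (F - {v}) (koszul_sign v F * mvar v * p))"
  by (cases "p = 0") (auto simp: koszul_diff_def)

lemma sum_singles: "p = (\<Sum>k\<in>Poly_Mapping.keys p. Poly_Mapping.single k (Poly_Mapping.lookup p k))"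
  by (rule poly_mapping_eqI)
    (auto simp: lookup_sum lookup_single when_def in_keys_iff sum.delta)

lemma chain_induct [case_names zero single add]:
  fixes c :: "('v, 'k::field) chain"
  assumes "P 0"
    and "\<And>F m k. F \<in> Poly_Mapping.keys c \<Longrightarrow> P (Poly_Mapping.single F (Poly_Mapping.single m k))"
    and "\<And>a b. P a \<Longrightarrow> P b \<Longrightarrow> P (a + b)"
  shows "P c"
proof -
  have sums: "P (sum g A)" if "\<And>x. x \<in> A \<Longrightarrow> P (g x)" for g :: "'z \<Rightarrow> _" and A
    using that by (induction A rule: infinite_finite_induct) (auto intro: assms)
  have "P (Poly_Mapping.single F p)" if "F \<in> Poly_Mapping.keys c" for F p
  proof -
    have s: "Poly_Mapping.single F (sum g A) = (\<Sum>x\<in>A. Poly_Mapping.single F (g x))"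
      for g :: "('v \<Rightarrow>\<^sub>0 nat) \<Rightarrow> ('v, 'k) mpoly" and A
      by (induction A rule: infinite_finite_induct) (auto simp: single_add)
    show ?thesis
      by (subst sum_singles[of p], subst s) (intro sums assms that)
  qed
  then show ?thesis
    by (subst sum_singles[of c]) (intro sums)
qed

lemma koszul_diff_zero [simp]: "koszul_diff 0 = 0"
  by (simp add: koszul_diff_def)

lemma koszul_diff_sum: "koszul_diff (sum g A) = (\<Sum>x\<in>A. koszul_diff (g x))"
  by (induction A rule: infinite_finite_induct) (auto simp: koszul_diff_add)

lemma koszul_sign_swap:
  assumes "finite F" "u \<in> F" "v \<in> F" "u < v"
  shows "koszul_sign u (F - {v}) = koszul_sign u F"
    and "koszul_sign v F = - koszul_sign v (F - {u})"
proof -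
  have "{w \<in> F - {v}. w < u} = {w \<in> F. w < u}" using assms by auto
  then show "koszul_sign u (F - {v}) = koszul_sign u F"
    by (simp only: koszul_sign_def)
  have "{w \<in> F. w < v} = insert u {w \<in> F - {u}. w < v}" using assms by auto
  then have "card {w \<in> F. w < v} = Suc (card {w \<in> F - {u}. w < v})"
    using assms by simp
  then show "koszul_sign v F = - koszul_sign v (F - {u})"
    by (simp add: koszul_sign_def)
qed

lemma koszul_diff_diff: "koszul_diff (koszul_diff c) = 0"
proof (induction c rule: chain_induct)
  case (single F m k)
  let ?p = "Poly_Mapping.single m k"
  show ?case
  proof (cases "finite F")
    case True
    let ?t = "\<lambda>v u. Poly_Mapping.single (F - {v} - {u})
        (koszul_sign u (F - {v}) * mvar u * (koszul_sign v F * mvar v * ?p))"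
    let ?A = "SIGMA v:F. F - {v}"
    have anti: "?t v u = - ?t u v" if "u \<in> F" "v \<in> F" "u < v" for u v
    proof -
      have "F - {v} - {u} = F - {u} - {v}" by auto
      then show ?thesis
        by (simp add: koszul_sign_swap[OF True that] mult_ac flip: single_uminus)
    qed
    have fin: "finite ?A" using True by auto
    have "koszul_diff (koszul_diff (Poly_Mapping.single F ?p)) = (\<Sum>v\<in>F. \<Sum>u\<in>F - {v}. ?t v u)"
      by (simp add: koszul_diff_single koszul_diff_sum)
    also have "\<dots> = (\<Sum>(v, u)\<in>?A. ?t v u)"
      by (subst sum.Sigma) (use True in auto)
    also have "?A = {(v, u). v \<in> F \<and> u \<in> F \<and> u < v} \<union> {(v, u). v \<in> F \<and> u \<in> F \<and> v < u}"
      by auto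
    also have "(\<Sum>(v, u)\<in>\<dots>. ?t v u) =
        (\<Sum>(v, u)\<in>{(v, u). v \<in> F \<and> u \<in> F \<and> u < v}. ?t v u) +
        (\<Sum>(v, u)\<in>{(v, u). v \<in> F \<and> u \<in> F \<and> v < u}. ?t v u)"
      by (rule sum.union_disjoint)
        (auto intro!: finite_subset[OF _ fin])
    also have "(\<Sum>(v, u)\<in>{(v, u). v \<in> F \<and> u \<in> F \<and> v < u}. ?t v u) =
        (\<Sum>(v, u)\<in>{(v, u). v \<in> F \<and> u \<in> F \<and> u < v}. ?t u v)"
      by (rule sum.reindex_bij_witness[of _ prod.swap prod.swap]) auto
    also have "(\<Sum>(v, u)\<in>{(v, u). v \<in> F \<and> u \<in> F \<and> u < v}. ?t v u) =
        (\<Sum>(v, u)\<in>{(v, u). v \<in> F \<and> u \<in> F \<and> u < v}. - ?t u v)"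
      by (rule sum.cong) (auto simp: anti)
    finally show ?thesis
      by (simp add: sum_negf case_prod_unfold)
  qed (simp add: koszul_diff_single)
qed (simp_all add: koszul_diff_add)

lemma koszul_sign_eq: "koszul_sign v F = Poly_Mapping.single 0 ((-1) ^ card {u \<in> F. u < v})"
proof -
  have "(-1) ^ n = Poly_Mapping.single (0 :: 'a \<Rightarrow>\<^sub>0 nat) ((-1 :: 'b) ^ n)" for n
    by (induction n) (simp_all add: mult_single flip: single_uminus)
  then show ?thesis by (simp add: koszul_sign_def)
qed

lemma koszul_diff_monomial:
  "koszul_diff (Poly_Mapping.single F (Poly_Mapping.single m k)) =
   (\<Sum>v\<in>F. Poly_Mapping.single (F - {v})
      (Poly_Mapping.single (m + Poly_Mapping.single v 1) ((-1) ^ card {u \<in> F. u < v} * k)))"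
  by (simp add: koszul_diff_single koszul_sign_eq mvar_def mult_single add.commute)

lemma koszul_augmentation:
  "Poly_Mapping.lookup (Poly_Mapping.lookup (koszul_diff c) {}) 0 = 0"
proof (induction c rule: chain_induct)
  case (single F m k)
  have "m + Poly_Mapping.single v 1 \<noteq> 0" for v
  proof
    assume "m + Poly_Mapping.single v 1 = 0"
    then have "Poly_Mapping.lookup (m + Poly_Mapping.single v 1) v = 0" by simp
    then show False by (simp add: lookup_add)
  qed
  then show ?case
    by (auto simp: koszul_diff_monomial lookup_sum lookup_single when_def intro!: sum.neutral)
qed (simp_all add: koszul_diff_add lookup_add)

text \<open>The contracting homotopy multiplies by \<open>e\<^sub>v\<close>, \<open>v\<close> the least variable of the multidegree.\<close>

definition koszul_homotopy_monomial ::
    "'v::linorder set \<Rightarrow> ('v \<Rightarrow>\<^sub>0 nat) \<Rightarrow> 'k::field \<Rightarrow> ('v, 'k) chain" where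
  "koszul_homotopy_monomial F m k =
     (let v = Min (Poly_Mapping.keys m \<union> F) in
      if Poly_Mapping.keys m \<union> F = {} \<or> v \<in> F then 0
      else Poly_Mapping.single (insert v F)
             (Poly_Mapping.single (m - Poly_Mapping.single v 1) k))"

definition koszul_homotopy :: "('v::linorder, 'k::field) chain \<Rightarrow> ('v, 'k) chain" where
  "koszul_homotopy c = (\<Sum>F \<in> Poly_Mapping.keys c.
     \<Sum>m \<in> Poly_Mapping.keys (Poly_Mapping.lookup c F).
       koszul_homotopy_monomial F m (Poly_Mapping.lookup (Poly_Mapping.lookup c F) m))"

lemma koszul_homotopy_monomial_zero [simp]: "koszul_homotopy_monomial F m 0 = 0"
  by (simp add: koszul_homotopy_monomial_def Let_def)

lemma koszul_homotopy_monomial_add: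
  "koszul_homotopy_monomial F m (k + l) =
   koszul_homotopy_monomial F m k + koszul_homotopy_monomial F m l"
  by (simp add: koszul_homotopy_monomial_def Let_def single_add)

lemma koszul_homotopy_zero [simp]: "koszul_homotopy 0 = 0"
  by (simp add: koszul_homotopy_def)

lemma koszul_homotopy_add: "koszul_homotopy (a + b) = koszul_homotopy a + koszul_homotopy b"
  unfolding koszul_homotopy_def
  by (rule sum_keys_add, simp, rule sum_keys_add)
    (simp_all add: koszul_homotopy_monomial_add)

lemma koszul_homotopy_sum: "koszul_homotopy (sum g A) = (\<Sum>x\<in>A. koszul_homotopy (g x))"
  by (induction A rule: infinite_finite_induct) (auto simp: koszul_homotopy_add)

lemma koszul_homotopy_single:
  "koszul_homotopy (Poly_Mapping.single F (Poly_Mapping.single m k)) =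
   koszul_homotopy_monomial F m k"
proof (cases "k = 0")
  case False
  then have "Poly_Mapping.single m k \<noteq> 0"
    by (metis keys_single keys_zero insert_not_empty)
  with False show ?thesis by (simp add: koszul_homotopy_def)
qed simp

lemma koszul_homotopy:
  assumes "\<And>F. F \<in> Poly_Mapping.keys c \<Longrightarrow> finite F"
  shows "koszul_diff (koszul_homotopy c) + koszul_homotopy (koszul_diff c) =
    c - Poly_Mapping.single {}
          (Poly_Mapping.single 0 (Poly_Mapping.lookup (Poly_Mapping.lookup c {}) 0))"
proof (induction c rule: chain_induct)
  case (single F m k)
  have F: "finite F" using single assms by blast
  let ?c = "Poly_Mapping.single F (Poly_Mapping.single m k)"
  define A where "A = Poly_Mapping.keys m \<union> F"
  define v where "v = Min A"
  have "finite A" using F by (simp add: A_def)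
  define sg where "sg u G = (-1 :: 'b) ^ card {w \<in> G. w < u}" for u :: 'a and G
  have A': "Poly_Mapping.keys (m + Poly_Mapping.single u 1) \<union> (F - {u}) = A" if "u \<in> F" for u
    using that by (auto simp: A_def in_keys_iff lookup_add lookup_single when_def split: if_splits)
  have hd: "koszul_homotopy (koszul_diff ?c) =
      (\<Sum>u\<in>F. koszul_homotopy_monomial (F - {u}) (m + Poly_Mapping.single u 1) (sg u F * k))"
    by (simp add: koszul_diff_monomial koszul_homotopy_sum koszul_homotopy_single sg_def)
  have h: "koszul_homotopy_monomial (F - {u}) (m + Poly_Mapping.single u 1) (sg u F * k) =
      (if v \<in> F - {u} then 0 else Poly_Mapping.single (insert v (F - {u}))
         (Poly_Mapping.single (m + Poly_Mapping.single u 1 - Poly_Mapping.single v 1) (sg u F * k)))"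
    if "u \<in> F" for u
  proof -
    have "A \<noteq> {}" using that by (auto simp: A_def)
    then show ?thesis
      unfolding koszul_homotopy_monomial_def Let_def A'[OF that] v_def[symmetric] by simp
  qed
  consider "A = {}" | "v \<in> F" | "v \<notin> F" "A \<noteq> {}" by blast
  then show ?case
  proof cases
    case 1
    then have "F = {}" and m: "Poly_Mapping.keys m = {}" by (auto simp: A_def)
    moreover have "m = 0"
      by (rule poly_mapping_eqI) (use m in_keys_iff[of _ m] in auto)
    ultimately show ?thesis
      by (simp add: koszul_diff_monomial koszul_homotopy_single koszul_homotopy_monomial_def)
  next
    case 2
    have "v \<le> w" if "w \<in> F" for w
      using \<open>finite A\<close> that by (simp add: v_def A_def)
    then have "{w \<in> F. w < v} = {}" by (auto simp: not_less)
    then have sg: "sg v F = 1" by (simp only: sg_def) simp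
    have "koszul_homotopy ?c = 0"
      using 2 by (simp add: koszul_homotopy_single koszul_homotopy_monomial_def v_def A_def)
    moreover have "koszul_homotopy (koszul_diff ?c) = (\<Sum>u\<in>F. if u = v then ?c else 0)"
      unfolding hd
    proof (rule sum.cong)
      fix u assume u: "u \<in> F"
      show "koszul_homotopy_monomial (F - {u}) (m + Poly_Mapping.single u 1) (sg u F * k) =
          (if u = v then ?c else 0)"
        unfolding h[OF u] using 2 by (auto simp: sg insert_absorb)
    qed simp
    ultimately show ?thesis
      using 2 F by (auto simp: lookup_single when_def)
  next
    case 3
    then have vA: "v \<in> A" using \<open>finite A\<close> by (simp add: v_def)
    then have vm: "v \<in> Poly_Mapping.keys m" using 3 by (auto simp: A_def)
    have m: "m - Poly_Mapping.single v 1 + p = m + p - Poly_Mapping.single v 1" for p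
      by (rule poly_mapping_eqI)
        (use vm in \<open>auto simp: lookup_add lookup_minus lookup_single when_def in_keys_iff\<close>)
    have less: "v < u" if "u \<in> F" for u
    proof -
      have "v \<le> u" using \<open>finite A\<close> that by (simp add: v_def A_def)
      with that 3 show ?thesis by (metis order_le_less)
    qed
    have sg1: "sg v (insert v F) = 1"
    proof -
      have "{w \<in> insert v F. w < v} = {}" using less by (auto dest: less_asym)
      then show ?thesis by (simp only: sg_def) simp
    qed
    have sg2: "sg u (insert v F) = - sg u F" if "u \<in> F" for u
    proof -
      have "{w \<in> insert v F. w < u} = insert v {w \<in> F. w < u}" using less[OF that] by auto
      with 3 F have "card {w \<in> insert v F. w < u} = Suc (card {w \<in> F. w < u})" by simp
      then show ?thesis by (simp add: sg_def)
    qed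
    have "koszul_homotopy ?c =
        Poly_Mapping.single (insert v F) (Poly_Mapping.single (m - Poly_Mapping.single v 1) k)"
      unfolding koszul_homotopy_single koszul_homotopy_monomial_def Let_def
        A_def[symmetric] v_def[symmetric]
      using 3 by simp
    then have "koszul_diff (koszul_homotopy ?c) =
        (\<Sum>u\<in>insert v F. Poly_Mapping.single (insert v F - {u})
          (Poly_Mapping.single (m + Poly_Mapping.single u 1 - Poly_Mapping.single v 1)
            (sg u (insert v F) * k)))"
      by (simp only: koszul_diff_monomial m sg_def)
    also have "\<dots> = ?c + (\<Sum>u\<in>F. - Poly_Mapping.single (insert v F - {u})
          (Poly_Mapping.single (m + Poly_Mapping.single u 1 - Poly_Mapping.single v 1) (sg u F * k)))"
      using F 3 by (simp add: sg1 sg2 flip: single_uminus)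
    also have "(\<Sum>u\<in>F. - Poly_Mapping.single (insert v F - {u})
          (Poly_Mapping.single (m + Poly_Mapping.single u 1 - Poly_Mapping.single v 1) (sg u F * k)))
        = - koszul_homotopy (koszul_diff ?c)"
      unfolding hd sum_negf[symmetric]
    proof (rule sum.cong)
      fix u assume u: "u \<in> F"
      then have "insert v F - {u} = insert v (F - {u})" using less by auto
      then show "- Poly_Mapping.single (insert v F - {u})
          (Poly_Mapping.single (m + Poly_Mapping.single u 1 - Poly_Mapping.single v 1) (sg u F * k))
        = - koszul_homotopy_monomial (F - {u}) (m + Poly_Mapping.single u 1) (sg u F * k)"
        unfolding h[OF u] using 3 by simp
    qed simp
    finally have "koszul_diff (koszul_homotopy ?c) + koszul_homotopy (koszul_diff ?c) = ?c"
      by simp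
    moreover have "m \<noteq> 0" using vm by auto
    ultimately show ?thesis
      by (auto simp: lookup_single when_def)
  qed
next
  case (add a b)
  let ?s = "\<lambda>c :: ('a, 'b) chain. Poly_Mapping.single {}
    (Poly_Mapping.single 0 (Poly_Mapping.lookup (Poly_Mapping.lookup c {}) 0)) :: ('a, 'b) chain"
  have "?s (a + b) = ?s a + ?s b" by (simp add: lookup_add single_add)
  moreover have "koszul_diff (koszul_homotopy (a + b)) + koszul_homotopy (koszul_diff (a + b)) =
      (koszul_diff (koszul_homotopy a) + koszul_homotopy (koszul_diff a)) +
      (koszul_diff (koszul_homotopy b) + koszul_homotopy (koszul_diff b))"
    by (simp add: koszul_diff_add koszul_homotopy_add)
  ultimately show ?case using add.IH by simp
qed simp

lemma poly_ring_add: "p \<in> poly_ring V \<Longrightarrow> q \<in> poly_ring V \<Longrightarrow> p + q \<in> poly_ring V"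
  using keys_add[of p q] by (fastforce simp: poly_ring_def)

lemma koszul_chains_add:
  assumes "a \<in> koszul_chains V (poly_ring V) i" "b \<in> koszul_chains V (poly_ring V) i"
  shows "a + b \<in> koszul_chains V (poly_ring V) i"
proof -
  have "Poly_Mapping.lookup c F \<in> poly_ring V"
    if "c \<in> koszul_chains V (poly_ring V) i" for c :: "('a, 'b) chain" and F
  proof (cases "F \<in> Poly_Mapping.keys c")
    case True
    with that show ?thesis by (auto simp: koszul_chains_def)
  next
    case False
    then have "Poly_Mapping.lookup c F = 0" by (simp add: in_keys_iff)
    then show ?thesis by (simp add: poly_ring_def)
  qed
  then have l: "Poly_Mapping.lookup (a + b) F \<in> poly_ring V" for F
    unfolding lookup_add by (intro poly_ring_add) (use assms in blast)+
  have "F \<subseteq> V \<and> card F = i" if "F \<in> Poly_Mapping.keys (a + b)" for F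
  proof -
    have "F \<in> Poly_Mapping.keys a \<or> F \<in> Poly_Mapping.keys b"
      using that keys_add[of a b] by blast
    with assms show ?thesis unfolding koszul_chains_def by blast
  qed
  with l show ?thesis unfolding koszul_chains_def by blast
qed

lemma koszul_homotopy_chains:
  assumes "finite V" and c: "c \<in> koszul_chains V (poly_ring V) i"
  shows "koszul_homotopy c \<in> koszul_chains V (poly_ring V) (Suc i)"
proof -
  have zero: "(0 :: ('a, 'b) chain) \<in> koszul_chains V (poly_ring V) (Suc i)"
    by (simp add: koszul_chains_def)
  have sums: "sum g A \<in> koszul_chains V (poly_ring V) (Suc i)"
    if "\<And>x. x \<in> A \<Longrightarrow> g x \<in> koszul_chains V (poly_ring V) (Suc i)"
    for g :: "'z \<Rightarrow> ('a, 'b) chain" and A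
    using that
    by (induction A rule: infinite_finite_induct) (auto intro: zero koszul_chains_add)
  show ?thesis
    unfolding koszul_homotopy_def
  proof (intro sums)
    fix F m
    assume F: "F \<in> Poly_Mapping.keys c" and m: "m \<in> Poly_Mapping.keys (Poly_Mapping.lookup c F)"
    have FV: "F \<subseteq> V" "card F = i" and mV: "Poly_Mapping.keys m \<subseteq> V"
      using c F m by (auto simp: koszul_chains_def poly_ring_def)
    have "finite F" using FV \<open>finite V\<close> by (auto intro: finite_subset)
    define v where "v = Min (Poly_Mapping.keys m \<union> F)"
    have v: "v \<in> V" if "Poly_Mapping.keys m \<union> F \<noteq> {}"
    proof -
      have "v \<in> Poly_Mapping.keys m \<union> F"
        unfolding v_def by (rule Min_in) (use \<open>finite F\<close> that in auto)
      then show ?thesis using FV mV by blast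
    qed
    have "x \<in> V" if "x \<in> Poly_Mapping.keys (m - Poly_Mapping.single v 1)" for x
    proof (rule ccontr)
      assume "x \<notin> V"
      then have "Poly_Mapping.lookup m x = 0" using mV by (meson in_keys_iff subsetD)
      then have "Poly_Mapping.lookup (m - Poly_Mapping.single v 1) x = 0"
        by (simp add: lookup_minus)
      with that show False unfolding in_keys_iff by contradiction
    qed
    then have p: "Poly_Mapping.single (m - Poly_Mapping.single v 1) k \<in> poly_ring V" for k :: 'b
      by (cases "k = 0") (auto simp: poly_ring_def)
    have "Poly_Mapping.single (insert v F) (Poly_Mapping.single (m - Poly_Mapping.single v 1) k)
        \<in> koszul_chains V (poly_ring V) (Suc i)"
      if "v \<notin> F" "Poly_Mapping.keys m \<union> F \<noteq> {}" for k :: 'b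
      using that FV \<open>finite F\<close> v p[of k]
      by (simp add: koszul_chains_def split: if_splits)
    then show "koszul_homotopy_monomial F m (Poly_Mapping.lookup (Poly_Mapping.lookup c F) m)
        \<in> koszul_chains V (poly_ring V) (Suc i)"
      unfolding koszul_homotopy_monomial_def Let_def v_def[symmetric]
      using zero by simp
  qed
qed

lemma koszul_exact:
  assumes "finite V" "c \<in> koszul_chains V (poly_ring V) i" "koszul_diff c = 0"
    and "i > 0 \<or> Poly_Mapping.lookup (Poly_Mapping.lookup c {}) 0 = 0"
  shows "\<exists>b \<in> koszul_chains V (poly_ring V) (Suc i). koszul_diff b = c"
proof
  show "koszul_homotopy c \<in> koszul_chains V (poly_ring V) (Suc i)"
    by (rule koszul_homotopy_chains[OF assms(1,2)])
  have "finite F" if "F \<in> Poly_Mapping.keys c" for F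
    using that assms(1,2) by (auto simp: koszul_chains_def intro: finite_subset)
  moreover have "Poly_Mapping.lookup (Poly_Mapping.lookup c {}) 0 = 0"
  proof (cases "{} \<in> Poly_Mapping.keys c")
    case True
    with assms(2) have "i = 0" by (auto simp: koszul_chains_def)
    with assms(4) show ?thesis by simp
  qed (simp add: in_keys_iff)
  ultimately show "koszul_diff (koszul_homotopy c) = c"
    using koszul_homotopy[of c] assms(3) by simp
qed

text \<open>
  \<open>\<beta>\<^bsub>i,X' \<squnion> Y'\<^esub>(I(G))\<close> and \<open>\<beta>\<^bsub>i,X',\<bullet>\<^esub>(I(G))\<close>. The \<open>itself\<close> argument is the coefficient field.
\<close>

definition betti ::
    "'k::field itself \<Rightarrow> 'a::linorder set \<Rightarrow> 'b::linorder set \<Rightarrow> ('a \<times> 'b) set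
      \<Rightarrow> nat \<Rightarrow> 'a set \<Rightarrow> 'b set \<Rightarrow> nat" where
  "betti _ X Y E i X' Y' =
     tor_dim (X <+> Y) (edge_ideal X Y E :: ('a + 'b, 'k) mpoly set) i (indicator_degree (X' <+> Y'))"

definition row_betti ::
    "'k::field itself \<Rightarrow> 'a::linorder set \<Rightarrow> 'b::linorder set \<Rightarrow> ('a \<times> 'b) set
      \<Rightarrow> nat \<Rightarrow> 'a set \<Rightarrow> nat" where
  "row_betti K X Y E i X' = (\<Sum>Y'\<in>Pow Y. betti K X Y E i X' Y')"

section \<open>Shifted skew diagrams and row conditions\<close>

definition shifted_skew_diagram :: "(nat \<times> nat) set \<Rightarrow> bool" where
  "shifted_skew_diagram D \<longleftrightarrow> (\<exists>l r la mu. r \<le> l \<and>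
     strict_antimono_on {1..l} la \<and> (\<forall>i\<in>{1..l}. la i > 0) \<and>
     strict_antimono_on {1..r} mu \<and> (\<forall>i\<in>{1..r}. mu i > 0) \<and>
     (\<forall>i\<in>{r<..l}. mu i = 0) \<and> (\<forall>i\<in>{1..l}. mu i < la i) \<and>
     D = {(i, j). 1 \<le> i \<and> i \<le> l \<and> i + mu i + 1 \<le> j \<and> j \<le> i + la i})"

definition bip_diagram :: "nat set \<Rightarrow> nat set \<Rightarrow> (nat \<times> nat) set \<Rightarrow> (nat \<times> nat) set" where
  "bip_diagram X Y D = {(x, y). x \<in> X \<and> y \<in> Y \<and> (x, y) \<in> D}"

definition row :: "('a \<times> 'b) set \<Rightarrow> 'a \<Rightarrow> 'b set" where
  "row E x = {y. (x, y) \<in> E}"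

definition column :: "('a \<times> 'b) set \<Rightarrow> 'b \<Rightarrow> 'a set" where
  "column E y = {x. (x, y) \<in> E}"

definition deg :: "('a \<times> 'b) set \<Rightarrow> 'a \<Rightarrow> nat" where
  "deg E x = card (row E x)"

definition row_nested :: "'a set \<Rightarrow> ('a \<times> 'b) set \<Rightarrow> bool" where
  "row_nested X E \<longleftrightarrow> (\<forall>x\<in>X. \<forall>x'\<in>X. row E x \<subseteq> row E x' \<or> row E x' \<subseteq> row E x)"

text \<open>The second condition concerns only the cardinalities \<open>c\<close> that occur among the rows.\<close>

definition nearly_row_nested :: "'a set \<Rightarrow> ('a \<times> 'b) set \<Rightarrow> bool" where
  "nearly_row_nested X E \<longleftrightarrow>
     (\<forall>x\<in>X. \<forall>x'\<in>X. deg E x < deg E x' \<longrightarrow> row E x \<subset> row E x') \<and>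
     (\<forall>c \<in> deg E ` X. card (\<Inter>x\<in>{x \<in> X. deg E x = c}. row E x) \<in> {c - 1, c})"

definition horizontal :: "('a \<times> 'b) set \<Rightarrow> bool" where
  "horizontal E \<longleftrightarrow> (\<forall>(x, y)\<in>E. column E y = {x})"

definition horizontal_vertical :: "('a \<times> 'b) set \<Rightarrow> bool" where
  "horizontal_vertical E \<longleftrightarrow> (\<forall>(x, y)\<in>E. column E y = {x} \<or> row E x = {y})"

definition is_R :: "'a set \<Rightarrow> ('a \<times> 'b) set \<Rightarrow> 'c set \<Rightarrow> ('a \<times> 'c) set \<Rightarrow> bool" where
  "is_R X E Y'' E'' \<longleftrightarrow>
     bipartite_graph X Y'' E'' \<and> row_nested X E'' \<and> (\<forall>x\<in>X. deg E'' x = deg E x)"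

definition is_H :: "'a set \<Rightarrow> ('a \<times> 'b) set \<Rightarrow> 'c set \<Rightarrow> ('a \<times> 'c) set \<Rightarrow> bool" where
  "is_H X E Y'' E'' \<longleftrightarrow>
     bipartite_graph X Y'' E'' \<and> horizontal E'' \<and> (\<forall>x\<in>X. deg E'' x = deg E x)"

text \<open>
  Isomorphism of bipartite graphs fixing the vertices in \<open>X\<close> and disregarding isolated vertices on
  the other side (\<open>Range E\<close> is the set of non-isolated ones).
\<close>

definition column_isomorphic :: "('a \<times> 'b) set \<Rightarrow> ('a \<times> 'c) set \<Rightarrow> bool" where
  "column_isomorphic E E' \<longleftrightarrow>
     (\<exists>f. bij_betw f (Range E) (Range E') \<and> E' = {(x, f y) | x y. (x, y) \<in> E})"

text \<open>
  The minimum over \<open>X' = {}\<close> is read as \<open>0\<close>; this is the value for which the binomial formula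
  for \<open>R\<^sub>G\<close> gives the correct Betti number \<open>0\<close>.
\<close>

definition mindeg :: "('a \<times> 'b) set \<Rightarrow> 'a set \<Rightarrow> nat" where
  "mindeg E X' = (if X' = {} then 0 else Min (deg E ` X'))"

end

theory Submission
  imports Defs "HOL-Library.Function_Algebras" "HOL-Library.Nat_Bijection"
begin

text \<open>
  In multidegree \<open>X' \<squnion> Y'\<close> the Koszul complex of \<open>I(G)\<close> is spanned by the sets of vertices whose
  complement in \<open>X' \<squnion> Y'\<close> contains an edge. Matching away the vertices of \<open>Y'\<close> one at a time leaves,
  shifted by \<open>card Y' - 1\<close>, the complex of those \<open>F \<subseteq> X'\<close> that contain no column of \<open>Y'\<close>.
  The long exact sequence of deletion and link of some \<open>x \<in> X'\<close> then bounds the sum over \<open>Y'\<close> by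
  \<open>\<Sum>A. \<beta>\<^bsub>i - card A, X' - {x}, \<bullet>\<^esub>\<close> with \<open>A\<close> ranging over the nonempty subsets of the row of \<open>x\<close>. This bound
  is attained for horizontal-vertical graphs, which gives the upper bound by induction on \<open>X'\<close>.

  For the lower bound let \<open>R\<close> be a shortest row. For each nonempty \<open>A \<subseteq> R\<close> the complexes of the sets
  \<open>A \<union> B\<close> with \<open>B \<subseteq> Y - R\<close> are the pieces of one complex with the homology of a sphere of dimension
  \<open>card X' - 2\<close>, so at least one of them contributes to the Betti number; and there are
  \<open>card R choose s\<close> sets \<open>A\<close> of size \<open>s\<close>. Whether a graph is nearly row-nested is already decided by the
  Betti numbers for two and three rows.
\<close>

section \<open>Dimension counts\<close>

text \<open>The three graphs share \<open>X\<close> but not their columns, so multidegrees in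
  \<open>Y\<close> cannot be compared one by one. All comparisons concern sums over
  \<open>Y'\<close>, where only row cardinalities can survive; hence the recursion removes rows. A
  class of degree \<open>j\<close> in the complex of \<open>Y'\<close> is given the weight
  \<open>m = j + card Y'\<close>, and the Betti index \<open>i\<close> is the weight
  \<open>i + 1\<close>. For a horizontal graph the recursion counts the sets of \<open>m\<close>
  cells in the rows of \<open>X'\<close> that meet each of these rows. A binomial coefficient of the
  total degree counts all \<open>m\<close>-sets of cells, whichever rows they meet, so it is the sum
  of the row Betti numbers over all \<open>X''\<close> in \<open>Pow X'\<close>. Two disjoint rows
  of size 1 show the difference: at \<open>i = 0\<close> the binomial is 2, while no generator of
  the ideal involves both rows. In the lower bound no single \<open>Y'\<close> can be prescribed:
  for given \<open>A\<close> it is unknown which \<open>B\<close> carries a class, and only the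
  complex assembled from all of them has a known homology.\<close>

context vector_space
begin

lemma dim_mono_finite:
  assumes "S \<subseteq> T" "finite W" "T \<subseteq> span W"
  shows "dim S \<le> dim T"
proof -
  obtain B where B: "B \<subseteq> T" "independent B" "T \<subseteq> span B" "card B = dim T"
    using basis_exists .
  have "finite B"
    using independent_span_bound[OF assms(2) B(2)] B(1) assms(3) by auto
  then show ?thesis
    using dim_le_card[of S B] B assms(1) by auto
qed

lemma dim_zero_space [simp]: "dim {0} = 0"
  using dim_le_card[of "{0}" "{}"] by simp

end

context vector_space_pair
begin

text \<open>The ambient spaces may be infinite-dimensional, so finiteness enters through the
  spanning set \<open>W\<close> of the subspace. A basis of the kernel is extended to one of
  \<open>V\<close>, and \<open>f\<close> is injective on the span of the added vectors.\<close>

lemma rank_nullity: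
  assumes f: "Vector_Spaces.linear s1 s2 f" and V: "vs1.subspace V" and W: "finite W" "V \<subseteq> vs1.span W"
  shows "vs1.dim V = vs1.dim {v \<in> V. f v = 0} + vs2.dim (f ` V)"
proof -
  interpret f: Vector_Spaces.linear s1 s2 f by (rule f)
  let ?N = "{v \<in> V. f v = 0}"
  obtain B where B: "B \<subseteq> ?N" "vs1.independent B" "?N \<subseteq> vs1.span B"
    using vs1.maximal_independent_subset .
  obtain C where C: "B \<subseteq> C" "C \<subseteq> V" "vs1.independent C" "V \<subseteq> vs1.span C"
    using vs1.maximal_independent_subset_extend[of B V] B by blast
  have finC: "finite C"
    using vs1.independent_span_bound[OF W(1) C(3)] C(2) W(2) by auto
  have "inj_on f (vs1.span (C - B))"
    unfolding f.inj_on_iff_eq_0[OF vs1.subspace_span]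
  proof safe
    fix x assume x: "x \<in> vs1.span (C - B)" "f x = 0"
    have "vs1.span (C - B) \<subseteq> V"
      using C(2) V by (intro vs1.span_minimal) auto
    with x B(3) have xB: "x \<in> vs1.span B" by auto
    \<comment> \<open>The coordinates of \<open>x\<close> are supported in \<open>B\<close> and also
      in \<open>C - B\<close>.\<close>
    have "vs1.representation C x b = 0" for b
    proof -
      have "vs1.representation C x = vs1.representation B x"
        by (rule vs1.representation_extend[OF C(3) xB C(1)])
      moreover have "vs1.representation C x = vs1.representation (C - B) x"
        by (rule vs1.representation_extend[OF C(3) x(1)]) auto
      ultimately show ?thesis
        using vs1.representation_ne_zero[of B x b] vs1.representation_ne_zero[of "C - B" x b]
        by auto
    qed
    then show "x = 0"
      using vs1.sum_nonzero_representation_eq[OF C(3), of x] xB vs1.span_mono[OF C(1)] by auto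
  qed
  then have ind: "vs2.independent (f ` (C - B))" and inj: "inj_on f (C - B)"
    using f.independent_injective_image[of "C - B"] vs1.independent_mono[OF C(3)]
      inj_on_subset[OF _ vs1.span_superset] by auto
  have "f ` V \<subseteq> f ` vs1.span C" using C(4) by auto
  also have "\<dots> = vs2.span (f ` C)" by (simp add: f.span_image)
  also have "\<dots> \<subseteq> vs2.span (f ` (C - B))"
  proof (rule vs2.span_minimal)
    show "f ` C \<subseteq> vs2.span (f ` (C - B))"
    proof
      fix y assume "y \<in> f ` C"
      then obtain x where x: "x \<in> C" "y = f x" by auto
      show "y \<in> vs2.span (f ` (C - B))"
      proof (cases "x \<in> B")
        case True
        then have "y = 0" using x B(1) by auto
        then show ?thesis by (simp add: vs2.span_zero)
      qed (use x in \<open>auto intro: vs2.span_base\<close>)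
    qed
  qed simp
  finally have "vs2.dim (f ` V) = card (f ` (C - B))"
    using C(2) ind by (intro vs2.basis_card_eq_dim[symmetric]) auto
  also have "\<dots> = card C - card B"
    using inj C(1) finC by (simp add: card_image card_Diff_subset finite_subset)
  finally show ?thesis
    using vs1.basis_card_eq_dim[OF B(1,3,2)] vs1.basis_card_eq_dim[OF C(2,4,3)]
      card_mono[OF finC C(1)] by simp
qed

lemma dim_image_inj:
  assumes f: "Vector_Spaces.linear s1 s2 f" and V: "vs1.subspace V" and W: "finite W" "V \<subseteq> vs1.span W"
    and inj: "\<And>v. v \<in> V \<Longrightarrow> f v = 0 \<Longrightarrow> v = 0"
  shows "vs2.dim (f ` V) = vs1.dim V"
proof -
  interpret f: Vector_Spaces.linear s1 s2 f by (rule f)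
  have "{v \<in> V. f v = 0} = {0}"
    using inj V vs1.subspace_0 f.zero by auto
  then show ?thesis
    using rank_nullity[OF f V W] by simp
qed

end

definition fscale :: "'k::field \<Rightarrow> ('a \<Rightarrow> 'k) \<Rightarrow> 'a \<Rightarrow> 'k" where
  "fscale r f = (\<lambda>x. r * f x)"

interpretation fn: vector_space "fscale :: 'k::field \<Rightarrow> ('a \<Rightarrow> 'k) \<Rightarrow> _"
  by unfold_locales (auto simp: fscale_def algebra_simps fun_eq_iff)

interpretation fn2: vector_space_pair
  "fscale :: 'k::field \<Rightarrow> ('a \<Rightarrow> 'k) \<Rightarrow> _" "fscale :: 'k::field \<Rightarrow> ('a \<Rightarrow> 'k) \<Rightarrow> _" ..

lemma fn_subspaceI:
  assumes "0 \<in> S" "\<And>f g. f \<in> S \<Longrightarrow> g \<in> S \<Longrightarrow> f + g \<in> S" "\<And>r f. f \<in> S \<Longrightarrow> fscale r f \<in> S"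
  shows "fn.subspace S"
  using assms by (simp add: fn.subspace_def)

section \<open>Homology of convex families of sets\<close>

text \<open>
  A convex family of finite sets is the difference of two simplicial complexes, and \<open>hom\<close> is the
  dimension of the relative homology. The degree \<open>j\<close> is the cardinality of the sets, one more than
  the usual dimension; it is an integer so that shifted degrees need no side conditions.
\<close>

definition convex_family :: "'v set \<Rightarrow> 'v set set \<Rightarrow> bool" where
  "convex_family V \<F> \<longleftrightarrow> finite V \<and> \<F> \<subseteq> Pow V \<and>
     (\<forall>A B C. A \<in> \<F> \<longrightarrow> C \<in> \<F> \<longrightarrow> A \<subseteq> B \<longrightarrow> B \<subseteq> C \<longrightarrow> B \<in> \<F>)"

definition sgn_at :: "'v::linorder \<Rightarrow> 'v set \<Rightarrow> 'k::field" where
  "sgn_at v S = (-1) ^ card {u \<in> S. u < v}"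

definition chain_space :: "'v set set \<Rightarrow> int \<Rightarrow> ('v set \<Rightarrow> 'k::field) set" where
  "chain_space \<F> j = {c. \<forall>S. c S \<noteq> 0 \<longrightarrow> S \<in> \<F> \<and> int (card S) = j}"

text \<open>The boundary map of the full simplex on \<open>V\<close> in coordinates:
  \<open>S\<close> receives one term from each \<open>insert v S\<close>. Followed by
  \<open>restr \<F>\<close> it is the differential of the relative complex.\<close>

definition bdry :: "'v::linorder set \<Rightarrow> ('v set \<Rightarrow> 'k::field) \<Rightarrow> 'v set \<Rightarrow> 'k" where
  "bdry V c = (\<lambda>S. \<Sum>v\<in>V - S. sgn_at v S * c (insert v S))"

definition restr :: "'v set set \<Rightarrow> ('v set \<Rightarrow> 'k::field) \<Rightarrow> 'v set \<Rightarrow> 'k" where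
  "restr \<F> c = (\<lambda>S. if S \<in> \<F> then c S else 0)"

definition cycles :: "'v::linorder set \<Rightarrow> 'v set set \<Rightarrow> int \<Rightarrow> ('v set \<Rightarrow> 'k::field) set" where
  "cycles V \<F> j = {c \<in> chain_space \<F> j. restr \<F> (bdry V c) = 0}"

definition bounds :: "'v::linorder set \<Rightarrow> 'v set set \<Rightarrow> int \<Rightarrow> ('v set \<Rightarrow> 'k::field) set" where
  "bounds V \<F> j = (\<lambda>c. restr \<F> (bdry V c)) ` chain_space \<F> (j + 1)"

definition hom :: "'k::field itself \<Rightarrow> 'v::linorder set \<Rightarrow> 'v set set \<Rightarrow> int \<Rightarrow> nat" where
  "hom _ V \<F> j = fn.dim (cycles V \<F> j :: ('v set \<Rightarrow> 'k) set) - fn.dim (bounds V \<F> j :: ('v set \<Rightarrow> 'k) set)"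

lemma sgn_at_sq [simp]: "sgn_at v S * sgn_at v S = (1 :: 'k::field)"
  by (simp add: sgn_at_def flip: power_add)

lemma sgn_at_sq' [simp]: "sgn_at v S * (sgn_at v S * x) = (x :: 'k::field)"
  by (simp flip: mult.assoc)

lemma sgn_at_insert:
  assumes "finite S" "u \<notin> S"
  shows "sgn_at v (insert u S) = (if u < v then - sgn_at v S else (sgn_at v S :: 'k::field))"
proof -
  have "{w \<in> insert u S. w < v} = (if u < v then insert u {w \<in> S. w < v} else {w \<in> S. w < v})"
    by auto
  then have "card {w \<in> insert u S. w < v} =
      (if u < v then Suc (card {w \<in> S. w < v}) else card {w \<in> S. w < v})"
    using assms by simp
  then show ?thesis by (simp add: sgn_at_def)
qed

lemma sgn_at_swap:
  assumes "finite S" "u \<notin> S" "v \<notin> S" "u \<noteq> v"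
  shows "sgn_at u S * sgn_at v (insert u S) = - (sgn_at v S * sgn_at u (insert v S) :: 'k::field)"
  using assms by (cases "u < v") (auto simp: sgn_at_insert)

lemma bdry_add: "bdry V (c + d) = bdry V c + bdry V d"
  by (simp add: bdry_def fun_eq_iff algebra_simps sum.distrib)

lemma bdry_scale: "bdry V (fscale r c) = fscale r (bdry V c)"
  by (simp add: bdry_def fscale_def fun_eq_iff sum_distrib_left algebra_simps)

lemma bdry_zero [simp]: "bdry V 0 = 0"
  by (simp add: bdry_def fun_eq_iff)

lemma bdry_bdry:
  assumes V: "finite V" and S: "S \<subseteq> V"
  shows "bdry V (bdry V c) S = (0 :: 'k::field)"
proof -
  define t where "t v u = sgn_at v S * (sgn_at u (insert v S) * c (insert u (insert v S)))" for u v
  define A where "A = {(v, u). v \<in> V - S \<and> u \<in> V - S \<and> v < u}"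
  define B where "B = {(v, u). v \<in> V - S \<and> u \<in> V - S \<and> u < v}"
  have fin: "finite A" "finite B"
    by (rule finite_subset[of _ "V \<times> V"]; use V in \<open>auto simp: A_def B_def\<close>)+
  have "finite S" using V S by (rule rev_finite_subset)
  then have anti: "t u v = - t v u" if "v \<notin> S" "u \<notin> S" "v < u" for u v
    using sgn_at_swap[of S v u, where 'k = 'k] that(1,2) less_imp_neq[OF that(3)]
    by (simp add: t_def insert_commute flip: mult.assoc)
  have "bdry V (bdry V c) S = (\<Sum>v\<in>V - S. \<Sum>u\<in>V - insert v S. t v u)"
    by (simp add: bdry_def t_def sum_distrib_left)
  also have "\<dots> = (\<Sum>(v, u)\<in>(SIGMA v:V - S. V - insert v S). t v u)"
    by (rule sum.Sigma) (use V in auto)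
  also have "(SIGMA v:V - S. V - insert v S) = A \<union> B"
    by (auto simp: A_def B_def)
  also have "(\<Sum>(v, u)\<in>\<dots>. t v u) = (\<Sum>(v, u)\<in>A. t v u) + (\<Sum>(v, u)\<in>B. t v u)"
    by (rule sum.union_disjoint) (use fin in \<open>auto simp: A_def B_def\<close>)
  also have "(\<Sum>(v, u)\<in>B. t v u) = (\<Sum>(v, u)\<in>A. t u v)"
    by (rule sum.reindex_bij_witness[of _ prod.swap prod.swap]) (auto simp: A_def B_def)
  also have "\<dots> = (\<Sum>(v, u)\<in>A. - t v u)"
    by (rule sum.cong) (auto simp: A_def anti)
  finally show ?thesis by (simp add: sum_negf case_prod_unfold)
qed

lemma restr_add: "restr \<F> (c + d) = restr \<F> c + restr \<F> d"
  by (auto simp: restr_def fun_eq_iff)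

lemma restr_scale: "restr \<F> (fscale r c) = fscale r (restr \<F> c)"
  by (auto simp: restr_def fscale_def fun_eq_iff)

lemma restr_zero [simp]: "restr \<F> 0 = 0"
  by (auto simp: restr_def fun_eq_iff)

lemma linear_restr: "Vector_Spaces.linear fscale fscale (restr \<F>)"
  by unfold_locales (simp_all add: restr_add restr_scale)

lemma linear_dif: "Vector_Spaces.linear fscale fscale (\<lambda>c. restr \<F> (bdry V c))"
  by unfold_locales (simp_all add: restr_add restr_scale bdry_add bdry_scale)

lemma subspace_chains: "fn.subspace (chain_space \<F> j)"
  by (rule fn_subspaceI) (force simp: chain_space_def fscale_def)+

lemma subspace_cycles: "fn.subspace (cycles V \<F> j)"
proof -
  interpret d: Vector_Spaces.linear fscale fscale "\<lambda>c. restr \<F> (bdry V c)" by (rule linear_dif)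
  have "cycles V \<F> j = chain_space \<F> j \<inter> {c. restr \<F> (bdry V c) = 0}" by (auto simp: cycles_def)
  then show ?thesis
    by (metis fn.subspace_inter subspace_chains d.subspace_kernel)
qed

lemma subspace_bounds: "fn.subspace (bounds V \<F> j)"
proof -
  interpret d: Vector_Spaces.linear fscale fscale "\<lambda>c. restr \<F> (bdry V c)" by (rule linear_dif)
  show ?thesis unfolding bounds_def by (intro d.subspace_image subspace_chains)
qed

definition point :: "'a \<Rightarrow> 'a \<Rightarrow> 'k::field" where
  "point S = (\<lambda>T. if T = S then 1 else 0)"

lemma chain_space_span:
  assumes "finite \<F>"
  shows "chain_space \<F> j \<subseteq> fn.span (point ` \<F>)"
proof
  fix c :: "'a set \<Rightarrow> 'b" assume c: "c \<in> chain_space \<F> j"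
  have "(\<Sum>S\<in>\<F>. fscale (c S) (point S)) T = (\<Sum>S\<in>\<F>. fscale (c S) (point S) T)" for T
    using assms by (induction \<F> rule: finite_induct) auto
  moreover have "(\<Sum>S\<in>\<F>. fscale (c S) (point S) T) = c T" for T
    using c assms by (auto simp: fscale_def point_def chain_space_def if_distrib cong: if_cong)
  ultimately have "c = (\<Sum>S\<in>\<F>. fscale (c S) (point S))"
    by (simp only: fun_eq_iff simp_thms)
  then show "c \<in> fn.span (point ` \<F>)"
    by (metis (no_types, lifting) fn.span_base fn.span_scale fn.span_sum imageI)
qed

lemma finite_family: "convex_family V \<F> \<Longrightarrow> finite \<F>"
  by (auto simp: convex_family_def intro: finite_subset)

lemma dif_chains:
  assumes "convex_family V \<F>" "c \<in> chain_space \<F> (j + 1)"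
  shows "restr \<F> (bdry V c) \<in> chain_space \<F> j"
  unfolding chain_space_def
proof (safe)
  fix S assume nz: "restr \<F> (bdry V c) S \<noteq> 0"
  then show S: "S \<in> \<F>" by (auto simp: restr_def split: if_splits)
  with nz have "bdry V c S \<noteq> 0" by (simp add: restr_def)
  then obtain v where "v \<in> V - S" "c (insert v S) \<noteq> 0"
    unfolding bdry_def by (metis (no_types, lifting) mult_zero_right sum.neutral)
  moreover have "finite S" using S assms(1) by (auto simp: convex_family_def intro: finite_subset)
  ultimately show "int (card S) = j"
    using assms(2) by (auto simp: chain_space_def)
qed

text \<open>Truncation loses nothing: if \<open>S\<close> is in the family and
  \<open>insert v S\<close> is not, convexity also excludes every
  \<open>insert u (insert v S)\<close>, so the discarded coefficient was already zero.\<close>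

lemma dif_dif:
  assumes "convex_family V \<F>" "c \<in> chain_space \<F> j"
  shows "restr \<F> (bdry V (restr \<F> (bdry V c))) = 0"
proof
  fix S
  show "restr \<F> (bdry V (restr \<F> (bdry V c))) S = 0 S"
  proof (cases "S \<in> \<F>")
    case True
    have "restr \<F> (bdry V c) (insert v S) = bdry V c (insert v S)" if "v \<in> V - S" for v
    proof (cases "insert v S \<in> \<F>")
      case False
      have "c (insert u (insert v S)) = 0" for u
      proof (rule ccontr)
        assume "c (insert u (insert v S)) \<noteq> 0"
        then have "insert u (insert v S) \<in> \<F>" using assms(2) by (auto simp: chain_space_def)
        with assms(1) True False show False
          unfolding convex_family_def by (metis subset_insertI)
      qed
      with False show ?thesis by (simp add: restr_def bdry_def)
    qed (simp add: restr_def)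
    then have "bdry V (restr \<F> (bdry V c)) S = bdry V (bdry V c) S"
      by (simp add: bdry_def)
    moreover have "finite V" "S \<subseteq> V"
      using True assms(1) unfolding convex_family_def by auto
    ultimately show ?thesis
      by (simp add: restr_def bdry_bdry)
  qed (simp add: restr_def)
qed

lemma bounds_subset_cycles: "convex_family V \<F> \<Longrightarrow> bounds V \<F> j \<subseteq> cycles V \<F> j"
  unfolding bounds_def cycles_def using dif_chains dif_dif by blast

lemma cycles_subset_chains: "cycles V \<F> j \<subseteq> chain_space \<F> j"
  by (auto simp: cycles_def)

text \<open>Stated on chains rather than as vanishing of \<open>hom\<close>, because the splitting
  arguments use actual preimages of cycles, in neighbouring degrees as well.\<close>

definition acyclic_family :: "'k::field itself \<Rightarrow> 'v::linorder set \<Rightarrow> 'v set set \<Rightarrow> bool" where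
  "acyclic_family _ V \<F> \<longleftrightarrow> (\<forall>j. (cycles V \<F> j :: ('v set \<Rightarrow> 'k) set) \<subseteq> bounds V \<F> j)"

lemma hom_acyclic:
  assumes "convex_family V \<F>" "acyclic_family TYPE('k::field) V \<F>"
  shows "hom TYPE('k) V \<F> j = 0"
proof -
  have "(cycles V \<F> j :: ('a set \<Rightarrow> 'k) set) = bounds V \<F> j"
    using assms bounds_subset_cycles unfolding acyclic_family_def by blast
  then show ?thesis by (simp add: hom_def)
qed

lemma convex_familyD:
  "convex_family V \<F> \<Longrightarrow> A \<in> \<F> \<Longrightarrow> C \<in> \<F> \<Longrightarrow> A \<subseteq> B \<Longrightarrow> B \<subseteq> C \<Longrightarrow> B \<in> \<F>"
  unfolding convex_family_def by blast

section \<open>Subcomplex and quotient of a convex family\<close>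

context
  fixes V :: "'v::linorder set" and \<F> \<A> :: "'v set set"
  assumes \<F>: "convex_family V \<F>" and \<A>: "\<A> \<subseteq> \<F>"
    and down: "\<And>S T. S \<in> \<A> \<Longrightarrow> T \<in> \<F> \<Longrightarrow> T \<subseteq> S \<Longrightarrow> T \<in> \<A>"
begin

lemma convex_family_down: "convex_family V \<A>"
  unfolding convex_family_def
proof (intro conjI allI impI)
  show "finite V" "\<A> \<subseteq> Pow V" using \<F> \<A> by (auto simp: convex_family_def)
  fix A B C assume *: "A \<in> \<A>" "C \<in> \<A>" "A \<subseteq> B" "B \<subseteq> C"
  then have "B \<in> \<F>" using \<A> by (intro convex_familyD[OF \<F>, of A C B]) auto
  with * show "B \<in> \<A>" using down[of C B] by blast
qed

lemma convex_family_up: "convex_family V (\<F> - \<A>)"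
  unfolding convex_family_def
proof (intro conjI allI impI)
  show "finite V" "\<F> - \<A> \<subseteq> Pow V" using \<F> \<A> by (auto simp: convex_family_def)
  fix A B C assume *: "A \<in> \<F> - \<A>" "C \<in> \<F> - \<A>" "A \<subseteq> B" "B \<subseteq> C"
  then have "B \<in> \<F>" using \<A> by (intro convex_familyD[OF \<F>, of A C B]) auto
  with * show "B \<in> \<F> - \<A>" using down[of B A] by blast
qed

lemma dif_down:
  fixes c :: "'v set \<Rightarrow> 'k::field"
  assumes "c \<in> chain_space \<A> j"
  shows "restr \<F> (bdry V c) = restr \<A> (bdry V c)"
proof
  fix S
  have "bdry V c S = 0" if "S \<in> \<F>" "S \<notin> \<A>"
    unfolding bdry_def
  proof (rule sum.neutral, safe)
    fix v
    have "insert v S \<notin> \<A>" using that down[of "insert v S" S] by auto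
    then show "sgn_at v S * c (insert v S) = 0" using assms by (auto simp: chain_space_def)
  qed
  then show "restr \<F> (bdry V c) S = restr \<A> (bdry V c) S"
    using \<A> by (auto simp: restr_def)
qed

lemma dif_up:
  fixes c :: "'v set \<Rightarrow> 'k::field"
  assumes "c \<in> chain_space \<F> j"
  shows "restr (\<F> - \<A>) (restr \<F> (bdry V c)) = restr (\<F> - \<A>) (bdry V (restr (\<F> - \<A>) c))"
proof
  fix S
  have "restr (\<F> - \<A>) c (insert v S) = c (insert v S)" if "S \<in> \<F> - \<A>" for v
    using assms down[of "insert v S" S] that by (auto simp: restr_def chain_space_def)
  then have "S \<in> \<F> - \<A> \<Longrightarrow> bdry V (restr (\<F> - \<A>) c) S = bdry V c S"
    by (simp add: bdry_def)
  then show "restr (\<F> - \<A>) (restr \<F> (bdry V c)) S = restr (\<F> - \<A>) (bdry V (restr (\<F> - \<A>) c)) S"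
    by (auto simp: restr_def)
qed

lemma chains_up: "c \<in> chain_space \<F> j \<Longrightarrow> restr (\<F> - \<A>) c \<in> chain_space (\<F> - \<A>) j"
  by (auto simp: chain_space_def restr_def)

lemma chains_mono: "chain_space \<A> j \<subseteq> chain_space \<F> j" "chain_space (\<F> - \<A>) j \<subseteq> chain_space \<F> j"
  using \<A> by (auto simp: chain_space_def)

lemma chains_kernel: "c \<in> chain_space \<F> j \<Longrightarrow> restr (\<F> - \<A>) c = 0 \<longleftrightarrow> c \<in> chain_space \<A> j"
  using \<A> by (force simp: chain_space_def restr_def fun_eq_iff)

lemma restr_up_id: "c \<in> chain_space (\<F> - \<A>) j \<Longrightarrow> restr (\<F> - \<A>) c = c"
  by (auto simp: chain_space_def restr_def fun_eq_iff)

lemma cycles_kernel: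
  "{c \<in> cycles V \<F> j. restr (\<F> - \<A>) c = 0} = (cycles V \<A> j :: ('v set \<Rightarrow> 'k::field) set)"
  using chains_mono chains_kernel dif_down unfolding cycles_def by fastforce

lemma restr_cycles: "restr (\<F> - \<A>) ` cycles V \<F> j \<subseteq> (cycles V (\<F> - \<A>) j :: ('v set \<Rightarrow> 'k::field) set)"
  using chains_up dif_up unfolding cycles_def by (fastforce simp: image_iff)

lemma restr_bounds: "restr (\<F> - \<A>) ` bounds V \<F> j = (bounds V (\<F> - \<A>) j :: ('v set \<Rightarrow> 'k::field) set)"
proof -
  have "restr (\<F> - \<A>) ` bounds V \<F> j =
      (\<lambda>c. restr (\<F> - \<A>) (bdry V (restr (\<F> - \<A>) c))) ` (chain_space \<F> (j + 1) :: ('v set \<Rightarrow> 'k) set)"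
    unfolding bounds_def image_image by (rule image_cong) (auto simp: dif_up)
  also have "\<dots> = (\<lambda>c. restr (\<F> - \<A>) (bdry V c)) ` restr (\<F> - \<A>) ` chain_space \<F> (j + 1)"
    by (simp add: image_image)
  also have "restr (\<F> - \<A>) ` chain_space \<F> (j + 1) = (chain_space (\<F> - \<A>) (j + 1) :: ('v set \<Rightarrow> 'k) set)"
    using chains_up chains_mono restr_up_id by (force simp: image_iff)
  finally show ?thesis by (simp add: bounds_def)
qed

text \<open>Only an inclusion: a chain may bound in \<open>\<F>\<close> without bounding in
  \<open>\<A>\<close>. This defect and the one in \<open>restr_cycles\<close> are what the
  connecting map of the long exact sequence measures.\<close>

lemma bounds_kernel: "bounds V \<A> j \<subseteq> {c \<in> bounds V \<F> j. restr (\<F> - \<A>) c = (0 :: 'v set \<Rightarrow> 'k::field)}"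
proof
  fix c :: "'v set \<Rightarrow> 'k" assume c: "c \<in> bounds V \<A> j"
  then obtain d where d: "d \<in> chain_space \<A> (j + 1)" "c = restr \<A> (bdry V d)" by (auto simp: bounds_def)
  then have "c = restr \<F> (bdry V d)" by (simp add: dif_down)
  moreover have "c \<in> chain_space \<A> j"
    using c bounds_subset_cycles[OF convex_family_down] cycles_subset_chains by blast
  ultimately show "c \<in> {c \<in> bounds V \<F> j. restr (\<F> - \<A>) c = 0}"
    using d chains_mono chains_kernel unfolding bounds_def by blast
qed

lemma hom_split_dim:
  "hom TYPE('k::field) V \<F> j =
     (fn.dim (cycles V \<A> j :: ('v set \<Rightarrow> 'k) set) + fn.dim (restr (\<F> - \<A>) ` cycles V \<F> j :: ('v set \<Rightarrow> 'k) set)) -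
     (fn.dim {c \<in> bounds V \<F> j. restr (\<F> - \<A>) c = (0 :: 'v set \<Rightarrow> 'k)} +
      fn.dim (bounds V (\<F> - \<A>) j :: ('v set \<Rightarrow> 'k) set))"
proof -
  have fin: "finite (point ` \<F> :: ('v set \<Rightarrow> 'k) set)" using finite_family[OF \<F>] by simp
  have sp: "cycles V \<F> j \<subseteq> fn.span (point ` \<F> :: ('v set \<Rightarrow> 'k) set)"
    using cycles_subset_chains chain_space_span[OF finite_family[OF \<F>]] by blast
  have sp': "bounds V \<F> j \<subseteq> fn.span (point ` \<F> :: ('v set \<Rightarrow> 'k) set)"
    using sp bounds_subset_cycles[OF \<F>] by blast
  show ?thesis
    unfolding hom_def
      fn2.rank_nullity[OF linear_restr subspace_cycles fin sp, where \<F>2 = "\<F> - \<A>"]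
      fn2.rank_nullity[OF linear_restr subspace_bounds fin sp', where \<F>2 = "\<F> - \<A>"]
    by (simp add: cycles_kernel restr_bounds)
qed

text \<open>Exactness at the middle term of the long exact sequence of \<open>\<A>\<close>,
  \<open>\<F>\<close> and \<open>\<F> - \<A>\<close>, as a dimension count.\<close>

lemma hom_split_le: "hom TYPE('k::field) V \<F> j \<le> hom TYPE('k) V \<A> j + hom TYPE('k) V (\<F> - \<A>) j"
proof -
  have "fn.dim (bounds V \<A> j :: ('v set \<Rightarrow> 'k) set) \<le>
      fn.dim {c \<in> bounds V \<F> j. restr (\<F> - \<A>) c = (0 :: 'v set \<Rightarrow> 'k)}"
    by (rule fn.dim_mono_finite[OF bounds_kernel, of "point ` \<F>"])
      (use finite_family[OF \<F>] chain_space_span[OF finite_family[OF \<F>]] bounds_subset_cycles[OF \<F>] cycles_subset_chains in blast)+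
  moreover have "fn.dim (restr (\<F> - \<A>) ` cycles V \<F> j :: ('v set \<Rightarrow> 'k) set) \<le>
      fn.dim (cycles V (\<F> - \<A>) j :: ('v set \<Rightarrow> 'k) set)"
    by (rule fn.dim_mono_finite[OF restr_cycles, of "point ` \<F>"])
      (use finite_family[OF \<F>] chain_space_span[OF finite_family[OF \<F>]] chains_mono(2) cycles_subset_chains in blast)+
  moreover have "fn.dim (bounds V \<A> j :: ('v set \<Rightarrow> 'k) set) \<le> fn.dim (cycles V \<A> j :: ('v set \<Rightarrow> 'k) set)"
    by (rule fn.dim_mono_finite[OF bounds_subset_cycles[OF convex_family_down], of "point ` \<F>"])
      (use finite_family[OF \<F>] chain_space_span[OF finite_family[OF \<F>]] chains_mono(1) cycles_subset_chains in blast)+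
  ultimately show ?thesis
    unfolding hom_split_dim unfolding hom_def by linarith
qed

lemma hom_split_up_acyclic:
  assumes "acyclic_family TYPE('k::field) V (\<F> - \<A>)"
  shows "hom TYPE('k) V \<F> j = hom TYPE('k) V \<A> j"
proof -
  have eq: "cycles V (\<F> - \<A>) j = (bounds V (\<F> - \<A>) j :: ('v set \<Rightarrow> 'k) set)" for j
    using assms bounds_subset_cycles[OF convex_family_up] unfolding acyclic_family_def by blast
  have "restr (\<F> - \<A>) ` cycles V \<F> j = (bounds V (\<F> - \<A>) j :: ('v set \<Rightarrow> 'k) set)"
  proof
    show "restr (\<F> - \<A>) ` cycles V \<F> j \<subseteq> (bounds V (\<F> - \<A>) j :: ('v set \<Rightarrow> 'k) set)"
      using restr_cycles eq by blast
    show "bounds V (\<F> - \<A>) j \<subseteq> (restr (\<F> - \<A>) ` cycles V \<F> j :: ('v set \<Rightarrow> 'k) set)"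
      unfolding restr_bounds[symmetric] by (intro image_mono bounds_subset_cycles \<F>)
  qed
  moreover have "{c \<in> bounds V \<F> j. restr (\<F> - \<A>) c = (0 :: 'v set \<Rightarrow> 'k)} \<subseteq> bounds V \<A> j"
  proof safe
    fix c :: "'v set \<Rightarrow> 'k"
    assume "c \<in> bounds V \<F> j" and 0: "restr (\<F> - \<A>) c = 0"
    then obtain f where f: "f \<in> chain_space \<F> (j + 1)" "c = restr \<F> (bdry V f)" by (auto simp: bounds_def)
    have "restr (\<F> - \<A>) f \<in> cycles V (\<F> - \<A>) (j + 1)"
      using chains_up[OF f(1)] 0 dif_up[OF f(1)] f(2) by (simp add: cycles_def)
    then obtain g where g: "g \<in> chain_space (\<F> - \<A>) (j + 2)"
      "restr (\<F> - \<A>) f = restr (\<F> - \<A>) (bdry V g)"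
      unfolding eq by (auto simp: bounds_def add.assoc)
    have gF: "g \<in> chain_space \<F> (j + 2)" using g(1) chains_mono by auto
    \<comment> \<open>\<open>f\<close> restricts to a cycle of the acyclic quotient, hence to a
      boundary of some \<open>g\<close>. Subtracting the boundary of \<open>g\<close> moves
      \<open>f\<close> into \<open>\<A>\<close> and keeps its boundary \<open>c\<close>.\<close>
    let ?e = "f - restr \<F> (bdry V g)"
    interpret d: Vector_Spaces.linear fscale fscale "\<lambda>c :: 'v set \<Rightarrow> 'k. restr \<F> (bdry V c)" by (rule linear_dif)
    interpret r: Vector_Spaces.linear fscale fscale "restr (\<F> - \<A>) :: ('v set \<Rightarrow> 'k) \<Rightarrow> _" by (rule linear_restr)
    have "?e \<in> chain_space \<F> (j + 1)"
    proof (rule fn.subspace_diff[OF subspace_chains f(1) dif_chains[OF \<F>]])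
      show "g \<in> chain_space \<F> (j + 1 + 1)" using gF by (simp add: add.assoc)
    qed
    moreover have "restr (\<F> - \<A>) ?e = 0"
      using dif_up[OF gF] restr_up_id[OF g(1)] g(2) by (simp add: r.diff)
    ultimately have e: "?e \<in> chain_space \<A> (j + 1)" using chains_kernel by blast
    have "c = restr \<F> (bdry V ?e)"
      using f(2) dif_dif[OF \<F> gF] by (simp add: d.diff)
    with e show "c \<in> bounds V \<A> j" by (auto simp: bounds_def dif_down)
  qed
  then have "{c \<in> bounds V \<F> j. restr (\<F> - \<A>) c = (0 :: 'v set \<Rightarrow> 'k)} = bounds V \<A> j"
    using bounds_kernel by blast
  ultimately show ?thesis
    unfolding hom_split_dim unfolding hom_def by simp
qed

lemma hom_split_down_acyclic:
  assumes "acyclic_family TYPE('k::field) V \<A>"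
  shows "hom TYPE('k) V \<F> j = hom TYPE('k) V (\<F> - \<A>) j"
proof -
  have eq: "cycles V \<A> j = (bounds V \<A> j :: ('v set \<Rightarrow> 'k) set)" for j
    using assms bounds_subset_cycles[OF convex_family_down] unfolding acyclic_family_def by blast
  have "{c \<in> bounds V \<F> j. restr (\<F> - \<A>) c = (0 :: 'v set \<Rightarrow> 'k)} \<subseteq> cycles V \<A> j"
    using bounds_subset_cycles[OF \<F>] cycles_kernel[of j, where 'k = 'k] by blast
  then have "{c \<in> bounds V \<F> j. restr (\<F> - \<A>) c = (0 :: 'v set \<Rightarrow> 'k)} = bounds V \<A> j"
    using bounds_kernel eq by blast
  moreover have "cycles V (\<F> - \<A>) j \<subseteq> (restr (\<F> - \<A>) ` cycles V \<F> j :: ('v set \<Rightarrow> 'k) set)"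
  proof
    fix z :: "'v set \<Rightarrow> 'k" assume z: "z \<in> cycles V (\<F> - \<A>) j"
    then have zF: "z \<in> chain_space \<F> j" using chains_mono by (auto simp: cycles_def)
    have zr: "restr (\<F> - \<A>) z = z" using z restr_up_id by (auto simp: cycles_def)
    let ?dz = "restr \<F> (bdry V z)"
    have dz: "?dz \<in> chain_space \<F> (j - 1)" using dif_chains[OF \<F>, of z "j - 1"] zF by simp
    have "restr (\<F> - \<A>) ?dz = 0" using z dif_up[OF zF] zr by (simp add: cycles_def)
    then have "?dz \<in> cycles V \<A> (j - 1)"
      unfolding cycles_kernel[symmetric] using dz dif_dif[OF \<F> zF] by (simp add: cycles_def)
    \<comment> \<open>The boundary of \<open>z\<close> is a cycle of the acyclic subcomplex, so it
      is also the boundary of some \<open>a\<close> there; \<open>z - a\<close> is a cycle of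
      \<open>\<F>\<close> that still restricts to \<open>z\<close>.\<close>
    then obtain a where a: "a \<in> chain_space \<A> j" "?dz = restr \<A> (bdry V a)"
      unfolding eq by (auto simp: bounds_def)
    interpret d: Vector_Spaces.linear fscale fscale "\<lambda>c :: 'v set \<Rightarrow> 'k. restr \<F> (bdry V c)" by (rule linear_dif)
    interpret r: Vector_Spaces.linear fscale fscale "restr (\<F> - \<A>) :: ('v set \<Rightarrow> 'k) \<Rightarrow> _" by (rule linear_restr)
    have aF: "a \<in> chain_space \<F> j" using a(1) chains_mono by auto
    then have "z - a \<in> cycles V \<F> j"
      using a zF by (simp add: cycles_def fn.subspace_diff[OF subspace_chains] d.diff dif_down)
    moreover have "restr (\<F> - \<A>) (z - a) = z"
      using chains_kernel[OF aF] a(1) zr by (simp add: r.diff)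
    ultimately show "z \<in> restr (\<F> - \<A>) ` cycles V \<F> j" by (metis imageI)
  qed
  then have "restr (\<F> - \<A>) ` cycles V \<F> j = (cycles V (\<F> - \<A>) j :: ('v set \<Rightarrow> 'k) set)"
    using restr_cycles by blast
  ultimately show ?thesis
    unfolding hom_split_dim unfolding hom_def by (simp add: eq)
qed

end

text \<open>The family consists of pairs \<open>S\<close>, \<open>insert v S\<close>, and inserting
  \<open>v\<close> is a contracting homotopy as in a cone with apex \<open>v\<close>. All acyclicity
  used later comes from such a matching.\<close>

lemma acyclic_toggle:
  assumes \<F>: "convex_family V \<F>" and v: "v \<in> V"
    and toggle: "\<And>S. insert v S \<in> \<F> \<longleftrightarrow> S - {v} \<in> \<F>"
  shows "acyclic_family TYPE('k::field) V \<F>"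
  unfolding acyclic_family_def
proof (intro allI subsetI)
  fix j and z :: "'a set \<Rightarrow> 'k" assume z: "z \<in> cycles V \<F> j"
  have finV: "finite V" and sub: "S \<subseteq> V" if "S \<in> \<F>" for S
    using \<F> that by (auto simp: convex_family_def)
  define g where "g = (\<lambda>S. if v \<in> S then sgn_at v S * z (S - {v}) else 0)"
  have "g \<in> chain_space \<F> (j + 1)"
    unfolding chain_space_def
  proof safe
    fix S assume "g S \<noteq> 0"
    then have vS: "v \<in> S" and "z (S - {v}) \<noteq> 0" by (auto simp: g_def split: if_splits)
    then have S: "S - {v} \<in> \<F>" "int (card (S - {v})) = j"
      using z by (auto simp: cycles_def chain_space_def)
    then show "S \<in> \<F>" using toggle[of S] vS by (simp add: insert_absorb)
    have "finite (S - {v})" using finite_subset[OF sub[OF S(1)] finV[OF S(1)]] .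
    then have "card S = Suc (card (S - {v}))" using vS by (metis card.remove finite_Diff2 finite.emptyI finite_insert)
    then show "int (card S) = j + 1" using S(2) by simp
  qed
  moreover have "restr \<F> (bdry V g) S = z S" for S
  proof (cases "S \<in> \<F>")
    case S: True
    have fS: "finite S" "finite V" using finV[OF S] sub[OF S] by (auto intro: finite_subset)
    show ?thesis
    proof (cases "v \<in> S")
      case False
      have "bdry V g S = (\<Sum>u\<in>V - S. if u = v then z S else 0)"
        unfolding bdry_def
      proof (rule sum.cong)
        fix u assume u: "u \<in> V - S"
        show "sgn_at u S * g (insert u S) = (if u = v then z S else 0)"
          using False fS by (auto simp: g_def sgn_at_insert insert_Diff_if)
      qed simp
      also have "\<dots> = z S" using False v fS by simp
      finally show ?thesis using S by (simp add: restr_def)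
    next
      case True
      define S' where "S' = S - {v}"
      have S': "S = insert v S'" "v \<notin> S'" "finite S'" using True fS by (auto simp: S'_def)
      have "S' \<in> \<F>" using S toggle[of S] True by (simp add: S'_def insert_absorb)
      \<comment> \<open>For \<open>v\<close> in \<open>S\<close> the boundary of \<open>g\<close> at
        \<open>S\<close> only involves values of \<open>z\<close> at other sets; the cycle equation
        of \<open>z\<close> at \<open>S'\<close> turns their sum into \<open>z S\<close>.\<close>
      then have "bdry V z S' = 0"
        using z by (auto simp: cycles_def restr_def fun_eq_iff split: if_splits dest: spec[of _ S'])
      moreover have VS: "V - S' = insert v (V - S)" using v by (auto simp: S'_def)
      have "bdry V z S' = sgn_at v S' * z (insert v S') + (\<Sum>u\<in>V - S. sgn_at u S' * z (insert u S'))"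
        unfolding bdry_def VS by (rule sum.insert) (use fS True in auto)
      ultimately have 0: "sgn_at v S' * z S + (\<Sum>u\<in>V - S. sgn_at u S' * z (insert u S')) = 0"
        unfolding S'(1)[symmetric] by simp
      have "bdry V g S = (\<Sum>u\<in>V - S. - sgn_at v S' * (sgn_at u S' * z (insert u S')))"
        unfolding bdry_def
      proof (rule sum.cong)
        fix u assume u: "u \<in> V - S"
        then have uv: "u \<noteq> v" "u \<notin> S'" using True by (auto simp: S'_def)
        have "insert u S - {v} = insert u S'" using uv by (auto simp: S'_def)
        then have "g (insert u S) = sgn_at v (insert u S) * z (insert u S')"
          using True by (simp add: g_def)
        moreover have "sgn_at v (insert u S) = (sgn_at v (insert u S') :: 'k)"
          unfolding S'(1) insert_commute[of u] using S' uv by (subst sgn_at_insert) auto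
        moreover have "sgn_at u S * sgn_at v (insert u S') = (- sgn_at v S' * sgn_at u S' :: 'k)"
          using S' uv by (cases "u < v") (auto simp: sgn_at_insert)
        ultimately show "sgn_at u S * g (insert u S) = - sgn_at v S' * (sgn_at u S' * z (insert u S'))"
          by (simp flip: mult.assoc)
      qed simp
      also have "\<dots> = - sgn_at v S' * (\<Sum>u\<in>V - S. sgn_at u S' * z (insert u S'))"
        by (simp add: sum_distrib_left)
      also have "(\<Sum>u\<in>V - S. sgn_at u S' * z (insert u S')) = - (sgn_at v S' * z S)"
        using 0 by (simp add: eq_neg_iff_add_eq_0 add.commute)
      finally show ?thesis using S by (simp add: restr_def)
    qed
  next
    case False
    then show ?thesis using z by (auto simp: restr_def cycles_def chain_space_def)
  qed
  ultimately show "z \<in> bounds V \<F> j"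
    unfolding bounds_def by (auto simp: image_iff fun_eq_iff intro!: bexI[of _ g])
qed

lemma chain_space_empty:
  assumes "\<And>S. S \<in> \<F> \<Longrightarrow> int (card S) \<noteq> j"
  shows "chain_space \<F> j = {0}"
proof -
  have "c = 0" if "c \<in> chain_space \<F> j" for c :: "'a set \<Rightarrow> 'b"
  proof
    show "c S = 0 S" for S using that assms[of S] by (auto simp: chain_space_def)
  qed
  then show ?thesis by (auto simp: chain_space_def)
qed

lemma hom_eq_0:
  assumes "\<And>S. S \<in> \<F> \<Longrightarrow> int (card S) \<noteq> j"
  shows "hom TYPE('k::field) V \<F> j = 0"
proof -
  have "cycles V \<F> j \<subseteq> {0 :: 'a set \<Rightarrow> 'k}"
    using chain_space_empty[of \<F> j] assms cycles_subset_chains by blast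
  then have "fn.dim (cycles V \<F> j :: ('a set \<Rightarrow> 'k) set) \<le> fn.dim {0 :: 'a set \<Rightarrow> 'k}"
    by (rule fn.dim_mono_finite[of _ _ "{}"]) auto
  then show ?thesis by (simp add: hom_def)
qed

lemma hom_empty [simp]: "hom TYPE('k::field) V {} j = 0"
  by (rule hom_eq_0) simp

lemma hom_singleton:
  fixes S :: "'v::linorder set"
  shows "hom TYPE('k::field) V {S} j = (if j = int (card S) then 1 else 0)"
proof (cases "j = int (card S)")
  case True
  have 0: "restr {S} (bdry V c) = 0" if "c \<in> chain_space {S} i" for c :: "'v set \<Rightarrow> 'k" and i
  proof
    fix T
    have "bdry V c S = 0"
      unfolding bdry_def by (rule sum.neutral) (use that in \<open>auto simp: chain_space_def\<close>)
    then show "restr {S} (bdry V c) T = 0 T" by (auto simp: restr_def)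
  qed
  have ind: "fn.independent {point S :: 'v set \<Rightarrow> 'k}"
  proof -
    have "(point S :: 'v set \<Rightarrow> 'k) S \<noteq> 0 S" by (simp add: point_def)
    then show ?thesis by (metis fn.dependent_single)
  qed
  have "cycles V {S} j = (chain_space {S} j :: ('v set \<Rightarrow> 'k) set)"
    using 0 by (auto simp: cycles_def)
  moreover have "point S \<in> (chain_space {S} j :: ('v set \<Rightarrow> 'k) set)"
    using True by (auto simp: chain_space_def point_def)
  ultimately have "fn.dim (cycles V {S} j :: ('v set \<Rightarrow> 'k) set) = card {point S :: 'v set \<Rightarrow> 'k}"
    using chain_space_span[of "{S}" j] ind by (intro fn.basis_card_eq_dim[symmetric]) auto
  moreover have "bounds V {S} j \<subseteq> {0 :: 'v set \<Rightarrow> 'k}"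
    by (auto simp: bounds_def 0)
  then have "fn.dim (bounds V {S} j :: ('v set \<Rightarrow> 'k) set) \<le> fn.dim {0 :: 'v set \<Rightarrow> 'k}"
    by (rule fn.dim_mono_finite[of _ _ "{}"]) auto
  ultimately show ?thesis using True by (simp add: hom_def)
qed (auto intro: hom_eq_0)

text \<open>The sign makes inserting a common vertex commute with the differential.\<close>

definition lift_chain :: "'v::linorder \<Rightarrow> ('v set \<Rightarrow> 'k::field) \<Rightarrow> 'v set \<Rightarrow> 'k" where
  "lift_chain v c = (\<lambda>S. if v \<in> S then (-1) ^ card {u \<in> S. v < u} * c (S - {v}) else 0)"

text \<open>Faces obtained by deleting \<open>v\<close> leave the new family, so its differential
  acts on the remaining vertices only; both complexes agree up to the sign in
  \<open>lift_chain\<close> and a shift by one.\<close>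

lemma hom_insert:
  assumes \<F>: "convex_family V \<F>" and v: "v \<in> V" and vF: "\<And>S. S \<in> \<F> \<Longrightarrow> v \<notin> S"
  shows "hom TYPE('k::field) V (insert v ` \<F>) (j + 1) = hom TYPE('k) V \<F> j"
proof -
  let ?l = "lift_chain v :: ('a set \<Rightarrow> 'k) \<Rightarrow> _"
  have finS: "finite S" and sub: "S \<subseteq> V" if "S \<in> \<F>" for S
    using \<F> that by (auto simp: convex_family_def intro: finite_subset)
  have lin: "Vector_Spaces.linear fscale fscale ?l"
    by unfold_locales (auto simp: lift_chain_def fscale_def fun_eq_iff algebra_simps)
  have inj: "c = 0" if c: "c \<in> chain_space \<F> j" "?l c = 0" for c j
  proof
    fix S
    show "c S = 0 S"
    proof (cases "S \<in> \<F>")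
      case True
      have "?l c (insert v S) = 0" using c(2) by simp
      then show ?thesis using vF[OF True] by (simp add: lift_chain_def)
    qed (use c(1) in \<open>auto simp: chain_space_def\<close>)
  qed
  have im: "chain_space (insert v ` \<F>) (i + 1) = ?l ` chain_space \<F> i" for i
  proof (intro equalityI subsetI)
    fix d :: "'a set \<Rightarrow> 'k" assume d: "d \<in> chain_space (insert v ` \<F>) (i + 1)"
    define c where "c = (\<lambda>S. if v \<in> S then 0 else (-1) ^ card {u \<in> insert v S. v < u} * d (insert v S) :: 'k)"
    have "c \<in> chain_space \<F> i"
      unfolding chain_space_def
    proof safe
      fix S assume nz: "c S \<noteq> 0"
      then have vS: "v \<notin> S" "d (insert v S) \<noteq> 0" by (auto simp: c_def split: if_splits)
      then obtain T where T: "T \<in> \<F>" "insert v S = insert v T" "int (card (insert v S)) = i + 1"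
        using d unfolding chain_space_def by blast
      have "S = T" using T(2) vS(1) vF[OF T(1)] by (simp add: insert_ident)
      then show "S \<in> \<F>" "int (card S) = i" using T finS vS by auto
    qed
    moreover have "?l c = d"
    proof
      fix S
      show "?l c S = d S"
        using d by (auto simp: lift_chain_def c_def insert_absorb chain_space_def mult.assoc[symmetric]
            simp flip: power_add)
    qed
    ultimately show "d \<in> ?l ` chain_space \<F> i" by blast
  next
    fix d :: "'a set \<Rightarrow> 'k" assume "d \<in> ?l ` chain_space \<F> i"
    then obtain c where c: "c \<in> chain_space \<F> i" "d = ?l c" by auto
    show "d \<in> chain_space (insert v ` \<F>) (i + 1)"
      unfolding chain_space_def
    proof safe
      fix S assume "d S \<noteq> 0"
      then have vS: "v \<in> S" "c (S - {v}) \<noteq> 0" using c(2) by (auto simp: lift_chain_def split: if_splits)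
      then have S: "S - {v} \<in> \<F>" "int (card (S - {v})) = i" using c(1) by (auto simp: chain_space_def)
      have e: "S = insert v (S - {v})" using vS by auto
      show "S \<in> insert v ` \<F>" using S(1) e by blast
      have "finite S" using finS[OF S(1)] by simp
      then have "Suc (card (S - {v})) = card S" using vS(1) by (rule card_Suc_Diff1)
      then show "int (card S) = i + 1" using S(2) by simp
    qed
  qed
  have comm: "restr (insert v ` \<F>) (bdry V (?l c)) = ?l (restr \<F> (bdry V c))"
    if c: "c \<in> chain_space \<F> i" for c i
  proof
    fix S
    show "restr (insert v ` \<F>) (bdry V (?l c)) S = ?l (restr \<F> (bdry V c)) S"
    proof (cases "S \<in> insert v ` \<F>")
      case True
      then obtain T where T: "T \<in> \<F>" "S = insert v T" by auto
      have vT: "v \<notin> T" "finite T" using vF finS T by auto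
      then have eS: "{u \<in> S. v < u} = {u \<in> T. v < u}" "S - {v} = T" using T by auto
      have "bdry V (?l c) S = (\<Sum>u\<in>V - S. (-1) ^ card {u \<in> T. v < u} * (sgn_at u T * c (insert u T)))"
        unfolding bdry_def
      proof (rule sum.cong)
        fix u assume u: "u \<in> V - S"
        then have uv: "u \<noteq> v" "u \<notin> T" using T by auto
        have "{w \<in> insert u S. v < w} = (if v < u then insert u {w \<in> T. v < w} else {w \<in> T. v < w})"
          using T uv by auto
        then have "(-1) ^ card {w \<in> insert u S. v < w} =
            (if v < u then -1 else 1) * (-1 :: 'k) ^ card {w \<in> T. v < w}"
          using uv vT by simp
        moreover have "insert u S - {v} = insert u T" using T uv vT by auto
        moreover have "sgn_at u S = (if v < u then - sgn_at u T else (sgn_at u T :: 'k))"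
          using T vT by (simp add: sgn_at_insert)
        ultimately show "sgn_at u S * ?l c (insert u S) =
            (-1) ^ card {u \<in> T. v < u} * (sgn_at u T * c (insert u T))"
          using T by (simp add: lift_chain_def)
      qed simp
      also have "\<dots> = (\<Sum>u\<in>V - T. (-1) ^ card {u \<in> T. v < u} * (sgn_at u T * c (insert u T)))"
      proof (rule sum.mono_neutral_left)
        show "finite (V - T)" using \<F> by (simp add: convex_family_def)
        \<comment> \<open>The two index sets differ only by \<open>v\<close> itself, whose term
          vanishes.\<close>
        have "insert v T \<notin> \<F>" using vF by blast
        then have "c (insert v T) = 0" using c by (auto simp: chain_space_def)
        then show "\<forall>u\<in>(V - T) - (V - S). (-1) ^ card {u \<in> T. v < u} * (sgn_at u T * c (insert u T)) = 0"
          using T by auto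
      qed (use T in auto)
      finally show ?thesis
        using True T eS by (simp add: restr_def lift_chain_def bdry_def sum_distrib_left)
    next
      case False
      then have "S - {v} \<notin> \<F>" if "v \<in> S" using that by (metis image_eqI insert_Diff)
      with False show ?thesis by (auto simp: restr_def lift_chain_def)
    qed
  qed
  have zero: "?l 0 = 0" by (auto simp: lift_chain_def fun_eq_iff)
  have cyc: "cycles V (insert v ` \<F>) (j + 1) = ?l ` cycles V \<F> j"
  proof -
    have "restr (insert v ` \<F>) (bdry V (?l c)) = 0 \<longleftrightarrow> restr \<F> (bdry V c) = 0" if "c \<in> chain_space \<F> j" for c
      using comm[OF that] inj[of "restr \<F> (bdry V c)" "j - 1"] dif_chains[OF \<F>, of c "j - 1"] that zero
      by auto
    then show ?thesis by (auto simp: cycles_def im)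
  qed
  have bou: "bounds V (insert v ` \<F>) (j + 1) = ?l ` bounds V \<F> j"
    unfolding bounds_def im image_image by (rule image_cong) (auto simp: comm)
  have fin: "finite (point ` \<F> :: ('a set \<Rightarrow> 'k) set)" using finite_family[OF \<F>] by simp
  have sp: "cycles V \<F> j \<subseteq> fn.span (point ` \<F> :: ('a set \<Rightarrow> 'k) set)"
    using cycles_subset_chains chain_space_span[OF finite_family[OF \<F>]] by blast
  have sp': "bounds V \<F> j \<subseteq> fn.span (point ` \<F> :: ('a set \<Rightarrow> 'k) set)"
    using sp bounds_subset_cycles[OF \<F>] by blast
  have "fn.dim (cycles V (insert v ` \<F>) (j + 1) :: ('a set \<Rightarrow> 'k) set) = fn.dim (cycles V \<F> j :: ('a set \<Rightarrow> 'k) set)"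
    unfolding cyc
  proof (rule fn2.dim_image_inj[OF lin subspace_cycles fin sp])
    show "c = 0" if "c \<in> cycles V \<F> j" "?l c = 0" for c
      using inj[of c j] that by (simp add: cycles_def)
  qed
  moreover have "fn.dim (bounds V (insert v ` \<F>) (j + 1) :: ('a set \<Rightarrow> 'k) set) = fn.dim (bounds V \<F> j :: ('a set \<Rightarrow> 'k) set)"
    unfolding bou
  proof (rule fn2.dim_image_inj[OF lin subspace_bounds fin sp'])
    show "c = 0" if "c \<in> bounds V \<F> j" "?l c = 0" for c
      using inj[of c j] that bounds_subset_cycles[OF \<F>] cycles_subset_chains by blast
  qed
  ultimately show ?thesis by (simp add: hom_def)
qed

section \<open>Betti numbers of edge ideals as homology of families\<close>

lemma lookup_indicator_degree:
  "finite S \<Longrightarrow> Poly_Mapping.lookup (indicator_degree S) v = (if v \<in> S then 1 else 0)"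
  by (simp add: indicator_degree_def lookup_sum lookup_single when_def)

lemma keys_indicator_degree: "finite S \<Longrightarrow> Poly_Mapping.keys (indicator_degree S) = S"
  by (auto simp: in_keys_iff lookup_indicator_degree split: if_splits)

lemma indicator_degree_Un:
  "finite S \<Longrightarrow> finite T \<Longrightarrow> S \<inter> T = {} \<Longrightarrow> indicator_degree (S \<union> T) = indicator_degree S + indicator_degree T"
  by (simp add: indicator_degree_def sum.union_disjoint)

lemma mvar_mult: "mvar u * mvar v = Poly_Mapping.single (Poly_Mapping.single u 1 + Poly_Mapping.single v 1) 1"
  by (simp add: mvar_def mult_single)

lemma monomial_in_edge_idealD:
  fixes k :: "'k::field"
  assumes "Poly_Mapping.single m k \<in> edge_ideal X Y E" "k \<noteq> 0"
  obtains x y where "(x, y) \<in> E" "Inl x \<in> Poly_Mapping.keys m" "Inr y \<in> Poly_Mapping.keys m"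
proof -
  let ?B = "{mvar (Inl x) * mvar (Inr y) | x y. (x, y) \<in> E} :: ('a + 'b, 'k) mpoly set"
  obtain c where c: "Poly_Mapping.single m k = (\<Sum>b\<in>?B. c b * b)"
    using assms(1) unfolding edge_ideal_def ideal_gen_def by auto
  have "m \<in> Poly_Mapping.keys (\<Sum>b\<in>?B. c b * b)"
    unfolding c[symmetric] using assms(2) by simp
  from subsetD[OF keys_sum this]
  obtain b where b: "b \<in> ?B" "m \<in> Poly_Mapping.keys (c b * b)"
    by blast
  then obtain x y where xy: "(x, y) \<in> E" "b = mvar (Inl x) * mvar (Inr y)" by auto
  then obtain n where "m = n + (Poly_Mapping.single (Inl x) 1 + Poly_Mapping.single (Inr y) 1)"
    using b(2) keys_mult[of "c b" b] by (auto simp: mvar_mult)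
  then have "Inl x \<in> Poly_Mapping.keys m" "Inr y \<in> Poly_Mapping.keys m"
    by (auto simp: in_keys_iff lookup_add lookup_single)
  with xy show ?thesis using that by blast
qed

lemma monomial_in_edge_idealI:
  fixes k :: "'k::field"
  assumes "bipartite_graph X Y E" and m: "Poly_Mapping.keys m \<subseteq> X <+> Y"
    and xy: "(x, y) \<in> E" "Inl x \<in> Poly_Mapping.keys m" "Inr y \<in> Poly_Mapping.keys m"
  shows "Poly_Mapping.single m k \<in> edge_ideal X Y E"
proof -
  let ?B = "{mvar (Inl x) * mvar (Inr y) | x y. (x, y) \<in> E} :: ('a + 'b, 'k) mpoly set"
  let ?e = "Poly_Mapping.single (Inl x) 1 + Poly_Mapping.single (Inr y) 1 :: 'a + 'b \<Rightarrow>\<^sub>0 nat"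
  let ?b = "mvar (Inl x) * mvar (Inr y) :: ('a + 'b, 'k) mpoly"
  define c where "c b = (if b = ?b then Poly_Mapping.single (m - ?e) k else 0)" for b
  have "finite E"
    using assms(1) by (auto simp: bipartite_graph_def intro: finite_subset)
  moreover have "?B = (\<lambda>(x, y). mvar (Inl x) * mvar (Inr y)) ` E" by auto
  ultimately have fin: "finite ?B" by simp
  have me: "m - ?e + ?e = m"
    by (rule poly_mapping_eqI) (use xy in \<open>auto simp: lookup_add lookup_minus lookup_single when_def in_keys_iff\<close>)
  have "(\<Sum>b\<in>?B. c b * b) = (\<Sum>b\<in>?B. if b = ?b then c ?b * ?b else 0)"
    by (rule sum.cong) (auto simp: c_def)
  also have "\<dots> = c ?b * ?b"
    using fin xy(1) by (subst sum.delta) auto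
  also have "\<dots> = Poly_Mapping.single m k"
    unfolding c_def mvar_mult by (simp only: simp_thms if_True mult_single me mult_1_right)
  finally have "Poly_Mapping.single m k = (\<Sum>b\<in>?B. c b * b)" ..
  moreover have "\<forall>b\<in>?B. c b \<in> poly_ring (X <+> Y)"
  proof -
    have "Poly_Mapping.keys (m - ?e) \<subseteq> Poly_Mapping.keys m"
      by (auto simp: in_keys_iff lookup_minus)
    then show ?thesis using m by (auto simp: c_def poly_ring_def)
  qed
  ultimately show ?thesis
    unfolding edge_ideal_def ideal_gen_def by blast
qed

text \<open>The upper Koszul complex of the edge ideal: the squarefree monomial on the complement of
  \<open>S\<close> must lie in the ideal, which means that the complement contains an edge.\<close>

definition edge_family :: "('a \<times> 'b) set \<Rightarrow> 'a set \<Rightarrow> 'b set \<Rightarrow> ('a + 'b) set set" where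
  "edge_family E X' Y' =
     {S. S \<subseteq> X' <+> Y' \<and> (\<exists>(x, y)\<in>E. Inl x \<in> X' <+> Y' - S \<and> Inr y \<in> X' <+> Y' - S)}"

text \<open>In the squarefree multidegree of \<open>W\<close> the coefficient of the symbol at
  \<open>F\<close> can only be a scalar multiple of the monomial on \<open>W - F\<close>. Chains of
  this multidegree are therefore scalar functions on subsets of \<open>W\<close>.\<close>

definition koszul_embed :: "'v set \<Rightarrow> ('v set \<Rightarrow> 'k::field) \<Rightarrow> ('v, 'k) chain" where
  "koszul_embed W c =
     (\<Sum>F\<in>Pow W. Poly_Mapping.single F (Poly_Mapping.single (indicator_degree (W - F)) (c F)))"

lemma lookup_koszul_embed:
  "finite W \<Longrightarrow> Poly_Mapping.lookup (koszul_embed W c) F =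
     (if F \<subseteq> W then Poly_Mapping.single (indicator_degree (W - F)) (c F) else 0)"
  by (simp add: koszul_embed_def lookup_sum lookup_single when_def)

lemma lookup_chain_scale:
  "Poly_Mapping.lookup (chain_scale k c) F = Poly_Mapping.single 0 k * Poly_Mapping.lookup c F"
  by (simp add: chain_scale_def map.rep_eq when_def)

interpretation fk: vector_space_pair
  "fscale :: 'k::field \<Rightarrow> ('v set \<Rightarrow> 'k) \<Rightarrow> _" "chain_scale :: 'k \<Rightarrow> ('v, 'k) chain \<Rightarrow> _"
  by (intro vector_space_pair.intro fn.vector_space_axioms vector_space_chain_scale)

lemma linear_koszul_embed:
  assumes "finite W"
  shows "Vector_Spaces.linear fscale chain_scale (koszul_embed W :: ('v set \<Rightarrow> 'k::field) \<Rightarrow> _)"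
proof -
  interpret k: vector_space "chain_scale :: 'k \<Rightarrow> ('v, 'k) chain \<Rightarrow> _" by (rule vector_space_chain_scale)
  show ?thesis
    by unfold_locales
      (auto intro!: poly_mapping_eqI[where 'a = "'v set"] simp: lookup_koszul_embed[OF assms] lookup_add single_add
        lookup_chain_scale mult_single fscale_def)
qed

lemma koszul_embed_bdry:
  fixes c :: "'v::linorder set \<Rightarrow> 'k::field"
  assumes V: "finite V" and W: "W \<subseteq> V" and c: "\<And>S. c S \<noteq> 0 \<Longrightarrow> S \<subseteq> W"
  shows "koszul_diff (koszul_embed W c) = koszul_embed W (bdry V c)"
proof -
  have fW: "finite W" using V W by (rule rev_finite_subset)
  define t where "t G v = Poly_Mapping.single G (Poly_Mapping.single (indicator_degree (W - G))
      (sgn_at v G * c (insert v G)))" for G v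
  have "koszul_diff (koszul_embed W c) = (\<Sum>F\<in>Pow W. \<Sum>v\<in>F. t (F - {v}) v)"
    unfolding koszul_embed_def koszul_diff_sum koszul_diff_monomial
  proof (intro sum.cong refl)
    fix F v assume F: "F \<in> Pow W" and v: "v \<in> F"
    have "indicator_degree (W - (F - {v})) = indicator_degree ((W - F) \<union> {v})"
      by (rule arg_cong[of _ _ indicator_degree]) (use F v in auto)
    also have "\<dots> = indicator_degree (W - F) + Poly_Mapping.single v 1"
      using F v fW by (subst indicator_degree_Un) (auto simp: indicator_degree_def)
    finally have 1: "indicator_degree (W - (F - {v})) = indicator_degree (W - F) + Poly_Mapping.single v 1" .
    have 2: "sgn_at v (F - {v}) = ((-1) ^ card {u \<in> F. u < v} :: 'k)"
      unfolding sgn_at_def by (rule arg_cong[of _ _ "\<lambda>A. (-1) ^ card A"]) auto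
    show "Poly_Mapping.single (F - {v}) (Poly_Mapping.single (indicator_degree (W - F) + Poly_Mapping.single v 1)
        ((-1) ^ card {u \<in> F. u < v} * c F)) = t (F - {v}) v"
      unfolding t_def 1 2 using v by (simp add: insert_absorb)
  qed
  also have "\<dots> = (\<Sum>(F, v)\<in>(SIGMA F:Pow W. F). t (F - {v}) v)"
    by (rule sum.Sigma) (use fW in \<open>auto intro: finite_subset\<close>)
  \<comment> \<open>Instead of a set and a vertex to remove, the index becomes the resulting face
    and the vertex to put back, which is the form of \<open>bdry\<close>.\<close>
  also have "\<dots> = (\<Sum>(G, v)\<in>(SIGMA G:Pow W. W - G). t G v)"
    by (rule sum.reindex_bij_witness[of _ "\<lambda>(G, v). (insert v G, v)" "\<lambda>(F, v). (F - {v}, v)"])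
      (auto simp: insert_absorb)
  also have "\<dots> = (\<Sum>G\<in>Pow W. \<Sum>v\<in>W - G. t G v)"
    by (rule sum.Sigma[symmetric]) (use fW in auto)
  also have "\<dots> = (\<Sum>G\<in>Pow W. Poly_Mapping.single G (Poly_Mapping.single (indicator_degree (W - G)) (bdry V c G)))"
  proof (rule sum.cong)
    fix G assume G: "G \<in> Pow W"
    have "bdry V c G = (\<Sum>v\<in>W - G. sgn_at v G * c (insert v G))"
      unfolding bdry_def by (rule sum.mono_neutral_right) (use V W c in auto)
    moreover have "(\<Sum>v\<in>A. t G v) = Poly_Mapping.single G (Poly_Mapping.single (indicator_degree (W - G))
        (\<Sum>v\<in>A. sgn_at v G * c (insert v G)))" for A
      by (induction A rule: infinite_finite_induct) (auto simp: t_def single_add)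
    ultimately show "(\<Sum>v\<in>W - G. t G v) = Poly_Mapping.single G
        (Poly_Mapping.single (indicator_degree (W - G)) (bdry V c G))" by simp
  qed simp
  finally show ?thesis by (simp add: koszul_embed_def)
qed

lemma convex_edge_family:
  assumes "bipartite_graph X Y E" "X' \<subseteq> X" "Y' \<subseteq> Y"
  shows "convex_family (X <+> Y) (edge_family E X' Y')"
  using assms unfolding convex_family_def edge_family_def bipartite_graph_def
  by (auto 0 4)

context
  fixes X :: "'a::linorder set" and Y :: "'b::linorder set" and E and X' Y'
  assumes E: "bipartite_graph X Y E" and X': "X' \<subseteq> X" and Y': "Y' \<subseteq> Y"
begin

lemma koszul_embed_chain_space:
  "koszul_embed (X' <+> Y') ` chain_space (edge_family E X' Y') (int i) =
   {c \<in> koszul_chains (X <+> Y) (edge_ideal X Y E :: ('a + 'b, 'k::field) mpoly set) i.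
      multihomogeneous (indicator_degree (X' <+> Y')) c}" (is "?L = ?R")
proof -
  let ?W = "X' <+> Y'"
  have fW: "finite ?W" using E X' Y' by (auto simp: bipartite_graph_def intro: finite_subset)
  have WV: "?W \<subseteq> X <+> Y" using X' Y' by auto
  show ?thesis
  proof (intro equalityI subsetI)
    fix d :: "('a + 'b, 'k) chain" assume "d \<in> ?L"
    then obtain c where c: "c \<in> chain_space (edge_family E X' Y') (int i)" and d: "d = koszul_embed ?W c"
      by auto
    have key: "F \<subseteq> ?W \<and> c F \<noteq> 0" if "F \<in> Poly_Mapping.keys d" for F
      using that by (auto simp: d lookup_koszul_embed[OF fW] in_keys_iff split: if_splits)
    have "d \<in> koszul_chains (X <+> Y) (edge_ideal X Y E) i"
      unfolding koszul_chains_def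
    proof (rule CollectI, intro ballI conjI)
      fix F assume "F \<in> Poly_Mapping.keys d"
      then have F: "F \<subseteq> ?W" "c F \<noteq> 0" using key by auto
      then show "F \<subseteq> X <+> Y" using WV by auto
      have F': "F \<in> edge_family E X' Y'" "card F = i" using c F(2) by (auto simp: chain_space_def)
      then show "card F = i" by simp
      from F' obtain x y where xy: "(x, y) \<in> E" "Inl x \<in> ?W - F" "Inr y \<in> ?W - F"
        unfolding edge_family_def by auto
      have "Poly_Mapping.single (indicator_degree (?W - F)) (c F) \<in> edge_ideal X Y E"
        by (rule monomial_in_edge_idealI[OF E _ xy(1)])
          (use xy fW WV in \<open>simp_all add: keys_indicator_degree\<close>, auto)
      then show "Poly_Mapping.lookup d F \<in> edge_ideal X Y E"
        using F by (simp add: d lookup_koszul_embed[OF fW])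
    qed
    moreover have "multihomogeneous (indicator_degree ?W) d"
      unfolding multihomogeneous_def
    proof (intro ballI)
      fix F m assume F: "F \<in> Poly_Mapping.keys d" and "m \<in> Poly_Mapping.keys (Poly_Mapping.lookup d F)"
      then have m: "m = indicator_degree (?W - F)"
        using key[OF F] by (auto simp: d lookup_koszul_embed[OF fW] split: if_splits)
      have "finite F" using key[OF F] fW by (auto intro: finite_subset)
      then have "indicator_degree (?W - F) + indicator_degree F = indicator_degree ((?W - F) \<union> F)"
        using fW by (subst indicator_degree_Un) auto
      also have "(?W - F) \<union> F = ?W" using key[OF F] by auto
      finally show "m + indicator_degree F = indicator_degree ?W" by (simp add: m)
    qed
    ultimately show "d \<in> ?R" by simp
  next
    fix d assume d: "d \<in> ?R"
    define c where "c F = (if F \<subseteq> ?W then Poly_Mapping.lookup (Poly_Mapping.lookup d F) (indicator_degree (?W - F)) else 0)" for F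
    have key: "F \<subseteq> ?W \<and> card F = i \<and> Poly_Mapping.lookup d F \<in> edge_ideal X Y E \<and>
        Poly_Mapping.lookup d F = Poly_Mapping.single (indicator_degree (?W - F)) (c F)"
      if F: "F \<in> Poly_Mapping.keys d" for F
    proof -
      have F': "F \<subseteq> X <+> Y" "card F = i" "Poly_Mapping.lookup d F \<in> edge_ideal X Y E"
        using d F by (auto simp: koszul_chains_def)
      have fF: "finite F" using F'(1) E by (auto simp: bipartite_graph_def intro: finite_subset)
      have hom: "m + indicator_degree F = indicator_degree ?W" if "m \<in> Poly_Mapping.keys (Poly_Mapping.lookup d F)" for m
        using d F that by (auto simp: multihomogeneous_def)
      have "Poly_Mapping.lookup d F \<noteq> 0" using F by (simp add: in_keys_iff)
      then obtain m0 where m0: "m0 \<in> Poly_Mapping.keys (Poly_Mapping.lookup d F)"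
        by (metis keys_eq_empty equals0I)
      have FW: "F \<subseteq> ?W"
      proof
        fix v assume "v \<in> F"
        have "Poly_Mapping.lookup (m0 + indicator_degree F) v = Poly_Mapping.lookup (indicator_degree ?W) v"
          using hom[OF m0] by simp
        then show "v \<in> ?W"
          using \<open>v \<in> F\<close> fF fW by (simp only: lookup_add lookup_indicator_degree) (auto split: if_splits)
      qed
      have m: "m = indicator_degree (?W - F)" if "m \<in> Poly_Mapping.keys (Poly_Mapping.lookup d F)" for m
      proof -
        have "m + indicator_degree F = indicator_degree ((?W - F) \<union> F)"
          using hom[OF that] FW by (simp add: Un_absorb2)
        also have "\<dots> = indicator_degree (?W - F) + indicator_degree F"
          using fW fF by (subst indicator_degree_Un) auto
        finally show ?thesis by simp
      qed
      have "Poly_Mapping.lookup d F = Poly_Mapping.single (indicator_degree (?W - F)) (c F)"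
      proof (rule poly_mapping_eqI)
        fix m show "Poly_Mapping.lookup (Poly_Mapping.lookup d F) m =
            Poly_Mapping.lookup (Poly_Mapping.single (indicator_degree (?W - F)) (c F)) m"
          using m[of m] FW by (auto simp: c_def lookup_single when_def in_keys_iff)
      qed
      with F' FW show ?thesis by simp
    qed
    have "c \<in> chain_space (edge_family E X' Y') (int i)"
      unfolding chain_space_def
    proof (rule CollectI, intro allI impI)
      fix F assume nz: "c F \<noteq> 0"
      then have "F \<in> Poly_Mapping.keys d" by (auto simp: c_def in_keys_iff split: if_splits)
      note F = key[OF this]
      have "Poly_Mapping.single (indicator_degree (?W - F)) (c F) \<in> edge_ideal X Y E" using F by metis
      then obtain x y where "(x, y) \<in> E" "Inl x \<in> Poly_Mapping.keys (indicator_degree (?W - F))"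
        "Inr y \<in> Poly_Mapping.keys (indicator_degree (?W - F))"
        using nz by (rule monomial_in_edge_idealD)
      then show "F \<in> edge_family E X' Y' \<and> int (card F) = int i"
        using F fW by (auto simp: edge_family_def keys_indicator_degree)
    qed
    moreover have "d = koszul_embed ?W c"
    proof (rule poly_mapping_eqI)
      fix F show "Poly_Mapping.lookup d F = Poly_Mapping.lookup (koszul_embed ?W c) F"
        using key[of F] by (cases "F \<in> Poly_Mapping.keys d")
          (auto simp: lookup_koszul_embed[OF fW] c_def in_keys_iff)
    qed
    ultimately show "d \<in> ?L" by blast
  qed
qed

lemma betti_eq_hom:
  "betti TYPE('k::field) X Y E i X' Y' = hom TYPE('k) (X <+> Y) (edge_family E X' Y') (int i)"
proof -
  let ?W = "X' <+> Y'" and ?V = "X <+> Y" and ?F = "edge_family E X' Y'"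
  let ?I = "edge_ideal X Y E :: ('a + 'b, 'k) mpoly set"
  let ?e = "koszul_embed ?W :: (('a + 'b) set \<Rightarrow> 'k) \<Rightarrow> _"
  have fV: "finite ?V" using E by (auto simp: bipartite_graph_def)
  have fW: "finite ?W" using E X' Y' by (auto simp: bipartite_graph_def intro: finite_subset)
  have WV: "?W \<subseteq> ?V" using X' Y' by auto
  note conv = convex_edge_family[OF E X' Y']
  have comm: "koszul_diff (?e c) = ?e (restr ?F (bdry ?V c))" if c: "c \<in> chain_space ?F j" for c j
  proof -
    have sub: "S \<subseteq> ?W" if "c S \<noteq> 0" for S using c that by (auto simp: chain_space_def edge_family_def)
    \<comment> \<open>The family is closed under subsets, so restricting the boundary to it changes
      nothing.\<close>
    have "bdry ?V c S = 0" if "S \<notin> ?F" for S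
      unfolding bdry_def
    proof (intro sum.neutral ballI)
      fix v assume "v \<in> ?V - S"
      have "insert v S \<notin> ?F" using that unfolding edge_family_def by auto
      then show "sgn_at v S * c (insert v S) = 0" using c by (auto simp: chain_space_def)
    qed
    then have "restr ?F (bdry ?V c) = bdry ?V c" by (auto simp: restr_def fun_eq_iff)
    then show ?thesis by (simp add: koszul_embed_bdry[OF fV WV sub])
  qed
  have inj: "c = 0" if c: "c \<in> chain_space ?F j" "?e c = 0" for c j
  proof
    fix S
    have "Poly_Mapping.lookup (?e c) S = 0" using c(2) by simp
    then have "S \<subseteq> ?W \<Longrightarrow> Poly_Mapping.single (indicator_degree (?W - S)) (c S) = 0"
      by (simp add: lookup_koszul_embed[OF fW])
    then have "S \<subseteq> ?W \<Longrightarrow> c S = 0"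
      by (metis lookup_single_eq lookup_zero)
    then show "c S = 0 S" using c(1) by (auto simp: chain_space_def edge_family_def)
  qed
  have zero: "?e 0 = 0" by (simp add: koszul_embed_def)
  have cyc: "koszul_cycles ?V ?I i (indicator_degree ?W) = ?e ` cycles ?V ?F (int i)"
  proof -
    have "koszul_cycles ?V ?I i (indicator_degree ?W) = {d \<in> ?e ` chain_space ?F (int i). koszul_diff d = 0}"
      unfolding koszul_embed_chain_space koszul_cycles_def by auto
    also have "\<dots> = ?e ` cycles ?V ?F (int i)"
    proof -
      have "koszul_diff (?e c) = 0 \<longleftrightarrow> restr ?F (bdry ?V c) = 0" if "c \<in> chain_space ?F (int i)" for c
        using comm[OF that] inj[of "restr ?F (bdry ?V c)" "int i - 1"] dif_chains[OF conv, of c "int i - 1"] that zero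
        by auto
      then show ?thesis by (auto simp: cycles_def)
    qed
    finally show ?thesis .
  qed
  have bou: "koszul_boundaries ?V ?I i (indicator_degree ?W) = ?e ` bounds ?V ?F (int i)"
  proof -
    have "koszul_boundaries ?V ?I i (indicator_degree ?W) = koszul_diff ` ?e ` chain_space ?F (int (Suc i))"
      unfolding koszul_embed_chain_space koszul_boundaries_def by auto
    also have "\<dots> = ?e ` bounds ?V ?F (int i)"
      unfolding bounds_def image_image by (rule image_cong) (auto simp: comm add.commute)
    finally show ?thesis .
  qed
  have fin: "finite (point ` ?F :: (('a + 'b) set \<Rightarrow> 'k) set)" using finite_family[OF conv] by simp
  have sp: "cycles ?V ?F (int i) \<subseteq> fn.span (point ` ?F :: (('a + 'b) set \<Rightarrow> 'k) set)"
    using cycles_subset_chains chain_space_span[OF finite_family[OF conv]] by blast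
  have sp': "bounds ?V ?F (int i) \<subseteq> fn.span (point ` ?F :: (('a + 'b) set \<Rightarrow> 'k) set)"
    using sp bounds_subset_cycles[OF conv] by blast
  have "vector_space.dim chain_scale (koszul_cycles ?V ?I i (indicator_degree ?W)) =
      fn.dim (cycles ?V ?F (int i) :: (('a + 'b) set \<Rightarrow> 'k) set)"
    unfolding cyc
  proof (rule fk.dim_image_inj[OF linear_koszul_embed[OF fW] subspace_cycles fin sp])
    show "c = 0" if "c \<in> cycles ?V ?F (int i)" "?e c = 0" for c
      using inj[of c "int i"] that by (simp add: cycles_def)
  qed
  moreover have "vector_space.dim chain_scale (koszul_boundaries ?V ?I i (indicator_degree ?W)) =
      fn.dim (bounds ?V ?F (int i) :: (('a + 'b) set \<Rightarrow> 'k) set)"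
    unfolding bou
  proof (rule fk.dim_image_inj[OF linear_koszul_embed[OF fW] subspace_bounds fin sp'])
    show "c = 0" if "c \<in> bounds ?V ?F (int i)" "?e c = 0" for c
      using inj[of c "int i"] that bounds_subset_cycles[OF conv] cycles_subset_chains by blast
  qed
  ultimately show ?thesis by (simp add: betti_def tor_dim_def hom_def)
qed

end

section \<open>Elimination of columns and rows\<close>

lemma convex_family_complex:
  assumes "finite V" "\<F> \<subseteq> Pow V" "\<And>S T. S \<in> \<F> \<Longrightarrow> T \<subseteq> S \<Longrightarrow> T \<in> \<F>"
  shows "convex_family V \<F>"
  unfolding convex_family_def using assms by blast

text \<open>Toggling an element \<open>t\<close> of \<open>W - U\<close> pairs all sets except
  \<open>W - {t}\<close>, whose partner \<open>W\<close> is excluded. This unpaired set carries the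
  only class.\<close>

lemma hom_interval:
  fixes V :: "'v::linorder set"
  assumes V: "finite V" "W \<subseteq> V" and UW: "U \<subset> W"
  shows "hom TYPE('k::field) V {S. U \<subseteq> S \<and> S \<subset> W} j = (if j = int (card W) - 1 then 1 else 0)"
proof -
  obtain t where t: "t \<in> W" "t \<notin> U" using UW by auto
  let ?F = "{S. U \<subseteq> S \<and> S \<subset> W}"
  have F: "convex_family V ?F" unfolding convex_family_def using V by auto
  let ?A = "?F - {W - {t}}"
  have down: "T \<in> ?A" if "S \<in> ?A" "T \<in> ?F" "T \<subseteq> S" for S T
  proof -
    have "T \<noteq> W - {t}"
    proof
      assume T: "T = W - {t}"
      then have "S = W - {t} \<or> S = W" using that t(1) by auto
      then show False using that by auto
    qed
    then show ?thesis using that by auto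
  qed
  have conv: "convex_family V ?A" by (rule convex_family_down[OF F _ down]) auto
  have ac: "acyclic_family TYPE('k) V ?A"
  proof (rule acyclic_toggle[OF conv])
    show "t \<in> V" using t V by auto
    fix S show "insert t S \<in> ?A \<longleftrightarrow> S - {t} \<in> ?A"
      using t by auto
  qed
  have "?F - ?A = {W - {t}}" using t UW by auto
  moreover have "int (card (W - {t})) = int (card W) - 1"
    using t V by (metis card_Suc_Diff1 finite_subset of_nat_Suc add_diff_cancel_left')
  ultimately show ?thesis
    using hom_split_down_acyclic[OF F _ down ac, where j = j] by (simp add: hom_singleton)
qed

lemma sum_Pow_insert:
  assumes "finite Z" "z \<notin> Z"
  shows "(\<Sum>B\<in>Pow (insert z Z). f B) = (\<Sum>B\<in>Pow Z. f B) + (\<Sum>B\<in>Pow Z. f (insert z B))"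
proof -
  have "inj_on (insert z) (Pow Z)" using assms(2) by (auto simp: inj_on_def)
  then have "(\<Sum>B\<in>insert z ` Pow Z. f B) = (\<Sum>B\<in>Pow Z. f (insert z B))"
    by (simp add: sum.reindex)
  moreover have "Pow Z \<inter> insert z ` Pow Z = {}" using assms(2) by auto
  ultimately show ?thesis
    using assms(1) by (simp add: Pow_insert sum.union_disjoint)
qed

section \<open>From the Koszul complex to the complex of uncovered columns\<close>

locale bipartite =
  fixes X :: "'a::linorder set" and Y :: "'b::linorder set" and E :: "('a \<times> 'b) set"
  assumes bip: "bipartite_graph X Y E"
begin

abbreviation (input) "V \<equiv> X <+> Y"

definition covered :: "'a set \<Rightarrow> 'b \<Rightarrow> ('a + 'b) set \<Rightarrow> bool" where
  "covered X' y S \<longleftrightarrow> (\<forall>x\<in>X'. (x, y) \<in> E \<longrightarrow> Inl x \<in> S)"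

lemma covered_mono: "covered X' y S \<Longrightarrow> S \<subseteq> T \<Longrightarrow> covered X' y T"
  by (auto simp: covered_def)

lemma covered_Inr [simp]:
  "covered X' y (insert (Inr z) S) = covered X' y S"
  "covered X' y (S - {Inr z}) = covered X' y S"
  by (auto simp: covered_def)

text \<open>Columns in \<open>A\<close> are compulsory, while a column of \<open>Z\<close> imposes
  its condition only on sets containing its vertex. This assembles the complexes of all
  \<open>A \<union> B\<close> with \<open>B \<subseteq> Z\<close> into a single one.\<close>

definition mixed_complex :: "'a set \<Rightarrow> 'b set \<Rightarrow> 'b set \<Rightarrow> ('a + 'b) set set" where
  "mixed_complex X' A Z = {S. S \<subseteq> X' <+> Z \<and> (\<forall>y. y \<in> A \<or> Inr y \<in> S \<longrightarrow> \<not> covered X' y S)}"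

definition cover_complex :: "'a set \<Rightarrow> 'b set \<Rightarrow> ('a + 'b) set set" where
  "cover_complex X' Y' = {S. S \<subseteq> Inl ` X' \<and> (\<forall>y\<in>Y'. \<not> covered X' y S)}"

definition h :: "'k::field itself \<Rightarrow> 'a set \<Rightarrow> 'b set \<Rightarrow> int \<Rightarrow> nat" where
  "h K X' Y' j = hom K V (cover_complex X' Y') j"

text \<open>An intermediate stage of the matching: the columns in \<open>P\<close> are already
  eliminated, those in \<open>Q\<close> still have their vertices.\<close>

definition half_covered :: "'a set \<Rightarrow> 'b set \<Rightarrow> 'b set \<Rightarrow> ('a + 'b) set set" where
  "half_covered X' P Q = {S. S \<subseteq> X' <+> Q \<and> (\<forall>p\<in>P. \<not> covered X' p S) \<and>
     (\<forall>q\<in>Q. Inr q \<notin> S \<longrightarrow> covered X' q S)}"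

lemma finite_XY: "finite X" "finite Y" "E \<subseteq> X \<times> Y"
  using bip by (auto simp: bipartite_graph_def)

lemma finite_V: "finite V" using finite_XY by simp

lemma convex_mixed:
  assumes "X' \<subseteq> X" "Z \<subseteq> Y"
  shows "convex_family V (mixed_complex X' A Z)"
proof (rule convex_family_complex[OF finite_V])
  show "mixed_complex X' A Z \<subseteq> Pow V" using assms by (auto simp: mixed_complex_def)
  show "T \<in> mixed_complex X' A Z" if "S \<in> mixed_complex X' A Z" "T \<subseteq> S" for S T
    using that covered_mono[OF _ that(2)] unfolding mixed_complex_def by blast
qed

lemma convex_cover:
  assumes "X' \<subseteq> X"
  shows "convex_family V (cover_complex X' Y')"
proof (rule convex_family_complex[OF finite_V])
  show "cover_complex X' Y' \<subseteq> Pow V" using assms by (auto simp: cover_complex_def)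
  show "T \<in> cover_complex X' Y'" if "S \<in> cover_complex X' Y'" "T \<subseteq> S" for S T
    using that covered_mono[OF _ that(2)] unfolding cover_complex_def by blast
qed

lemma mixed_complex_empty: "mixed_complex X' A {} = cover_complex X' A"
  by (auto simp: mixed_complex_def cover_complex_def)

lemma half_covered_empty: "half_covered X' P {} = cover_complex X' P"
  by (auto simp: half_covered_def cover_complex_def)

lemma convex_half_covered:
  assumes "X' \<subseteq> X" "Q \<subseteq> Y"
  shows "convex_family V (half_covered X' P Q)"
  unfolding convex_family_def
proof (intro conjI allI impI)
  show "finite V" by (rule finite_V)
  show "half_covered X' P Q \<subseteq> Pow V" using assms by (auto simp: half_covered_def)
  fix A B C assume *: "A \<in> half_covered X' P Q" "C \<in> half_covered X' P Q" "A \<subseteq> B" "B \<subseteq> C"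
  have "B \<subseteq> X' <+> Q" using *(2,4) by (auto simp: half_covered_def)
  moreover have "\<not> covered X' p B" if "p \<in> P" for p
    using *(2) that covered_mono[OF _ *(4)] by (auto simp: half_covered_def)
  moreover have "covered X' q B" if "q \<in> Q" "Inr q \<notin> B" for q
    using *(1,3) that covered_mono[OF _ *(3)] by (auto simp: half_covered_def)
  ultimately show "B \<in> half_covered X' P Q" by (simp add: half_covered_def)
qed

lemma edge_family_covered:
  "edge_family E X' Y' = {S. S \<subseteq> X' <+> Y' \<and> (\<exists>y\<in>Y'. Inr y \<notin> S \<and> \<not> covered X' y S)}"
  unfolding edge_family_def covered_def by fastforce

text \<open>Where some other column already provides an edge in the complement, \<open>Inr q\<close>
  can be toggled. In the remaining sets \<open>q\<close> is the only column that provides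
  one.\<close>

lemma hom_edge_family:
  assumes X': "X' \<subseteq> X" and Q: "insert q Q \<subseteq> Y" "q \<notin> Q"
  shows "hom TYPE('k::field) V (edge_family E X' (insert q Q)) j = hom TYPE('k) V (half_covered X' {q} Q) j"
proof -
  let ?F = "edge_family E X' (insert q Q)"
  let ?A = "{S \<in> ?F. \<exists>y\<in>Q. Inr y \<notin> S \<and> \<not> covered X' y S}"
  have F: "convex_family V ?F" by (rule convex_edge_family[OF bip X' Q(1)])
  have down: "T \<in> ?A" if "S \<in> ?A" "T \<in> ?F" "T \<subseteq> S" for S T
    using that covered_mono[OF _ that(3)] by auto
  have conv: "convex_family V ?A" by (rule convex_family_down[OF F _ down]) auto
  have ac: "acyclic_family TYPE('k) V ?A"
    by (rule acyclic_toggle[OF conv, of "Inr q"])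
      (use Q in \<open>auto simp: edge_family_covered\<close>)
  have "?F - ?A = half_covered X' {q} Q"
    using Q by (auto simp: edge_family_covered half_covered_def)
  then show ?thesis
    using hom_split_down_acyclic[OF F _ down ac, where j = j] by simp
qed

text \<open>Outside \<open>?A\<close> the column \<open>q\<close> is covered and
  \<open>Inr q\<close> can be toggled. Inside \<open>?A\<close> the vertex \<open>Inr q\<close> is
  always present; taking it out moves \<open>q\<close> from the pending to the eliminated columns
  and lowers the degree by one.\<close>

lemma hom_half_covered_step:
  assumes X': "X' \<subseteq> X" and Q: "insert q Q \<subseteq> Y" "q \<notin> Q"
  shows "hom TYPE('k::field) V (half_covered X' P (insert q Q)) (j + 1) =
    hom TYPE('k) V (half_covered X' (insert q P) Q) j"
proof -
  let ?F = "half_covered X' P (insert q Q)"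
  let ?A = "{S \<in> ?F. Inr q \<in> S \<and> \<not> covered X' q S}"
  have F: "convex_family V ?F" by (rule convex_half_covered[OF X' Q(1)])
  have down: "T \<in> ?A" if "S \<in> ?A" "T \<in> ?F" "T \<subseteq> S" for S T
    using that covered_mono[OF _ that(3)] by (auto simp: half_covered_def)
  have A: "?A = insert (Inr q) ` half_covered X' (insert q P) Q"
  proof (intro equalityI subsetI)
    fix S assume S: "S \<in> ?A"
    then have "S - {Inr q} \<in> half_covered X' (insert q P) Q"
      using Q by (auto simp: half_covered_def)
    then show "S \<in> insert (Inr q) ` half_covered X' (insert q P) Q"
      using S by (intro image_eqI[of _ _ "S - {Inr q}"]) auto
  next
    fix S assume "S \<in> insert (Inr q) ` half_covered X' (insert q P) Q"
    then show "S \<in> ?A" by (auto simp: half_covered_def)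
  qed
  have conv: "convex_family V (?F - ?A)" by (rule convex_family_up[OF F _ down]) auto
  have ac: "acyclic_family TYPE('k) V (?F - ?A)"
    by (rule acyclic_toggle[OF conv, of "Inr q"])
      (use Q in \<open>auto simp: half_covered_def\<close>)
  have "hom TYPE('k) V ?F (j + 1) = hom TYPE('k) V ?A (j + 1)"
    by (rule hom_split_up_acyclic[OF F _ down ac]) auto
  also have "\<dots> = hom TYPE('k) V (half_covered X' (insert q P) Q) j"
    unfolding A
  proof (rule hom_insert)
    show "convex_family V (half_covered X' (insert q P) Q)" using X' Q by (intro convex_half_covered) auto
  qed (use Q in \<open>auto simp: half_covered_def\<close>)
  finally show ?thesis .
qed

lemma hom_half_covered:
  assumes X': "X' \<subseteq> X" and "finite Q" "Q \<subseteq> Y"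
  shows "hom TYPE('k::field) V (half_covered X' P Q) (j + int (card Q)) = h TYPE('k) X' (P \<union> Q) j"
  using assms(2,3)
proof (induction Q arbitrary: P rule: finite_induct)
  case empty
  then show ?case by (simp add: half_covered_empty h_def)
next
  case (insert q Q)
  have e: "j + int (card (insert q Q)) = j + int (card Q) + 1" using insert by simp
  show ?case
    unfolding e hom_half_covered_step[OF X' insert.prems insert.hyps(2)]
    using insert.IH[of "insert q P"] insert.prems by simp
qed

lemma cover_complex_no_rows: "cover_complex {} Y' = (if Y' = {} then {{}} else {})"
  by (auto simp: cover_complex_def covered_def)

lemma h_no_rows: "h TYPE('k::field) {} Y' j = (if Y' = {} \<and> j = 0 then 1 else 0)"
  by (simp add: h_def cover_complex_no_rows hom_singleton)

text \<open>No column of \<open>Y'\<close> contains \<open>x\<close>, so \<open>Inl x\<close> is a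
  cone point.\<close>

lemma acyclic_cover:
  assumes X': "X' \<subseteq> X" and x: "x \<in> X'" "row E x \<inter> Y' = {}"
  shows "acyclic_family TYPE('k::field) V (cover_complex X' Y')"
proof (rule acyclic_toggle[OF convex_cover[OF X']])
  show "Inl x \<in> V" using x X' by auto
  fix S
  have "covered X' y (insert (Inl x) S) = covered X' y (S - {Inl x})" if "y \<in> Y'" for y
    using x(2) that by (auto simp: covered_def row_def)
  then show "insert (Inl x) S \<in> cover_complex X' Y' \<longleftrightarrow> S - {Inl x} \<in> cover_complex X' Y'"
    using x(1) by (auto simp: cover_complex_def)
qed

lemma h_missed_row: "X' \<subseteq> X \<Longrightarrow> x \<in> X' \<Longrightarrow> row E x \<inter> Y' = {} \<Longrightarrow> h TYPE('k::field) X' Y' j = 0"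
  unfolding h_def by (intro hom_acyclic convex_cover acyclic_cover)

lemma cover_complex_void:
  "y \<in> Y' \<Longrightarrow> (\<And>x. x \<in> X' \<Longrightarrow> (x, y) \<notin> E) \<Longrightarrow> cover_complex X' Y' = {}"
  by (auto simp: cover_complex_def covered_def)

lemma h_void: "y \<in> Y' \<Longrightarrow> (\<And>x. x \<in> X' \<Longrightarrow> (x, y) \<notin> E) \<Longrightarrow> h TYPE('k::field) X' Y' j = 0"
  unfolding h_def by (subst cover_complex_void) auto

text \<open>The first column is eliminated without a shift, since its vertex is absent from all
  remaining sets; each of the other \<open>card Y' - 1\<close> columns costs one degree.\<close>

theorem betti_eq_h:
  assumes X': "X' \<subseteq> X" and Y': "Y' \<subseteq> Y"
  shows "betti TYPE('k::field) X Y E i X' Y' = h TYPE('k) X' Y' (int i + 1 - int (card Y'))"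
proof (cases "Y' = {}")
  case True
  have "edge_family E X' {} = {}" by (simp add: edge_family_covered)
  \<comment> \<open>Without columns the only class is that of \<open>X' = {}\<close> in degree 0,
    and the degree here is positive.\<close>
  moreover have "h TYPE('k) X' {} (int i + 1) = 0"
    using h_missed_row[OF X', of _ "{}", where 'k = 'k] by (cases "X' = {}") (auto simp: h_no_rows)
  ultimately show ?thesis
    using betti_eq_hom[OF bip X' Y', of i, where 'k = 'k] True by simp
next
  case False
  then obtain q Q where Q: "Y' = insert q Q" "q \<notin> Q" by (metis all_not_in_conv mk_disjoint_insert)
  have fQ: "finite Q" using Q Y' finite_XY by (auto intro: finite_subset)
  have "betti TYPE('k) X Y E i X' Y' = hom TYPE('k) V (half_covered X' {q} Q) (int i)"
    using betti_eq_hom[OF bip X' Y', of i, where 'k = 'k] hom_edge_family[OF X', of q Q] Q Y' by simp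
  also have "int i = (int i + 1 - int (card Y')) + int (card Q)" using Q fQ by simp
  also have "hom TYPE('k) V (half_covered X' {q} Q) \<dots> = h TYPE('k) X' ({q} \<union> Q) (int i + 1 - int (card Y'))"
    using Q Y' by (intro hom_half_covered[OF X' fQ]) auto
  finally show ?thesis using Q by simp
qed

section \<open>Deletion and link of a row\<close>

context
  fixes X' :: "'a set" and x :: 'a and Y' :: "'b set"
  assumes X': "insert x X' \<subseteq> X" and x: "x \<notin> X'"
begin

lemma cover_deletion: "{S \<in> cover_complex (insert x X') Y'. Inl x \<notin> S} = cover_complex X' (Y' - row E x)"
proof -
  have "covered (insert x X') y S \<longleftrightarrow> y \<notin> row E x \<and> covered X' y S" if "Inl x \<notin> S" for y S
    using that by (auto simp: covered_def row_def)
  moreover have "S \<subseteq> Inl ` insert x X' \<and> Inl x \<notin> S \<longleftrightarrow> S \<subseteq> Inl ` X'" for S :: "('a + 'b) set"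
    using x by auto
  ultimately show ?thesis unfolding cover_complex_def by blast
qed

lemma cover_link:
  "cover_complex (insert x X') Y' - {S \<in> cover_complex (insert x X') Y'. Inl x \<notin> S} =
   insert (Inl x) ` cover_complex X' Y'"
proof -
  have cov: "covered (insert x X') y (insert (Inl x) S) = covered X' y S" for y S
    using x by (auto simp: covered_def)
  show ?thesis
  proof (intro equalityI subsetI)
    fix S assume "S \<in> cover_complex (insert x X') Y' - {S \<in> cover_complex (insert x X') Y'. Inl x \<notin> S}"
    then have S: "S \<in> cover_complex (insert x X') Y'" "S = insert (Inl x) (S - {Inl x})" by auto
    then have "S - {Inl x} \<in> cover_complex X' Y'"
      using cov[of _ "S - {Inl x}"] by (auto simp: cover_complex_def)
    with S(2) show "S \<in> insert (Inl x) ` cover_complex X' Y'" by blast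
  next
    fix S assume "S \<in> insert (Inl x) ` cover_complex X' Y'"
    then show "S \<in> cover_complex (insert x X') Y' - {S \<in> cover_complex (insert x X') Y'. Inl x \<notin> S}"
      using cov by (auto simp: cover_complex_def)
  qed
qed

lemma hom_cover_link:
  "hom TYPE('k::field) V (insert (Inl x) ` cover_complex X' Y') j = h TYPE('k) X' Y' (j - 1)"
proof -
  have "hom TYPE('k) V (insert (Inl x) ` cover_complex X' Y') (j - 1 + 1) =
      hom TYPE('k) V (cover_complex X' Y') (j - 1)"
  proof (rule hom_insert)
    show "convex_family V (cover_complex X' Y')" using X' by (intro convex_cover) auto
  qed (use X' x in \<open>auto simp: cover_complex_def\<close>)
  then show ?thesis by (simp add: h_def)
qed

text \<open>The deletion cannot cover a column through \<open>x\<close>, so only the columns outside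
  its row remain as conditions. In the link \<open>x\<close> is already present and merely
  disappears from each column.\<close>

lemma h_insert_le:
  "h TYPE('k::field) (insert x X') Y' j \<le> h TYPE('k) X' (Y' - row E x) j + h TYPE('k) X' Y' (j - 1)"
proof -
  have "hom TYPE('k) V (cover_complex (insert x X') Y') j \<le>
      hom TYPE('k) V {S \<in> cover_complex (insert x X') Y'. Inl x \<notin> S} j +
      hom TYPE('k) V (cover_complex (insert x X') Y' - {S \<in> cover_complex (insert x X') Y'. Inl x \<notin> S}) j"
    by (rule hom_split_le[OF convex_cover[OF X']]) auto
  then show ?thesis
    unfolding cover_link hom_cover_link unfolding cover_deletion h_def .
qed

lemma h_insert_eq:
  assumes "acyclic_family TYPE('k::field) V (cover_complex X' (Y' - row E x))"
  shows "h TYPE('k) (insert x X') Y' j = h TYPE('k) X' Y' (j - 1)"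
proof -
  have "hom TYPE('k) V (cover_complex (insert x X') Y') j = hom TYPE('k) V
     (cover_complex (insert x X') Y' - {S \<in> cover_complex (insert x X') Y'. Inl x \<notin> S}) j"
  proof (rule hom_split_down_acyclic[OF convex_cover[OF X']])
    show "acyclic_family TYPE('k) V {S \<in> cover_complex (insert x X') Y'. Inl x \<notin> S}"
      unfolding cover_deletion by (rule assms)
  qed auto
  then show ?thesis unfolding cover_link hom_cover_link by (simp add: h_def)
qed

text \<open>The columns that survive in the deletion of \<open>x\<close> miss the row of
  \<open>x0\<close>, so the deletion is a cone over \<open>x0\<close> and only the link
  contributes.\<close>

lemma h_insert_dominating:
  assumes "x0 \<in> X'" "row E x0 \<inter> Y' \<subseteq> row E x"
  shows "h TYPE('k::field) (insert x X') Y' j = h TYPE('k) X' Y' (j - 1)"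
  by (rule h_insert_eq, rule acyclic_cover[of _ x0]) (use assms X' in auto)

text \<open>A set containing \<open>Inl x\<close> covers the column \<open>y\<close>, which meets
  \<open>insert x X'\<close> in \<open>x\<close> alone; hence the link is void.\<close>

lemma h_insert_isolated:
  assumes "y \<in> Y'" "y \<in> row E x" "\<And>x'. x' \<in> X' \<Longrightarrow> (x', y) \<notin> E"
  shows "h TYPE('k::field) (insert x X') Y' j = h TYPE('k) X' (Y' - row E x) j"
proof -
  have "cover_complex X' Y' = {}" using assms by (intro cover_complex_void) auto
  then have "cover_complex (insert x X') Y' = {S \<in> cover_complex (insert x X') Y'. Inl x \<notin> S}"
    using cover_link by auto
  then show ?thesis unfolding h_def using cover_deletion by simp
qed

end

text \<open>A nonempty set would cover a private column of one of its vertices, so the complex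
  consists of the empty set only.\<close>

lemma h_private_columns:
  assumes X': "X' \<subseteq> X" and "\<And>y. y \<in> Y' \<Longrightarrow> \<exists>x\<in>X'. (x, y) \<in> E"
    and "\<And>x. x \<in> X' \<Longrightarrow> \<exists>y\<in>Y'. \<forall>x'\<in>X'. (x', y) \<in> E \<longrightarrow> x' = x"
  shows "h TYPE('k::field) X' Y' j = (if j = 0 then 1 else 0)"
proof -
  have "S = {}" if S: "S \<subseteq> Inl ` X'" "\<forall>y\<in>Y'. \<not> covered X' y S" for S
  proof (rule ccontr)
    assume "S \<noteq> {}"
    then obtain x where x: "x \<in> X'" "Inl x \<in> S" using S by auto
    then obtain y where y: "y \<in> Y'" "\<forall>x'\<in>X'. (x', y) \<in> E \<longrightarrow> x' = x" using assms(3) by blast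
    then show False using S(2) x by (auto simp: covered_def)
  qed
  moreover have "{} \<in> cover_complex X' Y'"
    using assms(2) by (auto simp: cover_complex_def covered_def)
  ultimately have "cover_complex X' Y' = {{}}"
    unfolding cover_complex_def by auto
  then show ?thesis by (simp add: h_def hom_singleton)
qed

lemma card_Inl: "int (card (Inl ` X' :: ('a + 'b) set)) = int (card X')"
  by (simp add: card_image)

text \<open>The complex is the boundary of the simplex on \<open>X'\<close>.\<close>

lemma h_full_columns:
  assumes X': "X' \<subseteq> X" "X' \<noteq> {}" and Y': "Y' \<noteq> {}" "\<And>x y. x \<in> X' \<Longrightarrow> y \<in> Y' \<Longrightarrow> (x, y) \<in> E"
  shows "h TYPE('k::field) X' Y' j = (if j = int (card X') - 1 then 1 else 0)"
proof -
  have eq: "cover_complex X' Y' = {S. {} \<subseteq> S \<and> S \<subset> Inl ` X'}"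
    using Y' by (auto simp: cover_complex_def covered_def)
  have "Inl ` X' \<subseteq> V" "{} \<subset> Inl ` X'" using X' by auto
  from hom_interval[OF finite_V this] show ?thesis
    unfolding h_def eq card_Inl .
qed

text \<open>Sets without \<open>Inr z\<close> ignore the column \<open>z\<close>; in sets with
  \<open>Inr z\<close> it becomes compulsory at the cost of one degree. \<open>B\<close> records the
  columns switched on by these splittings.\<close>

lemma hom_mixed_le:
  assumes X': "X' \<subseteq> X" and "finite Z" "Z \<subseteq> Y"
  shows "hom TYPE('k::field) V (mixed_complex X' A Z) j \<le> (\<Sum>B\<in>Pow Z. h TYPE('k) X' (A \<union> B) (j - int (card B)))"
  using assms(2,3)
proof (induction Z arbitrary: A j rule: finite_induct)
  case empty
  then show ?case by (simp add: mixed_complex_empty h_def)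
next
  case (insert z Z)
  let ?F = "mixed_complex X' A (insert z Z)"
  let ?A = "{S \<in> ?F. Inr z \<notin> S}"
  have "?A = mixed_complex X' A Z" using insert.hyps by (auto simp: mixed_complex_def)
  moreover have "?F - ?A = insert (Inr z) ` mixed_complex X' (insert z A) Z"
  proof (intro equalityI subsetI)
    fix S assume "S \<in> ?F - ?A"
    then have S: "S \<in> ?F" "S = insert (Inr z) (S - {Inr z})" by auto
    then have "S - {Inr z} \<in> mixed_complex X' (insert z A) Z" by (auto simp: mixed_complex_def)
    with S(2) show "S \<in> insert (Inr z) ` mixed_complex X' (insert z A) Z" by blast
  qed (auto simp: mixed_complex_def)
  moreover have "hom TYPE('k) V ?F j \<le> hom TYPE('k) V ?A j + hom TYPE('k) V (?F - ?A) j"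
    by (rule hom_split_le[OF convex_mixed[OF X' insert.prems]]) auto
  moreover have "hom TYPE('k) V (insert (Inr z) ` mixed_complex X' (insert z A) Z) (j - 1 + 1) =
      hom TYPE('k) V (mixed_complex X' (insert z A) Z) (j - 1)"
  proof (rule hom_insert)
    show "convex_family V (mixed_complex X' (insert z A) Z)" using X' insert.prems by (intro convex_mixed) auto
  qed (use insert in \<open>auto simp: mixed_complex_def\<close>)
  ultimately have "hom TYPE('k) V ?F j \<le>
      hom TYPE('k) V (mixed_complex X' A Z) j + hom TYPE('k) V (mixed_complex X' (insert z A) Z) (j - 1)"
    by simp
  also have "\<dots> \<le> (\<Sum>B\<in>Pow Z. h TYPE('k) X' (A \<union> B) (j - int (card B))) +
      (\<Sum>B\<in>Pow Z. h TYPE('k) X' (insert z A \<union> B) (j - 1 - int (card B)))"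
    using insert.IH[of A j] insert.IH[of "insert z A" "j - 1"] insert.prems by (intro add_mono) auto
  also have "(\<Sum>B\<in>Pow Z. h TYPE('k) X' (insert z A \<union> B) (j - 1 - int (card B))) =
      (\<Sum>B\<in>Pow Z. h TYPE('k) X' (A \<union> insert z B) (j - int (card (insert z B))))"
  proof (rule sum.cong)
    fix B assume "B \<in> Pow Z"
    then have "finite B" "z \<notin> B" using insert.hyps by (auto intro: finite_subset)
    then show "h TYPE('k) X' (insert z A \<union> B) (j - 1 - int (card B)) =
        h TYPE('k) X' (A \<union> insert z B) (j - int (card (insert z B)))"
      by (simp add: algebra_simps)
  qed simp
  finally show ?case by (simp add: sum_Pow_insert[OF insert.hyps])
qed

text \<open>
  For a row \<open>x0\<close> such that no row lies strictly inside it, making the columns outside \<open>row E x0\<close>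
  optional collapses the complex to a sphere: this is localization at the prime of \<open>row E x0\<close>.
\<close>

lemma hom_mixed:
  assumes X': "X' \<subseteq> X" and x0: "x0 \<in> X'" and A: "A \<subseteq> row E x0" "A \<noteq> {}"
    and min: "\<And>x. x \<in> X' \<Longrightarrow> row E x \<subseteq> row E x0 \<Longrightarrow> row E x = row E x0"
  shows "hom TYPE('k::field) V (mixed_complex X' A (Y - row E x0)) (int (card X') - 1) = 1"
proof -
  define Z where "Z = Y - row E x0"
  have Z: "finite Z" "Z \<subseteq> Y" using finite_XY by (auto simp: Z_def)
  \<comment> \<open>\<open>F Z1\<close> keeps the sets that cover all columns of \<open>Z1\<close>.
    As long as a column \<open>y\<close> of \<open>Z\<close> is uncovered, \<open>Inr y\<close> can
    be toggled, so demanding coverage column by column preserves the homology.\<close>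
  define F where "F Z1 = {S \<in> mixed_complex X' A Z. \<forall>y\<in>Z1. covered X' y S}" for Z1
  have convF: "convex_family V (F Z1)" for Z1
    unfolding convex_family_def
  proof (intro conjI allI impI)
    show "finite V" by (rule finite_V)
    show "F Z1 \<subseteq> Pow V" using X' Z(2) by (auto simp: F_def mixed_complex_def)
    fix A' B C assume *: "A' \<in> F Z1" "C \<in> F Z1" "A' \<subseteq> B" "B \<subseteq> C"
    then have "B \<in> mixed_complex X' A Z"
      using convex_familyD[OF convex_mixed[OF X' Z(2)], of A' A C B] by (auto simp: F_def)
    then show "B \<in> F Z1" using * covered_mono[OF _ *(3)] by (auto simp: F_def)
  qed
  have step: "hom TYPE('k) V (F Z1) j = hom TYPE('k) V (F {}) j" if "finite Z1" "Z1 \<subseteq> Z" for Z1 j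
    using that
  proof (induction Z1 rule: finite_induct)
    case (insert y Z1)
    let ?A = "{S \<in> F Z1. \<not> covered X' y S}"
    have down: "T \<in> ?A" if "S \<in> ?A" "T \<in> F Z1" "T \<subseteq> S" for S T
      using that covered_mono[OF _ that(3)] by auto
    have conv: "convex_family V ?A" by (rule convex_family_down[OF convF _ down]) auto
    have ac: "acyclic_family TYPE('k) V ?A"
    proof (rule acyclic_toggle[OF conv, of "Inr y"])
      show "Inr y \<in> V" using insert.prems Z by auto
      show "insert (Inr y) S \<in> ?A \<longleftrightarrow> S - {Inr y} \<in> ?A" for S
        using insert.prems by (auto simp: F_def mixed_complex_def)
    qed
    have "hom TYPE('k) V (F Z1) j = hom TYPE('k) V (F Z1 - ?A) j"
      by (rule hom_split_down_acyclic[OF convF _ down ac]) auto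
    also have "F Z1 - ?A = F (insert y Z1)" by (auto simp: F_def)
    finally show ?case using insert.IH insert.prems by simp
  qed simp
  \<comment> \<open>By minimality a row different from that of \<open>x0\<close> has a column in
    \<open>Z\<close>, and covering this column forces the row's vertex into the set. Full coverage
    also excludes all vertices \<open>Inr y\<close>, which leaves an interval.\<close>
  define U where "U = {x \<in> X'. row E x \<noteq> row E x0}"
  have "F Z = {S. Inl ` U \<subseteq> S \<and> S \<subset> Inl ` X'}"
  proof (intro equalityI subsetI)
    fix S assume S: "S \<in> F Z"
    then have "Inr y \<notin> S" for y by (auto simp: F_def mixed_complex_def)
    then have "S \<subseteq> Inl ` X'" using S by (force simp: F_def mixed_complex_def)
    moreover have "S \<noteq> Inl ` X'" using S A(2) by (auto simp: F_def mixed_complex_def covered_def)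
    moreover have "Inl x \<in> S" if "x \<in> U" for x
    proof -
      have x: "x \<in> X'" "\<not> row E x \<subseteq> row E x0" using that min by (auto simp: U_def)
      then obtain y where y: "(x, y) \<in> E" "y \<notin> row E x0" by (auto simp: row_def)
      then have "y \<in> Z" using finite_XY by (auto simp: Z_def)
      then show ?thesis using S x(1) y(1) by (auto simp: F_def covered_def)
    qed
    ultimately show "S \<in> {S. Inl ` U \<subseteq> S \<and> S \<subset> Inl ` X'}" by auto
  next
    fix S :: "('a + 'b) set" assume "S \<in> {S. Inl ` U \<subseteq> S \<and> S \<subset> Inl ` X'}"
    then have S: "Inl ` U \<subseteq> S" "S \<subset> Inl ` X'" by auto
    then obtain x where x: "x \<in> X'" "Inl x \<notin> S" by auto
    then have "row E x = row E x0" using S by (auto simp: U_def)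
    then have "\<not> covered X' y S" if "y \<in> A" for y
      using x A that by (auto simp: covered_def row_def)
    moreover have "covered X' y S" if "y \<in> Z" for y
      unfolding covered_def
    proof (intro ballI impI)
      fix x assume "x \<in> X'" "(x, y) \<in> E"
      then have "x \<in> U" using that by (auto simp: U_def Z_def row_def)
      then show "Inl x \<in> S" using S by auto
    qed
    ultimately show "S \<in> F Z" using S by (auto simp: F_def mixed_complex_def)
  qed
  moreover have "hom TYPE('k) V {S. Inl ` U \<subseteq> S \<and> S \<subset> Inl ` X'} (int (card X') - 1) = 1"
  proof -
    have "Inl ` X' \<subseteq> V" "Inl ` U \<subset> Inl ` X'" using X' x0 by (auto simp: U_def)
    from hom_interval[OF finite_V this, where 'k = 'k] show ?thesis unfolding card_Inl by simp
  qed
  moreover have "F {} = mixed_complex X' A Z" by (simp add: F_def)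
  ultimately show ?thesis
    using step[OF Z(1), of "int (card X') - 1"] by (simp add: Z_def)
qed

lemma sum_h_ge_1:
  assumes X': "X' \<subseteq> X" and x0: "x0 \<in> X'" and A: "A \<subseteq> row E x0" "A \<noteq> {}"
    and min: "\<And>x. x \<in> X' \<Longrightarrow> row E x \<subseteq> row E x0 \<Longrightarrow> row E x = row E x0"
  shows "1 \<le> (\<Sum>B\<in>Pow (Y - row E x0). h TYPE('k::field) X' (A \<union> B) (int (card X') - 1 - int (card B)))"
  using hom_mixed[OF assms, where 'k = 'k] hom_mixed_le[OF X', of "Y - row E x0" A "int (card X') - 1", where 'k = 'k]
    finite_XY by simp

end

section \<open>Row Betti numbers\<close>

lemma sum_Pow_split:
  assumes "finite Y" "R \<subseteq> Y"
  shows "(\<Sum>S\<in>Pow Y. f S) = (\<Sum>A\<in>Pow R. \<Sum>B\<in>Pow (Y - R). f (A \<union> B))"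
proof -
  have fin: "finite (Pow R)" "finite (Pow (Y - R))" using assms by (auto intro: finite_subset)
  have "(\<Sum>S\<in>Pow Y. f S) = (\<Sum>(A, B)\<in>Pow R \<times> Pow (Y - R). f (A \<union> B))"
    by (rule sum.reindex_bij_witness[of _ "\<lambda>(A, B). A \<union> B" "\<lambda>S. (S \<inter> R, S - R)"])
      (use assms(2) in \<open>auto simp: Int_Diff_Un\<close>)
  then show ?thesis using fin by (simp add: sum.cartesian_product)
qed

lemma sum_Pow_nonempty:
  assumes "finite R"
  shows "(\<Sum>A\<in>Pow R. f A) = f {} + (\<Sum>A\<in>Pow R - {{}}. f A)"
  using assms by (subst sum.remove[of _ "{}"]) auto

text \<open>Reduces a recursion over subsets of a row to the size of the row, so that graphs with
  equal degrees can be compared.\<close>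

lemma sum_Pow_card:
  assumes "finite R" "finite R'" "card R = card R'"
  shows "(\<Sum>A\<in>Pow R - {{}}. f (card A)) = (\<Sum>A\<in>Pow R' - {{}}. f (card A))"
proof -
  obtain g where g: "bij_betw g R R'" using finite_same_card_bij[OF assms] by auto
  have "bij_betw (image g) (Pow R - {{}}) (Pow R' - {{}})"
  proof (rule bij_betw_imageI)
    have gi: "inj_on g R" and gR: "g ` R = R'" using g by (auto simp: bij_betw_def)
    show "inj_on (image g) (Pow R - {{}})" using inj_on_image_Pow[OF gi] by (rule inj_on_subset) auto
    show "image g ` (Pow R - {{}}) = Pow R' - {{}}"
      using inj_on_image_set_diff[OF inj_on_image_Pow[OF gi], of "Pow R" "{{}}"] image_Pow_surj[OF gR]
      by simp
  qed
  moreover have "card (g ` A) = card A" if "A \<in> Pow R - {{}}" for A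
    using that g by (intro card_image) (auto simp: bij_betw_def intro: inj_on_subset)
  ultimately show ?thesis
    by (subst sum.reindex_bij_betw[symmetric, of "image g"]) auto
qed

lemma sum_Pow_delta:
  assumes "finite Z"
  shows "(\<Sum>A\<in>Pow Z. if card A = s then 1 else 0) = card Z choose s"
proof -
  have "(\<Sum>A\<in>Pow Z. if card A = s then 1 else 0) = card {A \<in> Pow Z. card A = s}"
    using assms by (simp add: sum.If_cases Int_def)
  also have "\<dots> = card Z choose s" using n_subsets[OF assms, of s] by simp
  finally show ?thesis .
qed

text \<open>Vandermonde's identity with one summand per subset of \<open>R\<close> instead of per
  size; each new element of \<open>R\<close> is one use of Pascal's rule.\<close>

lemma sum_mult_Pow_choose:
  assumes "finite R"
  shows "(\<Sum>A\<in>Pow R. if int (card A) \<le> m then D choose nat (m - int (card A)) else 0) =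
    (if 0 \<le> m then (D + card R) choose nat m else 0)"
  using assms
proof (induction R arbitrary: m rule: finite_induct)
  case (insert r R)
  have c: "card (insert r B) = Suc (card B)" if "B \<in> Pow R" for B
    using that insert.hyps by (auto intro!: card_insert_disjoint intro: finite_subset)
  have 1: "(\<Sum>B\<in>Pow R. if int (card (insert r B)) \<le> m then D choose nat (m - int (card (insert r B))) else 0) =
      (if 0 \<le> m - 1 then (D + card R) choose nat (m - 1) else 0)"
    unfolding insert.IH[symmetric] by (rule sum.cong) (auto simp: c algebra_simps)
  have 2: "(if 0 \<le> m then (D + card R) choose nat m else 0) +
      (if 0 \<le> m - 1 then (D + card R) choose nat (m - 1) else 0) =
      (if 0 \<le> m then (D + card (insert r R)) choose nat m else 0)"
  proof (cases "m \<ge> 1")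
    case True
    then have "nat m = Suc (nat (m - 1))" by simp
    with True insert.hyps show ?thesis by simp
  next
    case False
    then have "m < 0 \<or> m = 0" by auto
    then show ?thesis by auto
  qed
  show ?case
    unfolding sum_Pow_insert[OF insert.hyps(1,2)] insert.IH[of m] 1 2 ..
qed auto

section \<open>Sums over all column sets\<close>

context bipartite
begin

text \<open>The column set \<open>Z\<close> is variable because the deletion of a row removes
  columns. The weight \<open>m\<close> is an integer, so shifts below zero simply give empty
  degrees.\<close>

definition row_sum :: "'k::field itself \<Rightarrow> 'a set \<Rightarrow> 'b set \<Rightarrow> int \<Rightarrow> nat" where
  "row_sum K X' Z m = (\<Sum>Y'\<in>Pow Z. h K X' Y' (m - int (card Y')))"

lemma row_betti_eq_row_sum:
  "X' \<subseteq> X \<Longrightarrow> row_betti TYPE('k::field) X Y E i X' = row_sum TYPE('k) X' Y (int i + 1)"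
  unfolding row_betti_def row_sum_def by (rule sum.cong) (auto simp: betti_eq_h)

lemma row_sum_no_rows:
  assumes "finite Z"
  shows "row_sum TYPE('k::field) {} Z m = (if m = 0 then 1 else 0)"
proof -
  have "row_sum TYPE('k) {} Z m = (\<Sum>Y'\<in>Pow Z. if Y' = {} then if m = 0 then 1 else 0 else 0)"
    unfolding row_sum_def by (rule sum.cong) (auto simp: h_no_rows)
  then show ?thesis using assms by simp
qed

lemma row_sum_mono: "finite Z' \<Longrightarrow> Z \<subseteq> Z' \<Longrightarrow> row_sum TYPE('k::field) X' Z m \<le> row_sum TYPE('k) X' Z' m"
  unfolding row_sum_def by (rule sum_mono2) auto

lemma finite_row: "finite (row E x)"
  using finite_XY by (auto simp: row_def intro: finite_subset)

lemma row_subset: "row E x \<subseteq> Y"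
  using finite_XY by (auto simp: row_def)

lemma row_sum_empty_row:
  assumes "X' \<subseteq> X" "x \<in> X'" "row E x \<inter> Z = {}"
  shows "row_sum TYPE('k::field) X' Z m = 0"
  unfolding row_sum_def using assms by (intro sum.neutral ballI h_missed_row[of X' x]) auto

lemma row_sum_split:
  assumes "Z \<subseteq> Y" "R \<subseteq> Z"
  shows "row_sum TYPE('k::field) X' Z m =
    (\<Sum>A\<in>Pow R. \<Sum>B\<in>Pow (Z - R). h TYPE('k) X' (A \<union> B) (m - int (card A) - int (card B)))"
proof -
  have fin: "finite Z" using assms(1) finite_XY by (auto intro: finite_subset)
  have "card (A \<union> B) = card A + card B" if "A \<in> Pow R" "B \<in> Pow (Z - R)" for A B
    using that assms(2) fin by (intro card_Un_disjoint) (auto intro: finite_subset)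
  then show ?thesis
    unfolding row_sum_def sum_Pow_split[OF fin assms(2)]
    by (intro sum.cong refl) (simp add: algebra_simps)
qed

lemma row_sum_dominating:
  assumes "insert x X' \<subseteq> X" "x \<notin> X'" "x0 \<in> X'" "row E x0 \<subseteq> row E x"
  shows "row_sum TYPE('k::field) (insert x X') Z m = row_sum TYPE('k) X' Z (m - 1)"
  unfolding row_sum_def
  by (intro sum.cong refl) (subst h_insert_dominating[OF assms(1-3)], use assms(4) in \<open>auto simp: algebra_simps\<close>)

text \<open>Group the sets \<open>Y'\<close> by their part \<open>A\<close> in the row of
  \<open>x\<close>, which must be nonempty. The link terms make up
  \<open>row_sum X' Z (m - 1)\<close> except for its part with \<open>A = {}\<close>; that part
  stands on the left to avoid a subtraction.\<close>

lemma row_sum_insert_aux: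
  assumes x: "insert x X' \<subseteq> X" "x \<notin> X'" and Z: "Z \<subseteq> Y" and R: "R = row E x \<inter> Z"
  shows "row_sum TYPE('k::field) (insert x X') Z m + row_sum TYPE('k) X' (Z - R) (m - 1) \<le>
    (\<Sum>A\<in>Pow R - {{}}. row_sum TYPE('k) X' (Z - R) (m - int (card A))) + row_sum TYPE('k) X' Z (m - 1)"
proof -
  have RZ: "R \<subseteq> Z" and fR: "finite R" using R finite_row by auto
  let ?g = "\<lambda>m A. \<Sum>B\<in>Pow (Z - R). h TYPE('k) X' (A \<union> B) (m - int (card A) - int (card B))"
  have "row_sum TYPE('k) (insert x X') Z m =
      (\<Sum>A\<in>Pow R - {{}}. \<Sum>B\<in>Pow (Z - R). h TYPE('k) (insert x X') (A \<union> B) (m - int (card A) - int (card B)))"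
  proof -
    have "(\<Sum>B\<in>Pow (Z - R). h TYPE('k) (insert x X') ({} \<union> B) (m - int (card {}) - int (card B))) = 0"
      using R by (intro sum.neutral ballI h_missed_row[OF x(1), of x]) auto
    then show ?thesis
      unfolding row_sum_split[OF Z RZ] by (subst sum_Pow_nonempty[OF fR]) simp
  qed
  also have "\<dots> \<le> (\<Sum>A\<in>Pow R - {{}}. \<Sum>B\<in>Pow (Z - R).
      h TYPE('k) X' B (m - int (card A) - int (card B)) +
      h TYPE('k) X' (A \<union> B) (m - 1 - int (card A) - int (card B)))"
  proof (intro sum_mono)
    fix A B assume A: "A \<in> Pow R - {{}}" and B: "B \<in> Pow (Z - R)"
    then have 1: "A \<union> B - row E x = B" using R by auto
    have 2: "m - int (card A) - int (card B) - 1 = m - 1 - int (card A) - int (card B)" by simp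
    show "h TYPE('k) (insert x X') (A \<union> B) (m - int (card A) - int (card B)) \<le>
        h TYPE('k) X' B (m - int (card A) - int (card B)) +
        h TYPE('k) X' (A \<union> B) (m - 1 - int (card A) - int (card B))"
      using h_insert_le[OF x, of "A \<union> B" "m - int (card A) - int (card B)", where 'k = 'k]
      unfolding 1 2 .
  qed
  also have "\<dots> = (\<Sum>A\<in>Pow R - {{}}. row_sum TYPE('k) X' (Z - R) (m - int (card A))) +
      (\<Sum>A\<in>Pow R - {{}}. ?g (m - 1) A)"
    by (simp add: sum.distrib row_sum_def)
  finally have "row_sum TYPE('k) (insert x X') Z m \<le> \<dots>" .
  moreover have "row_sum TYPE('k) X' Z (m - 1) =
      row_sum TYPE('k) X' (Z - R) (m - 1) + (\<Sum>A\<in>Pow R - {{}}. ?g (m - 1) A)"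
    unfolding row_sum_split[OF Z RZ] by (subst sum_Pow_nonempty[OF fR]) (simp add: row_sum_def)
  ultimately show ?thesis by simp
qed

text \<open>The extra term on the left of \<open>row_sum_insert_aux\<close> equals the deletion term
  of any one singleton \<open>{r}\<close>. Cancelling the two puts the whole link sum in the place
  of that term; the others only grow when \<open>Z - R\<close> is replaced by \<open>Z\<close>. A
  second singleton makes the growth strict.\<close>

lemma row_sum_insert_le:
  assumes x: "insert x X' \<subseteq> X" "x \<notin> X'" and Z: "Z \<subseteq> Y" and R: "R = row E x \<inter> Z"
  shows "row_sum TYPE('k::field) (insert x X') Z m \<le> (\<Sum>A\<in>Pow R - {{}}. row_sum TYPE('k) X' Z (m - int (card A)))"
    and "r \<in> R \<Longrightarrow> r' \<in> R \<Longrightarrow> r \<noteq> r' \<Longrightarrow>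
      row_sum TYPE('k) X' (Z - R) (m - 1) < row_sum TYPE('k) X' Z (m - 1) \<Longrightarrow>
      row_sum TYPE('k) (insert x X') Z m < (\<Sum>A\<in>Pow R - {{}}. row_sum TYPE('k) X' Z (m - int (card A)))"
proof -
  have fR: "finite R" and fZ: "finite Z" using R finite_row Z finite_XY by (auto intro: finite_subset)
  let ?f = "\<lambda>A. row_sum TYPE('k) X' (Z - R) (m - int (card A))"
  let ?g = "\<lambda>A. row_sum TYPE('k) X' Z (m - int (card A))"
  have le: "?f A \<le> ?g A" for A using fZ by (intro row_sum_mono) auto
  have main: "row_sum TYPE('k) (insert x X') Z m \<le> ?g {r} + sum ?f (Pow R - {{}} - {{r}})" if "r \<in> R" for r
  proof -
    have "sum ?f (Pow R - {{}}) = ?f {r} + sum ?f (Pow R - {{}} - {{r}})"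
      using that fR by (intro sum.remove) auto
    then show ?thesis using row_sum_insert_aux[OF x Z R, of m, where 'k = 'k] by simp
  qed
  have rem: "sum ?g (Pow R - {{}}) = ?g {r} + sum ?g (Pow R - {{}} - {{r}})" if "r \<in> R" for r
    using that fR by (intro sum.remove) auto
  show "row_sum TYPE('k) (insert x X') Z m \<le> sum ?g (Pow R - {{}})"
  proof (cases "R = {}")
    case True
    then show ?thesis using row_sum_empty_row[OF x(1), of x Z m, where 'k = 'k] R by simp
  next
    case False
    then obtain r where r: "r \<in> R" by auto
    have "sum ?f (Pow R - {{}} - {{r}}) \<le> sum ?g (Pow R - {{}} - {{r}})" by (intro sum_mono le)
    then show ?thesis using main[OF r] rem[OF r] by simp
  qed
  assume r: "r \<in> R" "r' \<in> R" "r \<noteq> r'"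
    and lt: "row_sum TYPE('k) X' (Z - R) (m - 1) < row_sum TYPE('k) X' Z (m - 1)"
  have "sum ?f (Pow R - {{}} - {{r}}) < sum ?g (Pow R - {{}} - {{r}})"
  proof (rule sum_strict_mono_ex1)
    show "\<exists>A\<in>Pow R - {{}} - {{r}}. ?f A < ?g A"
      by (rule bexI[of _ "{r'}"]) (use r lt in auto)
  qed (use fR le in auto)
  then show "row_sum TYPE('k) (insert x X') Z m < sum ?g (Pow R - {{}})"
    using main[OF r(1)] rem[OF r(1)] by simp
qed

text \<open>Each column in the row of \<open>x\<close> is private to \<open>x\<close>, so only the
  deletion contributes. For \<open>X'\<close> itself such a column makes the complex void, which
  permits \<open>Y\<close> in place of \<open>Y - row E x\<close>.\<close>

lemma row_sum_insert_disjoint: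
  assumes x: "insert x X' \<subseteq> X" "x \<notin> X'" and disj: "\<And>x'. x' \<in> X' \<Longrightarrow> row E x \<inter> row E x' = {}"
  shows "row_sum TYPE('k::field) (insert x X') Y m =
    (\<Sum>A\<in>Pow (row E x) - {{}}. row_sum TYPE('k) X' Y (m - int (card A)))"
proof -
  let ?R = "row E x"
  have eq: "row_sum TYPE('k) X' Y m = row_sum TYPE('k) X' (Y - ?R) m" for m
    unfolding row_sum_def
  proof (rule sum.mono_neutral_right)
    show "\<forall>Y'\<in>Pow Y - Pow (Y - ?R). h TYPE('k) X' Y' (m - int (card Y')) = 0"
    proof
      fix Y' assume "Y' \<in> Pow Y - Pow (Y - ?R)"
      then obtain y where "y \<in> Y'" "y \<in> ?R" by auto
      then show "h TYPE('k) X' Y' (m - int (card Y')) = 0"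
        using disj by (intro h_void[of y]) (auto simp: row_def)
    qed
  qed (use finite_XY in auto)
  have "row_sum TYPE('k) (insert x X') Y m =
      (\<Sum>A\<in>Pow ?R - {{}}. \<Sum>B\<in>Pow (Y - ?R). h TYPE('k) (insert x X') (A \<union> B) (m - int (card A) - int (card B)))"
  proof -
    have "(\<Sum>B\<in>Pow (Y - ?R). h TYPE('k) (insert x X') ({} \<union> B) (m - int (card {}) - int (card B))) = 0"
      by (intro sum.neutral ballI h_missed_row[OF x(1), of x]) auto
    then show ?thesis
      unfolding row_sum_split[OF order.refl row_subset[of x]] by (subst sum_Pow_nonempty[OF finite_row]) simp
  qed
  also have "\<dots> = (\<Sum>A\<in>Pow ?R - {{}}. row_sum TYPE('k) X' (Y - ?R) (m - int (card A)))"
    unfolding row_sum_def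
  proof (intro sum.cong refl)
    fix A B assume A: "A \<in> Pow ?R - {{}}" and B: "B \<in> Pow (Y - ?R)"
    then obtain y where y: "y \<in> A" by auto
    have "h TYPE('k) (insert x X') (A \<union> B) (m - int (card A) - int (card B)) =
        h TYPE('k) X' (A \<union> B - ?R) (m - int (card A) - int (card B))"
      by (rule h_insert_isolated[OF x, of y]) (use A y disj in \<open>auto simp: row_def\<close>)
    also have "A \<union> B - ?R = B" using A B by auto
    finally show "h TYPE('k) (insert x X') (A \<union> B) (m - int (card A) - int (card B)) =
        h TYPE('k) X' B (m - int (card A) - int (card B))" .
  qed
  finally show ?thesis by (simp add: eq)
qed

text \<open>Each \<open>A\<close> of size \<open>s\<close> in a shortest row contributes at least
  one class, and different \<open>A\<close> involve disjoint collections of column sets.\<close>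

lemma choose_le_row_sum:
  assumes X': "X' \<subseteq> X" and x0: "x0 \<in> X'" and min: "\<And>x. x \<in> X' \<Longrightarrow> deg E x0 \<le> deg E x" and s: "s \<ge> 1"
  shows "deg E x0 choose s \<le> row_sum TYPE('k::field) X' Y (int (card X') - 1 + int s)"
proof -
  let ?R = "row E x0"
  let ?m = "int (card X') - 1 + int s"
  have "deg E x0 choose s = (\<Sum>A\<in>{A. A \<subseteq> ?R \<and> card A = s}. 1)"
    using n_subsets[OF finite_row, of x0 s] by (simp add: deg_def)
  also have "\<dots> \<le> (\<Sum>A\<in>{A. A \<subseteq> ?R \<and> card A = s}. \<Sum>B\<in>Pow (Y - ?R).
      h TYPE('k) X' (A \<union> B) (?m - int (card A) - int (card B)))"
  proof (rule sum_mono)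
    fix A assume A: "A \<in> {A. A \<subseteq> ?R \<and> card A = s}"
    have "row E x = ?R" if "x \<in> X'" "row E x \<subseteq> ?R" for x
      using card_seteq[OF finite_row that(2)] min[OF that(1)] by (simp add: deg_def)
    then have "1 \<le> (\<Sum>B\<in>Pow (Y - ?R). h TYPE('k) X' (A \<union> B) (int (card X') - 1 - int (card B)))"
      using A s by (intro sum_h_ge_1[OF X' x0]) auto
    then show "1 \<le> (\<Sum>B\<in>Pow (Y - ?R). h TYPE('k) X' (A \<union> B) (?m - int (card A) - int (card B)))"
      using A by simp
  qed
  also have "\<dots> \<le> row_sum TYPE('k) X' Y ?m"
    unfolding row_sum_split[OF order.refl row_subset[of x0]]
    by (rule sum_mono2) (auto simp: finite_row)
  finally show ?thesis .
qed

section \<open>Nearly row-nested graphs\<close>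

text \<open>The recursion has only the summand \<open>A = {z}\<close>, so every row just shifts the
  weight by one.\<close>

lemma row_sum_single_columns:
  assumes Z: "Z \<subseteq> Y" and T: "finite T" "T \<subseteq> X" and one: "\<And>x. x \<in> T \<Longrightarrow> card (row E x \<inter> Z) = 1"
  shows "row_sum TYPE('k::field) T Z m \<le> (if m = int (card T) then 1 else 0)"
  using T one
proof (induction T arbitrary: m rule: finite_induct)
  case empty
  have "finite Z" using Z finite_XY by (auto intro: finite_subset)
  then show ?case by (simp add: row_sum_no_rows)
next
  case (insert x T)
  obtain z where z: "row E x \<inter> Z = {z}" using insert.prems(2)[of x] by (auto simp: card_1_singleton_iff)
  have "row_sum TYPE('k) (insert x T) Z m \<le> (\<Sum>A\<in>Pow {z} - {{}}. row_sum TYPE('k) T Z (m - int (card A)))"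
    using row_sum_insert_le(1)[OF insert.prems(1) insert.hyps(2) Z refl, of m, where 'k = 'k] z by simp
  also have "Pow {z} - {{}} = {{z}}" by auto
  also have "(\<Sum>A\<in>{{z}}. row_sum TYPE('k) T Z (m - int (card A))) \<le> (if m - 1 = int (card T) then 1 else 0)"
    using insert.IH[of "m - 1"] insert.prems by simp
  also have "\<dots> = (if m = int (card (insert x T)) then 1 else 0)"
    using insert.hyps by auto
  finally show ?case .
qed

text \<open>Split \<open>Y'\<close> into \<open>A\<close> in the core and \<open>B\<close> outside.
  With \<open>B = {}\<close> and \<open>A\<close> nonempty the complex is the boundary of a simplex;
  with \<open>B\<close> nonempty the choice of \<open>A\<close> only shifts the weight, and all such
  \<open>B\<close> together give at most one class, since each row has a single cell outside the
  core.\<close>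

lemma row_sum_common_core:
  assumes T: "T \<subseteq> X" "T \<noteq> {}" and Z: "\<And>x. x \<in> T \<Longrightarrow> Z \<subseteq> row E x"
    and c: "\<And>x. x \<in> T \<Longrightarrow> card (row E x) = Suc (card Z)"
  shows "row_sum TYPE('k::field) T Y m \<le>
    (if int (card T) \<le> m then Suc (card Z) choose nat (m + 1 - int (card T)) else 0)"
proof -
  have fT: "finite T" using T(1) finite_XY by (auto intro: finite_subset)
  have ZY: "Z \<subseteq> Y" using T(2) Z row_subset by blast
  have fZ: "finite Z" using ZY finite_XY by (auto intro: finite_subset)
  let ?n = "int (card T)"
  have one: "card (row E x \<inter> (Y - Z)) = 1" if "x \<in> T" for x
  proof -
    have "row E x \<inter> (Y - Z) = row E x - Z" using row_subset by blast
    then show ?thesis using c[OF that] Z[OF that] fZ by (simp add: card_Diff_subset)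
  qed
  \<comment> \<open>A core column contains all of \<open>T\<close>, so it is uncovered as soon as
    any column of \<open>B\<close> is.\<close>
  have core: "h TYPE('k) T (A \<union> B) j = h TYPE('k) T B j" if A: "A \<subseteq> Z" and B: "B \<noteq> {}" for A B j
  proof -
    have "\<not> covered T a S" if "b \<in> B" "\<not> covered T b S" "a \<in> A" for a b S
      using that A Z unfolding covered_def row_def by blast
    then have "cover_complex T (A \<union> B) = cover_complex T B"
      using B unfolding cover_complex_def by blast
    then show ?thesis by (simp add: h_def)
  qed
  have "row_sum TYPE('k) T Y m = (\<Sum>A\<in>Pow Z. \<Sum>B\<in>Pow (Y - Z).
      h TYPE('k) T (A \<union> B) (m - int (card A) - int (card B)))"
    by (rule row_sum_split[OF order.refl ZY])
  also have "\<dots> \<le> (\<Sum>A\<in>Pow Z. (if A \<noteq> {} \<and> m - int (card A) = ?n - 1 then 1 else 0) +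
      (if m - int (card A) = ?n then 1 else 0))"
  proof (rule sum_mono)
    fix A assume A: "A \<in> Pow Z"
    have "h TYPE('k) T A (m - int (card A)) \<le> (if A \<noteq> {} \<and> m - int (card A) = ?n - 1 then 1 else 0)"
    proof (cases "A = {}")
      case True
      then show ?thesis using h_missed_row[OF T(1), of _ "{}", where 'k = 'k] T(2) by auto
    next
      case False
      have "(x, y) \<in> E" if "x \<in> T" "y \<in> A" for x y using A Z[OF that(1)] that(2) by (auto simp: row_def)
      then show ?thesis using h_full_columns[OF T False, of "m - int (card A)", where 'k = 'k] False by auto
    qed
    moreover have "(\<Sum>B\<in>Pow (Y - Z) - {{}}. h TYPE('k) T (A \<union> B) (m - int (card A) - int (card B))) \<le>
        (if m - int (card A) = ?n then 1 else 0)"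
    proof -
      have "(\<Sum>B\<in>Pow (Y - Z) - {{}}. h TYPE('k) T (A \<union> B) (m - int (card A) - int (card B))) =
          (\<Sum>B\<in>Pow (Y - Z) - {{}}. h TYPE('k) T B (m - int (card A) - int (card B)))"
        by (rule sum.cong) (use A core in auto)
      also have "\<dots> \<le> row_sum TYPE('k) T (Y - Z) (m - int (card A))"
        unfolding row_sum_def by (rule sum_mono2) (use finite_XY in auto)
      also have "\<dots> \<le> (if m - int (card A) = ?n then 1 else 0)"
        by (rule row_sum_single_columns[OF _ fT T(1) one]) auto
      finally show ?thesis .
    qed
    ultimately show "(\<Sum>B\<in>Pow (Y - Z). h TYPE('k) T (A \<union> B) (m - int (card A) - int (card B))) \<le>
      (if A \<noteq> {} \<and> m - int (card A) = ?n - 1 then 1 else 0) + (if m - int (card A) = ?n then 1 else 0)"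
      using finite_XY by (subst sum_Pow_nonempty) auto
  qed
  also have "\<dots> \<le> (if ?n \<le> m then Suc (card Z) choose nat (m + 1 - ?n) else 0)"
  proof (cases "?n \<le> m")
    case True
    \<comment> \<open>The case \<open>B = {}\<close> requires \<open>card A = Suc s\<close>, the
      case of nonempty \<open>B\<close> requires \<open>card A = s\<close>; Pascal's rule adds the
      two counts.\<close>
    then obtain s where s: "m = ?n + int s" by (metis zle_iff_zadd)
    have "(\<Sum>A\<in>Pow Z. (if A \<noteq> {} \<and> m - int (card A) = ?n - 1 then 1 else 0) +
        (if m - int (card A) = ?n then 1 else 0)) =
        (\<Sum>A\<in>Pow Z. (if card A = Suc s then 1 else 0) + (if card A = s then 1 else 0) :: nat)"
      by (rule sum.cong) (auto simp: s)
    also have "\<dots> = Suc (card Z) choose Suc s"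
      by (simp add: sum.distrib sum_Pow_delta[OF fZ])
    also have "Suc s = nat (m + 1 - ?n)" using s by simp
    finally show ?thesis using True by simp
  next
    case False
    have "(\<Sum>A\<in>Pow Z. (if A \<noteq> {} \<and> m - int (card A) = ?n - 1 then 1 else 0) +
        (if m - int (card A) = ?n then 1 else 0)) = (0 :: nat)"
    proof (intro sum.neutral ballI)
      fix A assume "A \<in> Pow Z"
      then have "finite A" using fZ by (auto intro: finite_subset)
      then have "A \<noteq> {} \<longrightarrow> card A \<ge> 1" by (simp add: Suc_le_eq card_gt_0_iff)
      then show "(if A \<noteq> {} \<and> m - int (card A) = ?n - 1 then 1 else 0) +
        (if m - int (card A) = ?n then 1 else 0) = (0 :: nat)"
        using False by auto
    qed
    then show ?thesis using False by simp
  qed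
  finally show ?thesis .
qed

text \<open>Every longer row contains a shortest one and therefore only shifts the weight by one.
  The shortest rows share a core with one element less than their size.\<close>

lemma row_sum_nearly_nested_le:
  assumes nn: "nearly_row_nested X E" and X': "X' \<subseteq> X" "X' \<noteq> {}"
  shows "row_sum TYPE('k::field) X' Y m \<le>
    (if int (card X') \<le> m then mindeg E X' choose nat (m + 1 - int (card X')) else 0)"
proof -
  have fX': "finite X'" using X' finite_XY by (auto intro: finite_subset)
  define c where "c = mindeg E X'"
  have c: "c = Min (deg E ` X')" using X'(2) by (simp add: c_def mindeg_def)
  have "c \<in> deg E ` X'" unfolding c by (rule Min_in) (use fX' X' in auto)
  then obtain x0 where x0: "x0 \<in> X'" "deg E x0 = c" by auto
  have cle: "c \<le> deg E x" if "x \<in> X'" for x unfolding c by (rule Min_le) (use fX' that in auto)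
  define T where "T = {x \<in> X'. deg E x = c}"
  have T: "T \<subseteq> X" "T \<noteq> {}" "x0 \<in> T" using X' x0 by (auto simp: T_def)
  have red: "row_sum TYPE('k) (T \<union> U) Y m = row_sum TYPE('k) T Y (m - int (card U))"
    if "finite U" "U \<subseteq> X' - T" for U m
    using that
  proof (induction U arbitrary: m rule: finite_induct)
    case (insert x U)
    have "deg E x0 < deg E x" using insert.prems cle[of x] x0 by (auto simp: T_def)
    moreover have "x0 \<in> X" "x \<in> X" using insert.prems X' x0 by auto
    ultimately have "row E x0 \<subseteq> row E x" using nn unfolding nearly_row_nested_def by blast
    then have "row_sum TYPE('k) (insert x (T \<union> U)) Y m = row_sum TYPE('k) (T \<union> U) Y (m - 1)"
      using insert T X' by (intro row_sum_dominating[of _ _ x0]) auto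
    then show ?case using insert by (simp add: algebra_simps)
  qed simp
  have U: "T \<union> (X' - T) = X'" by (auto simp: T_def)
  have card_U: "int (card X') = int (card T) + int (card (X' - T))"
    using fX' by (simp add: T_def card_Diff_subset card_mono)
  have eq: "row_sum TYPE('k) X' Y m = row_sum TYPE('k) T Y (m - int (card (X' - T)))"
    using red[of "X' - T" m] fX' unfolding U by simp
  show ?thesis
  proof (cases "c = 0")
    case True
    \<comment> \<open>An empty row is treated apart, since a core of size \<open>c - 1\<close> must
      satisfy \<open>Suc (card Z) = c\<close>.\<close>
    then have "row E x0 \<inter> Y = {}" using x0(2) finite_row by (simp add: deg_def)
    then show ?thesis using row_sum_empty_row[OF X'(1) x0(1), of Y m, where 'k = 'k] by simp
  next
    case False
    define I where "I = (\<Inter>x\<in>{x \<in> X. deg E x = c}. row E x)"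
    have "c \<in> deg E ` X" using x0 X' by auto
    then have "card I \<in> {c - 1, c}" using nn by (auto simp: nearly_row_nested_def I_def)
    \<comment> \<open>If all shortest rows coincide, their intersection has \<open>c\<close>
      elements and one of them is dropped, so both alternatives of the definition obey the same
      bound.\<close>
    then obtain Z where Z: "Z \<subseteq> I" "card Z = c - 1"
      using obtain_subset_with_card_n[of "c - 1" I] by (metis diff_le_self insert_iff order.refl singletonD)
    have sc: "Suc (card Z) = c" using Z False by simp
    have "row_sum TYPE('k) T Y (m - int (card (X' - T))) \<le>
      (if int (card T) \<le> m - int (card (X' - T))
       then Suc (card Z) choose nat (m - int (card (X' - T)) + 1 - int (card T)) else 0)"
    proof (rule row_sum_common_core[OF T(1,2)])
      show "Z \<subseteq> row E x" if "x \<in> T" for x using that Z X' by (auto simp: T_def I_def)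
      show "card (row E x) = Suc (card Z)" if "x \<in> T" for x
        using that sc by (simp add: T_def deg_def)
    qed
    moreover have 1: "int (card T) \<le> m - int (card (X' - T)) \<longleftrightarrow> int (card X') \<le> m"
      and 2: "m - int (card (X' - T)) + 1 - int (card T) = m + 1 - int (card X')"
      unfolding card_U by auto
    ultimately show ?thesis unfolding eq c_def[symmetric] sc 1 2 by blast
  qed
qed

lemma mindeg_obtain:
  assumes "X' \<subseteq> X" "X' \<noteq> {}"
  obtains x0 where "x0 \<in> X'" "deg E x0 = mindeg E X'" "\<And>x. x \<in> X' \<Longrightarrow> deg E x0 \<le> deg E x"
proof -
  have fX': "finite X'" using assms finite_XY by (auto intro: finite_subset)
  have "Min (deg E ` X') \<in> deg E ` X'" by (rule Min_in) (use fX' assms in auto)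
  then obtain x0 where "x0 \<in> X'" "deg E x0 = Min (deg E ` X')" by auto
  with fX' assms that[of x0] show ?thesis by (simp add: mindeg_def)
qed

text \<open>With \<open>s = i + 2 - card X'\<close> the weight \<open>card X' - 1 + s\<close>
  becomes \<open>i + 1\<close>, and \<open>card X' < i + 2\<close> says that the sets
  \<open>A\<close> of size \<open>s\<close> are nonempty.\<close>

lemma row_betti_ge:
  assumes X': "X' \<subseteq> X"
  shows "(if card X' < i + 2 then mindeg E X' choose (i + 2 - card X') else 0) \<le>
    row_betti TYPE('k::field) X Y E i X'"
proof (cases "X' = {}")
  case True
  then show ?thesis by (simp add: mindeg_def)
next
  case False
  obtain x0 where x0: "x0 \<in> X'" "deg E x0 = mindeg E X'" "\<And>x. x \<in> X' \<Longrightarrow> deg E x0 \<le> deg E x"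
    using mindeg_obtain[OF X' False] by blast
  show ?thesis
  proof (cases "card X' < i + 2")
    case True
    have 1: "int (card X') - 1 + int (i + 2 - card X') = int i + 1" using True by simp
    have "1 \<le> i + 2 - card X'" using True by simp
    from choose_le_row_sum[OF X' x0(1,3) this, where 'k = 'k] show ?thesis
      unfolding row_betti_eq_row_sum[OF X'] 1 x0(2) using True by simp
  qed simp
qed

lemma row_betti_nearly_nested:
  assumes "nearly_row_nested X E" and X': "X' \<subseteq> X"
  shows "row_betti TYPE('k::field) X Y E i X' =
    (if card X' < i + 2 then mindeg E X' choose (i + 2 - card X') else 0)"
proof (rule antisym)
  show "row_betti TYPE('k) X Y E i X' \<le> (if card X' < i + 2 then mindeg E X' choose (i + 2 - card X') else 0)"
  proof (cases "X' = {}")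
    case True
    then show ?thesis
      using row_sum_no_rows[OF finite_XY(2), of "int i + 1", where 'k = 'k] by (simp add: row_betti_eq_row_sum)
  next
    case False
    have 1: "int (card X') \<le> int i + 1 \<longleftrightarrow> card X' < i + 2" by auto
    have 2: "nat (int i + 1 + 1 - int (card X')) = i + 2 - card X'" by simp
    show ?thesis
      using row_sum_nearly_nested_le[OF assms False, of "int i + 1", where 'k = 'k]
      unfolding row_betti_eq_row_sum[OF X'] 1 2 .
  qed
qed (rule row_betti_ge[OF X'])

section \<open>Testing near nestedness on two and three rows\<close>

lemma h_two_private:
  assumes "{x0, x1} \<subseteq> X" "y0 \<in> row E x0 - row E x1" "y1 \<in> row E x1 - row E x0"
  shows "h TYPE('k::field) {x0, x1} {y0, y1} 0 = 1"
proof -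
  have "h TYPE('k) {x0, x1} {y0, y1} 0 = (if (0 :: int) = 0 then 1 else 0)"
    by (rule h_private_columns[OF assms(1)]) (use assms(2,3) in \<open>auto simp: row_def\<close>)
  then show ?thesis by simp
qed

text \<open>Within the columns \<open>y0\<close>, \<open>y1\<close> the row of \<open>x2\<close>
  contains that of \<open>x0\<close>, so adding \<open>x2\<close> shifts the class of the two
  private columns by one.\<close>

lemma h_three:
  assumes "{x0, x1, x2} \<subseteq> X" "x2 \<noteq> x0" "x2 \<noteq> x1"
    and "y0 \<in> row E x0 - row E x1" "y1 \<in> row E x1 - row E x0" "y0 \<in> row E x2" "y1 \<in> row E x2"
  shows "h TYPE('k::field) {x0, x1, x2} {y0, y1} 1 = 1"
proof -
  have "h TYPE('k) (insert x2 {x0, x1}) {y0, y1} 1 = h TYPE('k) {x0, x1} {y0, y1} (1 - 1)"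
    by (rule h_insert_dominating[where ?x0.0 = x0]) (use assms in auto)
  then show ?thesis
    using h_two_private[of x0 x1 y0 y1, where 'k = 'k] assms by (simp add: insert_commute)
qed

lemma card_le_row_sum:
  assumes "\<S> \<subseteq> Pow Y" and "\<And>Y'. Y' \<in> \<S> \<Longrightarrow> h TYPE('k::field) X' Y' (m - int (card Y')) = 1"
  shows "card \<S> \<le> row_sum TYPE('k) X' Y m"
proof -
  have "card \<S> = (\<Sum>Y'\<in>\<S>. h TYPE('k) X' Y' (m - int (card Y')))"
    using assms(2) by simp
  also have "\<dots> \<le> row_sum TYPE('k) X' Y m"
    unfolding row_sum_def by (rule sum_mono2) (use assms(1) finite_XY in auto)
  finally show ?thesis .
qed

text \<open>A common column gives the complex of two points, and a pair of private columns, one from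
  each row, gives the complex of the empty set. Both have weight 2.\<close>

lemma row_sum_two_ge:
  assumes X': "{x0, x1} \<subseteq> X" "x0 \<noteq> x1"
  shows "card (row E x0 \<inter> row E x1) + card (row E x0 - row E x1) * card (row E x1 - row E x0) \<le>
    row_sum TYPE('k::field) {x0, x1} Y 2"
proof -
  let ?A = "row E x0 \<inter> row E x1" and ?B = "row E x0 - row E x1" and ?C = "row E x1 - row E x0"
  define \<S>1 where "\<S>1 = (\<lambda>y. {y}) ` ?A"
  define \<S>2 where "\<S>2 = (\<lambda>(y, z). {y, z}) ` (?B \<times> ?C)"
  have "card \<S>1 = card ?A" unfolding \<S>1_def by (rule card_image) (auto simp: inj_on_def)
  moreover have "card \<S>2 = card ?B * card ?C"
    unfolding \<S>2_def by (subst card_image) (auto simp: inj_on_def doubleton_eq_iff card_cartesian_product)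
  moreover have "\<S>1 \<inter> \<S>2 = {}" by (auto simp: \<S>1_def \<S>2_def)
  moreover have "finite \<S>1" "finite \<S>2" using finite_row by (auto simp: \<S>1_def \<S>2_def)
  ultimately have "card (\<S>1 \<union> \<S>2) = card ?A + card ?B * card ?C" by (simp add: card_Un_disjoint)
  moreover have "card (\<S>1 \<union> \<S>2) \<le> row_sum TYPE('k) {x0, x1} Y 2"
  proof (rule card_le_row_sum)
    show "\<S>1 \<union> \<S>2 \<subseteq> Pow Y" using row_subset by (fastforce simp: \<S>1_def \<S>2_def)
    fix Y' assume "Y' \<in> \<S>1 \<union> \<S>2"
    then consider y where "Y' = {y}" "y \<in> ?A" | y z where "Y' = {y, z}" "y \<in> ?B" "z \<in> ?C"
      by (auto simp: \<S>1_def \<S>2_def)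
    then show "h TYPE('k) {x0, x1} Y' (2 - int (card Y')) = 1"
    proof cases
      case 1
      have "h TYPE('k) {x0, x1} {y} 1 = (if (1 :: int) = int (card {x0, x1}) - 1 then 1 else 0)"
        by (rule h_full_columns) (use 1 X' in \<open>auto simp: row_def\<close>)
      then show ?thesis using 1 X' by simp
    next
      case 2
      then have "y \<noteq> z" by auto
      then show ?thesis using 2 h_two_private[OF X'(1), of y z, where 'k = 'k] by simp
    qed
  qed
  ultimately show ?thesis by simp
qed

text \<open>
  Three rows of size \<open>c\<close> pairwise meeting in \<open>c - 1\<close> points without a common core of size \<open>c - 1\<close>
  are the complements of three single points \<open>b\<close>, \<open>a\<close>, \<open>d\<close> in a set of size \<open>c + 1\<close>.
\<close>

lemma row_sum_three_ge:
  assumes X': "{x0, x1, x2} \<subseteq> X" "x0 \<noteq> x1" "x0 \<noteq> x2" "x1 \<noteq> x2"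
    and rows: "row E x0 = insert a (insert d K)" "row E x1 = insert b (insert d K)" "row E x2 = insert a (insert b K)"
    and K: "a \<notin> K" "b \<notin> K" "d \<notin> K" "a \<noteq> b" "a \<noteq> d" "b \<noteq> d"
  shows "deg E x0 < row_sum TYPE('k::field) {x0, x1, x2} Y 3"
proof -
  have fK: "finite K" using finite_row[of x0] rows by simp
  \<comment> \<open>The singletons of \<open>K\<close> and the three pairs number
    \<open>card K + 3\<close>, one more than the size \<open>card K + 2\<close> of the rows.\<close>
  define \<S> where "\<S> = (\<lambda>y. {y}) ` K \<union> {{a, b}, {a, d}, {b, d}}"
  have "card \<S> = card ((\<lambda>y. {y}) ` K) + card {{a, b}, {a, d}, {b, d}}"
    unfolding \<S>_def using K fK by (intro card_Un_disjoint) auto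
  also have "\<dots> = card K + 3"
    using K by (subst card_image) (auto simp: doubleton_eq_iff inj_on_def)
  also have "\<dots> = Suc (deg E x0)" using rows K fK by (simp add: deg_def)
  finally have "card \<S> = Suc (deg E x0)" .
  moreover have "card \<S> \<le> row_sum TYPE('k) {x0, x1, x2} Y 3"
  proof (rule card_le_row_sum)
    show "\<S> \<subseteq> Pow Y" using row_subset[of x0] row_subset[of x1] rows by (auto simp: \<S>_def)
    fix Y' assume "Y' \<in> \<S>"
    then consider y where "Y' = {y}" "y \<in> K" | "Y' = {a, b}" | "Y' = {d, a}" | "Y' = {d, b}"
      by (auto simp: \<S>_def insert_commute)
    then show "h TYPE('k) {x0, x1, x2} Y' (3 - int (card Y')) = 1"
    proof cases
      case 1
      have "h TYPE('k) {x0, x1, x2} {y} 2 = (if (2 :: int) = int (card {x0, x1, x2}) - 1 then 1 else 0)"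
        by (rule h_full_columns) (use 1 X' rows in \<open>auto simp: row_def\<close>)
      then show ?thesis using 1 X' by simp
    next
      case 2
      then show ?thesis
        using h_three[of x0 x1 x2 a b, where 'k = 'k] X' rows K by simp
    next
      case 3
      have "h TYPE('k) {x1, x2, x0} {d, a} 1 = 1"
        by (rule h_three) (use X' rows K in auto)
      then show ?thesis using 3 K by (simp add: insert_commute)
    next
      case 4
      have "h TYPE('k) {x0, x2, x1} {d, b} 1 = 1"
        by (rule h_three) (use X' rows K in auto)
      then show ?thesis using 4 K by (simp add: insert_commute)
    qed
  qed
  ultimately show ?thesis by simp
qed

text \<open>For two rows with \<open>a\<close> common and \<open>b \<le> c\<close> private columns,
  \<open>a + b * c \<le> a + b\<close> forces \<open>b = 0\<close> or \<open>b = c = 1\<close>: the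
  rows are nested or differ by exchanging one element. Three rows then rule out exchanges without a
  common core.\<close>

lemma nearly_row_nestedI:
  assumes two: "\<And>x0 x1. {x0, x1} \<subseteq> X \<Longrightarrow> x0 \<noteq> x1 \<Longrightarrow> deg E x0 \<le> deg E x1 \<Longrightarrow>
      row_sum TYPE('k::field) {x0, x1} Y 2 \<le> deg E x0"
    and three: "\<And>x0 x1 x2. {x0, x1, x2} \<subseteq> X \<Longrightarrow> x0 \<noteq> x1 \<Longrightarrow> x0 \<noteq> x2 \<Longrightarrow> x1 \<noteq> x2 \<Longrightarrow>
      deg E x0 = deg E x1 \<Longrightarrow> deg E x0 = deg E x2 \<Longrightarrow>
      row_sum TYPE('k) {x0, x1, x2} Y 3 \<le> deg E x0"
  shows "nearly_row_nested X E"
proof -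
  have pair: "row E x0 \<subseteq> row E x1 \<or>
      (\<exists>a b. row E x0 - row E x1 = {a} \<and> row E x1 - row E x0 = {b})"
    if x: "x0 \<in> X" "x1 \<in> X" "deg E x0 \<le> deg E x1" for x0 x1
  proof (cases "x0 = x1")
    case False
    let ?a = "card (row E x0 \<inter> row E x1)" and ?b = "card (row E x0 - row E x1)" and ?c = "card (row E x1 - row E x0)"
    have d0: "deg E x0 = ?a + ?b"
      unfolding deg_def by (metis finite_row card_Int_Diff)
    have d1: "deg E x1 = ?a + ?c"
      unfolding deg_def by (metis finite_row card_Int_Diff Int_commute)
    have "?a + ?b * ?c \<le> deg E x0"
      by (rule order.trans[OF row_sum_two_ge two]) (use x False in auto)
    then have "?a + ?b * ?c \<le> ?a + ?b" by (simp only: d0)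
    then have "?b * ?c \<le> ?b" by simp
    then consider "?b = 0" | "?b = 1" "?c = 1"
      using x(3) d0 d1 by (cases "?b = 0") auto
    then show ?thesis
    proof cases
      case 1
      then show ?thesis using finite_row by auto
    next
      case 2
      then show ?thesis by (auto simp: card_1_singleton_iff)
    qed
  qed simp
  have lt: "row E x \<subset> row E x'" if x: "x \<in> X" "x' \<in> X" "deg E x < deg E x'" for x x'
  proof -
    have "row E x \<subseteq> row E x'"
    proof (rule ccontr)
      assume "\<not> row E x \<subseteq> row E x'"
      then obtain a b where "row E x - row E x' = {a}" "row E x' - row E x = {b}"
        using pair[OF x(1,2)] x(3) by auto
      then have "card (row E x - row E x') = card (row E x' - row E x)" by simp
      then have "card (row E x) = card (row E x')"
        by (metis finite_row card_Int_Diff Int_commute)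
      then show False using x(3) by (simp add: deg_def)
    qed
    then show ?thesis using x(3) by (auto simp: deg_def)
  qed
  have core: "card (\<Inter>x\<in>{x \<in> X. deg E x = c}. row E x) \<in> {c - 1, c}" if c: "c \<in> deg E ` X" for c
  proof -
    let ?T = "{x \<in> X. deg E x = c}"
    let ?I = "\<Inter>x\<in>?T. row E x"
    obtain x0 where x0: "x0 \<in> ?T" using c by auto
    show ?thesis
    proof (cases "\<forall>x\<in>?T. row E x = row E x0")
      case True
      then have "row E ` ?T = {row E x0}" using x0 by blast
      then show ?thesis using x0 by (simp add: deg_def)
    next
      case False
      then obtain x1 where x1: "x1 \<in> ?T" "row E x1 \<noteq> row E x0" by auto
      have pT: "row E x = row E x' \<or> (\<exists>a b. row E x - row E x' = {a} \<and> row E x' - row E x = {b})"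
        if "x \<in> ?T" "x' \<in> ?T" for x x'
      proof (cases "row E x \<subseteq> row E x'")
        case True
        then show ?thesis using card_subset_eq[OF finite_row True] that by (simp add: deg_def)
      next
        case False
        then show ?thesis using pair[of x x'] that by simp
      qed
      obtain a b where ab: "row E x0 - row E x1 = {a}" "row E x1 - row E x0 = {b}"
        using pT[OF x0 x1(1)] x1(2) by auto
      let ?C = "row E x0 \<inter> row E x1"
      have "card (row E x0) = card ?C + card (row E x0 - row E x1)"
        by (metis finite_row card_Int_Diff)
      then have cC: "Suc (card ?C) = c" using ab x0 by (simp add: deg_def)
      \<comment> \<open>A row of the same size that misses some \<open>d\<close> in
        \<open>?C\<close> exchanges exactly \<open>d\<close> against each of the rows of
        \<open>x0\<close> and \<open>x1\<close>. It then contains \<open>a\<close> and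
        \<open>b\<close>, which is the forbidden configuration of three rows.\<close>
      have "?C \<subseteq> row E x2" if x2: "x2 \<in> ?T" for x2
      proof (rule ccontr)
        assume "\<not> ?C \<subseteq> row E x2"
        then obtain d where d: "d \<in> ?C" "d \<notin> row E x2" by auto
        have "row E x0 \<noteq> row E x2" "d \<in> row E x0 - row E x2" using d by auto
        then obtain p where p: "row E x0 - row E x2 = {d}" "row E x2 - row E x0 = {p}"
          using pT[OF x0 x2] by (metis singletonD)
        have "row E x1 \<noteq> row E x2" "d \<in> row E x1 - row E x2" using d by auto
        then obtain q where q: "row E x1 - row E x2 = {d}" "row E x2 - row E x1 = {q}"
          using pT[OF x1(1) x2] by (metis singletonD)
        have ab2: "a \<in> row E x2" "b \<in> row E x2" using ab p q d by auto
        have K: "row E x0 = insert a (insert d (?C - {d}))" "row E x1 = insert b (insert d (?C - {d}))"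
          using ab d by auto
        have K2: "row E x2 = insert a (insert b (?C - {d}))"
        proof -
          have "p = b" using ab ab2 p by auto
          then show ?thesis using ab ab2 p d by blast
        qed
        have ne: "x0 \<noteq> x1" "x0 \<noteq> x2" "x1 \<noteq> x2" using x1(2) d by auto
        have "a \<notin> ?C - {d}" "b \<notin> ?C - {d}" "d \<notin> ?C - {d}" "a \<noteq> b" "a \<noteq> d" "b \<noteq> d"
          using ab d by auto
        then have "deg E x0 < row_sum TYPE('k) {x0, x1, x2} Y 3"
          by (intro row_sum_three_ge[OF _ ne K K2]) (use x0 x1 x2 in auto)
        moreover have "row_sum TYPE('k) {x0, x1, x2} Y 3 \<le> deg E x0"
          by (rule three[OF _ ne]) (use x0 x1 x2 in auto)
        ultimately show False by simp
      qed
      then have "?I = ?C" using x0 x1 by auto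
      then show ?thesis using cC by auto
    qed
  qed
  show ?thesis
    unfolding nearly_row_nested_def using lt core by (intro conjI ballI impI)
qed

text \<open>At \<open>i = card X' - 1\<close> the binomial is \<open>mindeg E X' choose 1\<close>,
  so the tests on two and three rows read off the indices 1 and 2.\<close>

lemma row_betti_eq_imp_nearly_nested:
  assumes eq: "\<And>i X'. X' \<subseteq> X \<Longrightarrow> row_betti TYPE('k::field) X Y E i X' =
    (if card X' < i + 2 then mindeg E X' choose (i + 2 - card X') else 0)"
  shows "nearly_row_nested X E"
proof (rule nearly_row_nestedI[where 'k = 'k])
  fix x0 x1 assume x: "{x0, x1} \<subseteq> X" "x0 \<noteq> x1" "deg E x0 \<le> deg E x1"
  then show "row_sum TYPE('k) {x0, x1} Y 2 \<le> deg E x0"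
    using eq[OF x(1), of 1] by (simp add: row_betti_eq_row_sum mindeg_def)
next
  fix x0 x1 x2 assume x: "{x0, x1, x2} \<subseteq> X" "x0 \<noteq> x1" "x0 \<noteq> x2" "x1 \<noteq> x2"
    "deg E x0 = deg E x1" "deg E x0 = deg E x2"
  then show "row_sum TYPE('k) {x0, x1, x2} Y 3 \<le> deg E x0"
    using eq[OF x(1), of 2] by (simp add: row_betti_eq_row_sum mindeg_def)
qed

section \<open>Horizontal and horizontal-vertical graphs\<close>

lemma horizontal_rows_disjoint:
  assumes "horizontal E" "x \<noteq> x'"
  shows "row E x \<inter> row E x' = {}"
proof (rule ccontr)
  assume "row E x \<inter> row E x' \<noteq> {}"
  then obtain y where "(x, y) \<in> E" "(x', y) \<in> E" by (auto simp: row_def)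
  moreover from this have "column E y = {x}" "column E y = {x'}"
    using assms(1) by (auto simp: horizontal_def)
  ultimately show False using assms(2) by simp
qed

lemma row_sum_horizontal_insert:
  assumes "horizontal E" "insert x X' \<subseteq> X" "x \<notin> X'"
  shows "row_sum TYPE('k::field) (insert x X') Y m =
    (\<Sum>A\<in>Pow (row E x) - {{}}. row_sum TYPE('k) X' Y (m - int (card A)))"
  using assms by (intro row_sum_insert_disjoint horizontal_rows_disjoint) auto

text \<open>If the row of \<open>x\<close> meets another row in a column \<open>y\<close>, neither
  cell is alone in that column, so both rows are \<open>{y}\<close>. The new row then dominates the
  old one, and the sum on the right has the single term \<open>A = {y}\<close>.\<close>

lemma row_sum_horizontal_vertical_insert:
  assumes hv: "horizontal_vertical E" and x: "insert x X' \<subseteq> X" "x \<notin> X'"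
  shows "row_sum TYPE('k::field) (insert x X') Y m =
    (\<Sum>A\<in>Pow (row E x) - {{}}. row_sum TYPE('k) X' Y (m - int (card A)))"
proof (cases "\<forall>x'\<in>X'. row E x \<inter> row E x' = {}")
  case True
  then show ?thesis by (intro row_sum_insert_disjoint[OF x]) auto
next
  case False
  then obtain x' y where x': "x' \<in> X'" and y: "(x, y) \<in> E" "(x', y) \<in> E" by (auto simp: row_def)
  have "x \<noteq> x'" using x' x(2) by auto
  then have "column E y \<noteq> {x}" "column E y \<noteq> {x'}" using y by (auto simp: column_def)
  then have r: "row E x = {y}" "row E x' = {y}" using hv y unfolding horizontal_vertical_def by auto
  have "row_sum TYPE('k) (insert x X') Y m = row_sum TYPE('k) X' Y (m - 1)"
    using r by (intro row_sum_dominating[OF x x']) auto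
  moreover have "Pow {y} - {{}} = {{y}}" by auto
  ultimately show ?thesis using r by simp
qed

text \<open>Subsets with \<open>x\<close> contribute the nonempty \<open>A\<close> in the row of
  \<open>x\<close>, and those without \<open>x\<close> supply \<open>A = {}\<close>. Only together
  do they give the full power set that Vandermonde's identity requires.\<close>

lemma sum_row_sum_horizontal:
  assumes hor: "horizontal E" and "finite X'" "X' \<subseteq> X"
  shows "(\<Sum>X''\<in>Pow X'. row_sum TYPE('k::field) X'' Y m) =
    (if 0 \<le> m then (\<Sum>x\<in>X'. deg E x) choose nat m else 0)"
  using assms(2,3)
proof (induction X' arbitrary: m rule: finite_induct)
  case empty
  then show ?case using finite_XY by (auto simp: row_sum_no_rows)
next
  case (insert x X')
  let ?D = "\<Sum>x\<in>X'. deg E x"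
  let ?t = "\<lambda>m. if 0 \<le> m then ?D choose nat m else 0"
  have IH: "(\<Sum>X''\<in>Pow X'. row_sum TYPE('k) X'' Y m) = ?t m" for m
    using insert by auto
  have "(\<Sum>X''\<in>Pow X'. row_sum TYPE('k) (insert x X'') Y m) =
      (\<Sum>X''\<in>Pow X'. \<Sum>A\<in>Pow (row E x) - {{}}. row_sum TYPE('k) X'' Y (m - int (card A)))"
    by (intro sum.cong refl row_sum_horizontal_insert[OF hor]) (use insert in auto)
  also have "\<dots> = (\<Sum>A\<in>Pow (row E x) - {{}}. ?t (m - int (card A)))"
    by (subst sum.swap) (simp add: IH)
  finally have "(\<Sum>X''\<in>Pow (insert x X'). row_sum TYPE('k) X'' Y m) =
      ?t m + (\<Sum>A\<in>Pow (row E x) - {{}}. ?t (m - int (card A)))"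
    by (simp add: sum_Pow_insert[OF insert.hyps] IH)
  also have "?t m + (\<Sum>A\<in>Pow (row E x) - {{}}. ?t (m - int (card A))) = (\<Sum>A\<in>Pow (row E x). ?t (m - int (card A)))"
    by (subst sum_Pow_nonempty[OF finite_row]) simp
  also have "\<dots> = (\<Sum>A\<in>Pow (row E x). if int (card A) \<le> m then ?D choose nat (m - int (card A)) else 0)"
    by (rule sum.cong) auto
  also have "\<dots> = (if 0 \<le> m then (?D + deg E x) choose nat m else 0)"
    unfolding deg_def by (rule sum_mult_Pow_choose[OF finite_row])
  finally show ?case using insert.hyps by (simp add: add.commute)
qed

lemma sum_row_betti_horizontal:
  assumes hor: "horizontal E" and X': "X' \<subseteq> X"
  shows "(\<Sum>X''\<in>Pow X'. row_betti TYPE('k::field) X Y E i X'') = (\<Sum>x\<in>X'. deg E x) choose (i + 1)"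
proof -
  have "(\<Sum>X''\<in>Pow X'. row_betti TYPE('k) X Y E i X'') = (\<Sum>X''\<in>Pow X'. row_sum TYPE('k) X'' Y (int i + 1))"
    using X' by (intro sum.cong refl row_betti_eq_row_sum) auto
  also have "\<dots> = (\<Sum>x\<in>X'. deg E x) choose nat (int i + 1)"
    using sum_row_sum_horizontal[OF hor _ X', of "int i + 1", where 'k = 'k] X' finite_XY
    by (auto intro: finite_subset)
  also have "nat (int i + 1) = i + 1" by simp
  finally show ?thesis .
qed

end

text \<open>The recursion bound for \<open>E\<close> is the exact recursion for \<open>E'\<close>:
  its summands depend on \<open>A\<close> only through \<open>card A\<close>, and corresponding rows
  have equal size. For horizontal-vertical \<open>E\<close> the bound is itself an equality.\<close>

lemma row_sum_le_horizontal:
  fixes E :: "('a::linorder \<times> 'b::linorder) set" and E' :: "('a \<times> 'c::linorder) set"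
  assumes G: "bipartite X Y E" and H: "bipartite X Y' E'" and hor: "horizontal E'"
    and deg: "\<And>x. x \<in> X \<Longrightarrow> deg E' x = deg E x" and X': "finite X'" "X' \<subseteq> X"
  shows "bipartite.row_sum X Y E TYPE('k::field) X' Y m \<le> bipartite.row_sum X Y' E' TYPE('k) X' Y' m"
    and "horizontal_vertical E \<Longrightarrow>
      bipartite.row_sum X Y E TYPE('k::field) X' Y m = bipartite.row_sum X Y' E' TYPE('k) X' Y' m"
proof -
  interpret G: bipartite X Y E by (rule G)
  interpret H: bipartite X Y' E' by (rule H)
  have card: "(\<Sum>A\<in>Pow (row E x) - {{}}. f (card A)) = (\<Sum>A\<in>Pow (row E' x) - {{}}. f (card A))"
    if "x \<in> X" for f :: "nat \<Rightarrow> nat" and x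
    using deg[OF that] by (intro sum_Pow_card G.finite_row H.finite_row) (simp add: deg_def)
  show "G.row_sum TYPE('k) X' Y m \<le> H.row_sum TYPE('k) X' Y' m"
    using X'
  proof (induction X' arbitrary: m rule: finite_induct)
    case empty
    then show ?case using G.finite_XY H.finite_XY by (simp add: G.row_sum_no_rows H.row_sum_no_rows)
  next
    case (insert x X')
    have "G.row_sum TYPE('k) (insert x X') Y m \<le>
        (\<Sum>A\<in>Pow (row E x) - {{}}. G.row_sum TYPE('k) X' Y (m - int (card A)))"
      by (rule G.row_sum_insert_le(1)[OF insert.prems insert.hyps(2) order.refl])
        (use G.row_subset in auto)
    also have "\<dots> \<le> (\<Sum>A\<in>Pow (row E x) - {{}}. H.row_sum TYPE('k) X' Y' (m - int (card A)))"
      using insert by (intro sum_mono) auto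
    also have "\<dots> = (\<Sum>A\<in>Pow (row E' x) - {{}}. H.row_sum TYPE('k) X' Y' (m - int (card A)))"
      using insert.prems by (intro card) auto
    also have "\<dots> = H.row_sum TYPE('k) (insert x X') Y' m"
      by (rule H.row_sum_horizontal_insert[OF hor insert.prems insert.hyps(2), symmetric])
    finally show ?case .
  qed
  assume hv: "horizontal_vertical E"
  show "G.row_sum TYPE('k) X' Y m = H.row_sum TYPE('k) X' Y' m"
    using X'
  proof (induction X' arbitrary: m rule: finite_induct)
    case empty
    then show ?case using G.finite_XY H.finite_XY by (simp add: G.row_sum_no_rows H.row_sum_no_rows)
  next
    case (insert x X')
    have "G.row_sum TYPE('k) (insert x X') Y m =
        (\<Sum>A\<in>Pow (row E x) - {{}}. G.row_sum TYPE('k) X' Y (m - int (card A)))"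
      by (rule G.row_sum_horizontal_vertical_insert[OF hv insert.prems insert.hyps(2)])
    also have "\<dots> = (\<Sum>A\<in>Pow (row E x) - {{}}. H.row_sum TYPE('k) X' Y' (m - int (card A)))"
      using insert by (intro sum.cong) auto
    also have "\<dots> = (\<Sum>A\<in>Pow (row E' x) - {{}}. H.row_sum TYPE('k) X' Y' (m - int (card A)))"
      using insert.prems by (intro card) auto
    also have "\<dots> = H.row_sum TYPE('k) (insert x X') Y' m"
      by (rule H.row_sum_horizontal_insert[OF hor insert.prems insert.hyps(2), symmetric])
    finally show ?case .
  qed
qed

lemma row_sum_less_horizontal:
  fixes E :: "('a::linorder \<times> 'b::linorder) set" and E' :: "('a \<times> 'c::linorder) set"
  assumes G: "bipartite X Y E" and H: "bipartite X Y' E'" and hor: "horizontal E'"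
    and deg: "\<And>x. x \<in> X \<Longrightarrow> deg E' x = deg E x" and nhv: "\<not> horizontal_vertical E"
  shows "\<exists>X'\<subseteq>X. bipartite.row_sum X Y E TYPE('k::field) X' Y 2 < bipartite.row_sum X Y' E' TYPE('k) X' Y' 2"
proof -
  interpret G: bipartite X Y E by (rule G)
  interpret H: bipartite X Y' E' by (rule H)
  obtain x y where xy: "(x, y) \<in> E" "column E y \<noteq> {x}" "row E x \<noteq> {y}"
    using nhv by (auto simp: horizontal_vertical_def)
  \<comment> \<open>Two cells in the column of \<open>y\<close> and two in the row of
    \<open>x\<close>: the rows \<open>x\<close>, \<open>x'\<close> at weight 2, that is Betti index
    1, already detect this.\<close>
  then obtain x' y' where x': "(x', y) \<in> E" "x' \<noteq> x" and y': "(x, y') \<in> E" "y' \<noteq> y"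
    by (auto simp: column_def row_def)
  have X: "insert x {x'} \<subseteq> X" "x \<notin> {x'}" and yY: "y \<in> Y" using xy x' G.finite_XY by auto
  have R: "row E x = row E x \<inter> Y" using G.row_subset by auto
  have lt: "G.row_sum TYPE('k) {x'} (Y - row E x) (2 - 1) < G.row_sum TYPE('k) {x'} Y (2 - 1)"
  proof -
    \<comment> \<open>The column \<open>y\<close> carries a class for the row \<open>x'\<close>
      alone; restricting the columns to those outside the row of \<open>x\<close> loses it.\<close>
    have 1: "G.h TYPE('k) {x'} {y} 0 = 1"
      using G.h_full_columns[of "{x'}" "{y}" 0, where 'k = 'k] X x' by simp
    have "G.row_sum TYPE('k) {x'} (Y - row E x) 1 < (\<Sum>S\<in>insert {y} (Pow (Y - row E x)). G.h TYPE('k) {x'} S (1 - int (card S)))"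
      using xy G.finite_XY 1 by (subst sum.insert) (auto simp: G.row_sum_def row_def)
    also have "\<dots> \<le> G.row_sum TYPE('k) {x'} Y 1"
      unfolding G.row_sum_def by (rule sum_mono2) (use yY G.finite_XY in auto)
    finally show ?thesis by simp
  qed
  have "G.row_sum TYPE('k) (insert x {x'}) Y 2 <
      (\<Sum>A\<in>Pow (row E x) - {{}}. G.row_sum TYPE('k) {x'} Y (2 - int (card A)))"
    by (rule G.row_sum_insert_le(2)[OF X order.refl R, of y y'])
      (use xy y' lt in \<open>auto simp: row_def\<close>)
  also have "\<dots> \<le> (\<Sum>A\<in>Pow (row E x) - {{}}. H.row_sum TYPE('k) {x'} Y' (2 - int (card A)))"
    by (intro sum_mono row_sum_le_horizontal(1)[OF G H hor deg]) (use X in auto)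
  also have "\<dots> = (\<Sum>A\<in>Pow (row E' x) - {{}}. H.row_sum TYPE('k) {x'} Y' (2 - int (card A)))"
    using deg[of x] X by (intro sum_Pow_card G.finite_row H.finite_row) (simp add: deg_def)
  also have "\<dots> = H.row_sum TYPE('k) (insert x {x'}) Y' 2"
    by (rule H.row_sum_horizontal_insert[OF hor X, symmetric])
  finally show ?thesis using X by blast
qed

section \<open>The graphs with prescribed row sizes\<close>

text \<open>Makes the formula for row-nested graphs an instance of the nearly nested one: nested
  rows of equal size coincide.\<close>

lemma row_nested_imp_nearly:
  assumes "finite E" "row_nested X E"
  shows "nearly_row_nested X E"
proof -
  have fin: "finite (row E x)" for x
    using finite_subset[of "row E x" "snd ` E"] assms(1) by (force simp: row_def)
  have lt: "row E x \<subset> row E x'" if "x \<in> X" "x' \<in> X" "deg E x < deg E x'" for x x'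
  proof -
    have "\<not> row E x' \<subseteq> row E x" using that(3) card_mono[OF fin, of "row E x'" x] by (auto simp: deg_def)
    then show ?thesis using assms(2) that(1,2) unfolding row_nested_def by blast
  qed
  have eq: "row E x = row E x'" if "x \<in> X" "x' \<in> X" "deg E x = deg E x'" for x x'
    using assms(2) that card_subset_eq[OF fin, of "row E x" x'] card_subset_eq[OF fin, of "row E x'" x]
    unfolding row_nested_def deg_def by metis
  have "card (\<Inter>x\<in>{x \<in> X. deg E x = c}. row E x) \<in> {c - 1, c}" if c: "c \<in> deg E ` X" for c
  proof -
    obtain x0 where x0: "x0 \<in> X" "deg E x0 = c" using c by auto
    have "row E ` {x \<in> X. deg E x = c} \<subseteq> {row E x0}"
    proof
      fix R assume "R \<in> row E ` {x \<in> X. deg E x = c}"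
      then obtain x where "x \<in> X" "deg E x = c" "R = row E x" by auto
      then show "R \<in> {row E x0}" using eq[of x x0] x0 by simp
    qed
    then have "row E ` {x \<in> X. deg E x = c} = {row E x0}" using x0 by blast
    then show ?thesis using x0 by (simp add: deg_def)
  qed
  with lt show ?thesis unfolding nearly_row_nested_def by blast
qed

lemma is_R_exists:
  fixes E :: "('a \<times> 'b) set"
  assumes "finite X"
  shows "\<exists>(Y'' :: nat set) R. is_R X E Y'' R"
proof -
  define R where "R = {(x, y :: nat). x \<in> X \<and> y < deg E x}"
  have row: "row R x = {..<deg E x}" if "x \<in> X" for x using that by (auto simp: R_def row_def)
  have "R = Sigma X (\<lambda>x. {..<deg E x})" by (auto simp: R_def)
  then have "finite (snd ` R)" using assms by simp
  moreover have "R \<subseteq> X \<times> snd ` R" by (force simp: R_def)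
  moreover have "row_nested X R" by (auto simp: row_nested_def row)
  moreover have "deg R x = deg E x" if "x \<in> X" for x using row[OF that] by (simp add: deg_def)
  ultimately have "is_R X E (snd ` R) R" using assms by (simp add: is_R_def bipartite_graph_def)
  then show ?thesis by blast
qed

lemma is_H_exists:
  fixes E :: "(nat \<times> 'b) set"
  assumes "finite X"
  shows "\<exists>(Y'' :: nat set) H. is_H X E Y'' H"
proof -
  \<comment> \<open>\<open>prod_encode\<close> gives every cell a column of its own within
    \<open>nat\<close>.\<close>
  define H where "H = {(x, prod_encode (x, j)) | x j. x \<in> X \<and> j < deg E x}"
  have row: "row H x = (\<lambda>j. prod_encode (x, j)) ` {..<deg E x}" if "x \<in> X" for x
    using that by (auto simp: H_def row_def)
  have "H = (\<lambda>(x, j). (x, prod_encode (x, j))) ` Sigma X (\<lambda>x. {..<deg E x})" by (auto simp: H_def)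
  then have "finite (snd ` H)" using assms by simp
  moreover have "H \<subseteq> X \<times> snd ` H" by (force simp: H_def)
  moreover have "horizontal H" by (auto simp: horizontal_def column_def H_def prod_encode_eq)
  moreover have "deg H x = deg E x" if "x \<in> X" for x
    unfolding deg_def[of H] row[OF that] by (subst card_image) (auto simp: inj_on_def prod_encode_eq)
  ultimately have "is_H X E (snd ` H) H" using assms by (simp add: is_H_def bipartite_graph_def)
  then show ?thesis by blast
qed

text \<open>The common induction step of both uniqueness proofs: new columns may be matched
  arbitrarily, and only the part of the new row inside the columns already seen must be
  respected.\<close>

lemma extend_column_bij:
  fixes R1 :: "'a \<Rightarrow> 'b set" and R2 :: "'a \<Rightarrow> 'c set"
  assumes f: "bij_betw f (\<Union>x\<in>S. R1 x) (\<Union>x\<in>S. R2 x)" "\<And>z. z \<in> S \<Longrightarrow> f ` R1 z = R2 z"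
    and fin: "finite (R1 x)" "finite (R2 x)"
    and card: "card (R1 x - (\<Union>x\<in>S. R1 x)) = card (R2 x - (\<Union>x\<in>S. R2 x))"
    and old: "f ` (R1 x \<inter> (\<Union>x\<in>S. R1 x)) = R2 x \<inter> (\<Union>x\<in>S. R2 x)"
  shows "\<exists>g. bij_betw g (\<Union>z\<in>insert x S. R1 z) (\<Union>z\<in>insert x S. R2 z) \<and> (\<forall>z\<in>insert x S. g ` R1 z = R2 z)"
proof -
  let ?U1 = "\<Union>x\<in>S. R1 x" and ?U2 = "\<Union>x\<in>S. R2 x"
  obtain e where e: "bij_betw e (R1 x - ?U1) (R2 x - ?U2)"
    using finite_same_card_bij[OF _ _ card] fin by auto
  define g where "g y = (if y \<in> ?U1 then f y else e y)" for y
  have gf: "bij_betw g ?U1 ?U2" using f(1) by (subst bij_betw_cong[of _ _ f]) (auto simp: g_def)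
  have ge: "bij_betw g (R1 x - ?U1) (R2 x - ?U2)" using e by (subst bij_betw_cong[of _ _ e]) (auto simp: g_def)
  have "bij_betw g (?U1 \<union> (R1 x - ?U1)) (?U2 \<union> (R2 x - ?U2))"
    by (rule bij_betw_combine[OF gf ge]) auto
  moreover have "?U1 \<union> (R1 x - ?U1) = (\<Union>z\<in>insert x S. R1 z)" "?U2 \<union> (R2 x - ?U2) = (\<Union>z\<in>insert x S. R2 z)"
    by auto
  moreover have "g ` R1 z = R2 z" if "z \<in> insert x S" for z
  proof (cases "z \<in> S")
    case True
    have "g ` R1 z = f ` R1 z" by (rule image_cong) (use True in \<open>auto simp: g_def\<close>)
    then show ?thesis using f(2) True by simp
  next
    case False
    then have z: "z = x" using that by auto
    have "g ` (R1 x \<inter> ?U1) = f ` (R1 x \<inter> ?U1)" by (rule image_cong) (auto simp: g_def)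
    then have "g ` (R1 x \<inter> ?U1) = R2 x \<inter> ?U2" using old by simp
    moreover have "g ` (R1 x - ?U1) = R2 x - ?U2" using ge by (auto simp: bij_betw_def)
    moreover have "R1 x = (R1 x \<inter> ?U1) \<union> (R1 x - ?U1)" by auto
    ultimately have "g ` R1 x = (R2 x \<inter> ?U2) \<union> (R2 x - ?U2)" by (metis image_Un)
    then show ?thesis using z by auto
  qed
  ultimately show ?thesis by (metis (no_types, lifting))
qed

lemma column_isomorphicI:
  fixes R1 :: "('a \<times> 'b) set" and R2 :: "('a \<times> 'c) set"
  assumes sub: "Domain R1 \<subseteq> X" "Domain R2 \<subseteq> X"
    and g: "bij_betw g (\<Union>x\<in>X. row R1 x) (\<Union>x\<in>X. row R2 x)" "\<And>x. x \<in> X \<Longrightarrow> g ` row R1 x = row R2 x"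
  shows "column_isomorphic R1 R2"
proof -
  have "(\<Union>x\<in>X. row R1 x) = Range R1" "(\<Union>x\<in>X. row R2 x) = Range R2"
    using sub by (auto simp: row_def)
  then have "bij_betw g (Range R1) (Range R2)" using g(1) by simp
  moreover have "R2 = {(x, g y) | x y. (x, y) \<in> R1}"
  proof (intro equalityI subsetI)
    fix p assume "p \<in> R2"
    then obtain x z where p: "p = (x, z)" "z \<in> row R2 x" "x \<in> X" using sub by (cases p) (auto simp: row_def)
    then have "z \<in> g ` row R1 x" using g(2) by simp
    then show "p \<in> {(x, g y) | x y. (x, y) \<in> R1}" using p by (auto simp: row_def)
  next
    fix p assume "p \<in> {(x, g y) | x y. (x, y) \<in> R1}"
    then obtain x y where p: "p = (x, g y)" "(x, y) \<in> R1" by auto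
    then have "x \<in> X" "g y \<in> g ` row R1 x" using sub by (auto simp: row_def)
    then have "g y \<in> row R2 x" using g(2) by simp
    then show "p \<in> R2" using p by (simp add: row_def)
  qed
  ultimately show ?thesis unfolding column_isomorphic_def by blast
qed

lemma finite_row_bipartite: "bipartite_graph X Y E \<Longrightarrow> finite (row E x)"
  unfolding bipartite_graph_def row_def by (rule finite_subset[of _ Y]) auto

lemma is_H_unique:
  assumes H1: "is_H X E Y1 H1" and H2: "is_H X E Y2 H2"
  shows "column_isomorphic H1 H2"
proof -
  have b: "bipartite_graph X Y1 H1" "bipartite_graph X Y2 H2" and hor: "horizontal H1" "horizontal H2"
    and deg: "\<And>x. x \<in> X \<Longrightarrow> deg H1 x = deg H2 x"
    using H1 H2 by (auto simp: is_H_def)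
  have dis1: "row H1 x \<inter> row H1 x' = {}" if "x \<noteq> x'" for x x'
    using hor(1) that by (auto simp: horizontal_def row_def column_def)
  have dis2: "row H2 x \<inter> row H2 x' = {}" if "x \<noteq> x'" for x x'
    using hor(2) that by (auto simp: horizontal_def row_def column_def)
  have "finite X" using b(1) by (simp add: bipartite_graph_def)
  then have "\<exists>g. bij_betw g (\<Union>x\<in>X. row H1 x) (\<Union>x\<in>X. row H2 x) \<and> (\<forall>x\<in>X. g ` row H1 x = row H2 x)"
    using deg
  proof (induction X rule: finite_induct)
    case empty
    then show ?case by (auto simp: bij_betw_def)
  next
    case (insert x S)
    then obtain f where f: "bij_betw f (\<Union>x\<in>S. row H1 x) (\<Union>x\<in>S. row H2 x)" "\<And>z. z \<in> S \<Longrightarrow> f ` row H1 z = row H2 z"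
      by auto
    have "row H1 x \<inter> row H1 z = {}" if "z \<in> S" for z
      using dis1[of x z] insert.hyps that by auto
    then have e1: "row H1 x \<inter> (\<Union>x\<in>S. row H1 x) = {}" by blast
    have "row H2 x \<inter> row H2 z = {}" if "z \<in> S" for z
      using dis2[of x z] insert.hyps that by auto
    then have e2: "row H2 x \<inter> (\<Union>x\<in>S. row H2 x) = {}" by blast
    show ?case
      by (rule extend_column_bij[OF f])
        (use insert.prems[of x] e1 e2 b in \<open>auto simp: finite_row_bipartite deg_def Diff_triv\<close>)
  qed
  then show ?thesis
    using b by (auto simp: bipartite_graph_def intro!: column_isomorphicI[of H1 X H2])
qed

lemma is_R_unique:
  assumes R1: "is_R X E Y1 R1" and R2: "is_R X E Y2 R2"
  shows "column_isomorphic R1 R2"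
proof -
  have b: "bipartite_graph X Y1 R1" "bipartite_graph X Y2 R2" and nes: "row_nested X R1" "row_nested X R2"
    and deg: "\<And>x. x \<in> X \<Longrightarrow> deg R1 x = deg E x" "\<And>x. x \<in> X \<Longrightarrow> deg R2 x = deg E x"
    using R1 R2 by (auto simp: is_R_def)
  have max: "row R z \<subseteq> row R x"
    if "bipartite_graph X Y' R" "row_nested X R" "x \<in> X" "z \<in> X" "deg R z \<le> deg R x" for R :: "('a \<times> 'z) set" and Y' x z
  proof (rule ccontr)
    assume n: "\<not> row R z \<subseteq> row R x"
    then have "row R x \<subset> row R z" using that unfolding row_nested_def by blast
    then have "card (row R x) < card (row R z)"
      by (rule psubset_card_mono[OF finite_row_bipartite[OF that(1)]])
    then show False using that(5) by (simp add: deg_def)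
  qed
  have "finite X" using b(1) by (simp add: bipartite_graph_def)
  define P where "P S \<longleftrightarrow> (\<exists>g. bij_betw g (\<Union>x\<in>S. row R1 x) (\<Union>x\<in>S. row R2 x) \<and> (\<forall>x\<in>S. g ` row R1 x = row R2 x))" for S
  have "S \<subseteq> X \<longrightarrow> P S" if "finite S" for S
    using that
  \<comment> \<open>Rows enter by increasing degree, so each new row contains all columns seen
    before and the compatibility condition is automatic.\<close>
  proof (induction S rule: finite_ranking_induct[where f = "deg E"])
    case empty
    then show ?case by (auto simp: bij_betw_def P_def)
  next
    case (insert x S)
    show ?case
    proof
      assume sub: "insert x S \<subseteq> X"
      let ?U1 = "\<Union>z\<in>S. row R1 z" and ?U2 = "\<Union>z\<in>S. row R2 z"
      obtain f where f: "bij_betw f ?U1 ?U2" "\<And>z. z \<in> S \<Longrightarrow> f ` row R1 z = row R2 z"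
        using insert sub by (auto simp: P_def)
      have U1: "?U1 \<subseteq> row R1 x"
        using max[OF b(1) nes(1), of x] deg(1) insert sub by (intro UN_least) auto
      have U2: "?U2 \<subseteq> row R2 x"
        using max[OF b(2) nes(2), of x] deg(2) insert sub by (intro UN_least) auto
      have fin: "finite (row R1 x)" "finite (row R2 x)" using b by (auto intro: finite_row_bipartite)
      have "card (row R1 x) = card (row R2 x)" using deg[of x] sub by (simp add: deg_def)
      then have "card (row R1 x - ?U1) = card (row R2 x - ?U2)"
        using U1 U2 fin bij_betw_same_card[OF f(1)] by (simp add: card_Diff_subset finite_subset)
      moreover have "f ` (row R1 x \<inter> ?U1) = row R2 x \<inter> ?U2"
        using U1 U2 f(1) by (simp add: Int_absorb1 bij_betw_def)
      ultimately show "P (insert x S)"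
        unfolding P_def by (intro extend_column_bij[OF f fin])
    qed
  qed
  then have "P X" using \<open>finite X\<close> by blast
  then obtain g where "bij_betw g (\<Union>x\<in>X. row R1 x) (\<Union>x\<in>X. row R2 x)" "\<And>x. x \<in> X \<Longrightarrow> g ` row R1 x = row R2 x"
    unfolding P_def by blast
  then show ?thesis
    using b by (auto simp: bipartite_graph_def intro!: column_isomorphicI[of R1 X R2])
qed

theorem corollary4p20:
  fixes D G :: "(nat \<times> nat) set" and X Y :: "nat set"
  assumes "shifted_skew_diagram D"
    and "finite X" "0 \<notin> X"
    and "finite Y" "0 \<notin> Y"
    and "G = bip_diagram X Y D"
  shows
    "(\<exists>(Y\<^sub>R :: nat set) R. is_R X G Y\<^sub>R R) \<and>
     (\<forall>(Y\<^sub>1 :: nat set) R\<^sub>1 (Y\<^sub>2 :: nat set) R\<^sub>2.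
        is_R X G Y\<^sub>1 R\<^sub>1 \<and> is_R X G Y\<^sub>2 R\<^sub>2 \<longrightarrow> column_isomorphic R\<^sub>1 R\<^sub>2) \<and>
     (\<exists>(Y\<^sub>H :: nat set) H. is_H X G Y\<^sub>H H) \<and>
     (\<forall>(Y\<^sub>1 :: nat set) H\<^sub>1 (Y\<^sub>2 :: nat set) H\<^sub>2.
        is_H X G Y\<^sub>1 H\<^sub>1 \<and> is_H X G Y\<^sub>2 H\<^sub>2 \<longrightarrow> column_isomorphic H\<^sub>1 H\<^sub>2) \<and>
     (\<forall>(Y\<^sub>R :: nat set) R (Y\<^sub>H :: nat set) H. is_R X G Y\<^sub>R R \<and> is_H X G Y\<^sub>H H \<longrightarrow>
        (\<forall>i. \<forall>X'\<subseteq>X.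
           row_betti TYPE('k::field) X Y\<^sub>R R i X' \<le> row_betti TYPE('k) X Y G i X' \<and>
           row_betti TYPE('k) X Y G i X' \<le> row_betti TYPE('k) X Y\<^sub>H H i X' \<and>
           row_betti TYPE('k) X Y\<^sub>R R i X' =
             (if card X' < i + 2 then mindeg G X' choose (i + 2 - card X') else 0) \<and>
           (\<Sum>X''\<in>Pow X'. row_betti TYPE('k) X Y\<^sub>H H i X'') = (\<Sum>x\<in>X'. deg G x) choose (i + 1)) \<and>
        ((\<forall>i. \<forall>X'\<subseteq>X. row_betti TYPE('k) X Y\<^sub>R R i X' = row_betti TYPE('k) X Y G i X')
           \<longleftrightarrow> nearly_row_nested X G) \<and>
        ((\<forall>i. \<forall>X'\<subseteq>X. row_betti TYPE('k) X Y G i X' = row_betti TYPE('k) X Y\<^sub>H H i X')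
           \<longleftrightarrow> horizontal_vertical G))"
proof -
  have G: "bipartite X Y G"
    using assms by (auto simp: bipartite_def bipartite_graph_def bip_diagram_def)
  interpret G: bipartite X Y G by (rule G)
  have main:
    "(\<forall>i. \<forall>X'\<subseteq>X.
       row_betti TYPE('k) X Y\<^sub>R R i X' \<le> row_betti TYPE('k) X Y G i X' \<and>
       row_betti TYPE('k) X Y G i X' \<le> row_betti TYPE('k) X Y\<^sub>H H i X' \<and>
       row_betti TYPE('k) X Y\<^sub>R R i X' =
         (if card X' < i + 2 then mindeg G X' choose (i + 2 - card X') else 0) \<and>
       (\<Sum>X''\<in>Pow X'. row_betti TYPE('k) X Y\<^sub>H H i X'') = (\<Sum>x\<in>X'. deg G x) choose (i + 1)) \<and>
     ((\<forall>i. \<forall>X'\<subseteq>X. row_betti TYPE('k) X Y\<^sub>R R i X' = row_betti TYPE('k) X Y G i X')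
       \<longleftrightarrow> nearly_row_nested X G) \<and>
     ((\<forall>i. \<forall>X'\<subseteq>X. row_betti TYPE('k) X Y G i X' = row_betti TYPE('k) X Y\<^sub>H H i X')
       \<longleftrightarrow> horizontal_vertical G)"
    if R: "is_R X G Y\<^sub>R R" and H: "is_H X G Y\<^sub>H H" for Y\<^sub>R Y\<^sub>H :: "nat set" and R H
  proof -
    have bR: "bipartite X Y\<^sub>R R" and degR: "\<And>x. x \<in> X \<Longrightarrow> deg R x = deg G x" and nest: "row_nested X R"
      using R by (auto simp: is_R_def bipartite_def)
    have bH: "bipartite X Y\<^sub>H H" and degH: "\<And>x. x \<in> X \<Longrightarrow> deg H x = deg G x" and hor: "horizontal H"
      using H by (auto simp: is_H_def bipartite_def)
    interpret R: bipartite X Y\<^sub>R R by (rule bR)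
    interpret H: bipartite X Y\<^sub>H H by (rule bH)
    have "finite R" using R.finite_XY by (auto intro: finite_subset)
    then have nn: "nearly_row_nested X R" using nest by (rule row_nested_imp_nearly)
    have mindeg: "mindeg R X' = mindeg G X'" if "X' \<subseteq> X" for X'
      using that degR by (auto simp: mindeg_def intro!: arg_cong[of _ _ Min] image_cong)
    have bettiR: "row_betti TYPE('k) X Y\<^sub>R R i X' =
        (if card X' < i + 2 then mindeg G X' choose (i + 2 - card X') else 0)" if "X' \<subseteq> X" for i X'
      using R.row_betti_nearly_nested[OF nn that, of i, where 'k = 'k] mindeg[OF that] by simp
    have fin: "finite X'" if "X' \<subseteq> X" for X' using that assms(2) by (rule finite_subset)
    have bettiH: "(\<Sum>X''\<in>Pow X'. row_betti TYPE('k) X Y\<^sub>H H i X'') = (\<Sum>x\<in>X'. deg G x) choose (i + 1)"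
      if "X' \<subseteq> X" for i X'
    proof -
      have "(\<Sum>x\<in>X'. deg H x) = (\<Sum>x\<in>X'. deg G x)" using that degH by (intro sum.cong) auto
      then show ?thesis using H.sum_row_betti_horizontal[OF hor that, of i, where 'k = 'k] by simp
    qed
    have lower: "row_betti TYPE('k) X Y\<^sub>R R i X' \<le> row_betti TYPE('k) X Y G i X'" if "X' \<subseteq> X" for i X'
      unfolding bettiR[OF that] by (rule G.row_betti_ge[OF that])
    have upper: "row_betti TYPE('k) X Y G i X' \<le> row_betti TYPE('k) X Y\<^sub>H H i X'" if "X' \<subseteq> X" for i X'
      unfolding G.row_betti_eq_row_sum[OF that] H.row_betti_eq_row_sum[OF that]
      by (rule row_sum_le_horizontal(1)[OF G bH hor degH fin[OF that] that])
    have eqR: "(\<forall>i. \<forall>X'\<subseteq>X. row_betti TYPE('k) X Y\<^sub>R R i X' = row_betti TYPE('k) X Y G i X')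
       \<longleftrightarrow> nearly_row_nested X G"
    proof
      assume eq: "\<forall>i. \<forall>X'\<subseteq>X. row_betti TYPE('k) X Y\<^sub>R R i X' = row_betti TYPE('k) X Y G i X'"
      show "nearly_row_nested X G"
      proof (rule G.row_betti_eq_imp_nearly_nested[where 'k = 'k])
        show "row_betti TYPE('k) X Y G i X' =
            (if card X' < i + 2 then mindeg G X' choose (i + 2 - card X') else 0)" if "X' \<subseteq> X" for i X'
          using eq that bettiR[OF that, of i] by simp
      qed
    next
      assume "nearly_row_nested X G"
      then show "\<forall>i. \<forall>X'\<subseteq>X. row_betti TYPE('k) X Y\<^sub>R R i X' = row_betti TYPE('k) X Y G i X'"
        using bettiR G.row_betti_nearly_nested[where 'k = 'k] by simp
    qed
    have eqH: "(\<forall>i. \<forall>X'\<subseteq>X. row_betti TYPE('k) X Y G i X' = row_betti TYPE('k) X Y\<^sub>H H i X')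
       \<longleftrightarrow> horizontal_vertical G"
    proof
      assume eq: "\<forall>i. \<forall>X'\<subseteq>X. row_betti TYPE('k) X Y G i X' = row_betti TYPE('k) X Y\<^sub>H H i X'"
      show "horizontal_vertical G"
      proof (rule ccontr)
        assume "\<not> horizontal_vertical G"
        from row_sum_less_horizontal[OF G bH hor degH this, where 'k = 'k]
        obtain X' where X': "X' \<subseteq> X" "G.row_sum TYPE('k) X' Y 2 < H.row_sum TYPE('k) X' Y\<^sub>H 2" by blast
        have "row_betti TYPE('k) X Y G 1 X' = row_betti TYPE('k) X Y\<^sub>H H 1 X'" using eq X'(1) by blast
        then show False
          using X' by (simp add: G.row_betti_eq_row_sum H.row_betti_eq_row_sum)
      qed
    next
      assume hv: "horizontal_vertical G"
      show "\<forall>i. \<forall>X'\<subseteq>X. row_betti TYPE('k) X Y G i X' = row_betti TYPE('k) X Y\<^sub>H H i X'"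
      proof (intro allI impI)
        fix i X' assume X': "X' \<subseteq> X"
        show "row_betti TYPE('k) X Y G i X' = row_betti TYPE('k) X Y\<^sub>H H i X'"
          unfolding G.row_betti_eq_row_sum[OF X'] H.row_betti_eq_row_sum[OF X']
          by (rule row_sum_le_horizontal(2)[OF G bH hor degH fin[OF X'] X' hv])
      qed
    qed
    show ?thesis
      by (intro conjI allI impI lower upper bettiR bettiH eqR eqH)
  qed
  show ?thesis
  proof (intro conjI)
    show "\<exists>(Y\<^sub>R :: nat set) R. is_R X G Y\<^sub>R R" by (rule is_R_exists[OF assms(2)])
    show "\<exists>(Y\<^sub>H :: nat set) H. is_H X G Y\<^sub>H H" by (rule is_H_exists[OF assms(2)])
    show "\<forall>(Y\<^sub>1 :: nat set) R\<^sub>1 (Y\<^sub>2 :: nat set) R\<^sub>2.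
        is_R X G Y\<^sub>1 R\<^sub>1 \<and> is_R X G Y\<^sub>2 R\<^sub>2 \<longrightarrow> column_isomorphic R\<^sub>1 R\<^sub>2"
      by (intro allI impI, elim conjE, rule is_R_unique)
    show "\<forall>(Y\<^sub>1 :: nat set) H\<^sub>1 (Y\<^sub>2 :: nat set) H\<^sub>2.
        is_H X G Y\<^sub>1 H\<^sub>1 \<and> is_H X G Y\<^sub>2 H\<^sub>2 \<longrightarrow> column_isomorphic H\<^sub>1 H\<^sub>2"
      by (intro allI impI, elim conjE, rule is_H_unique)
  qed (intro allI impI, elim conjE, rule main)
qed

end
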